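(* There exists a universal constant $C>0$ such that the following holds. Let $\mathcal{K}$ be the Koopman operator of a measure-preserving dynamical system, with spectral measure $\mathcal{E}$, and let $\mathbb{K}\in\mathbb{C}^{N\times N}$ be an mpEDMD matrix computed from a dictionary of size $N$ and $M$ snapshots, with Gram matrix $G$ and associated matrix-valued measure $\mathcal{E}_{N,M}$ (all defined in the context). Suppose that $\phi:\mathbb{T}\rightarrow\mathbb{R}$ is Lipschitz continuous with Lipschitz constant bounded by $1$. Then for any $L\in\mathbb{N}$, any $g\in L^2(\Omega,\omega)$ and any $\pmb{g}\in\mathbb{C}^N$, $$ \left\|\int_{\mathbb{T}} \phi(\lambda)\,d\mathcal{E}(\lambda)g-\Psi \int_{\mathbb{T}}\phi(\lambda)\,d\mathcal{E}_{N,M}(\lambda)\, \pmb{g}\right\|\leq C\left(\frac{\log(L)}{L}\left[\|g\|+\|\Psi G^{-1/2}\|\,\|G^{1/2}\pmb{g}\|_2\right]+\|g-\Psi\pmb{g}\|\,\|\phi\|_\infty+\sum_{1\leq l\leq L}\frac{\|\mathcal{K}^lg-\Psi\mathbb{K}^l\pmb{g}\|+\|(\mathcal{K}^* )^lg-\Psi\mathbb{K}^{-l}\pmb{g}\|}{l}\right). $$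
   Context: Setting. $\Omega\subseteq\mathbb{R}^d$, $\omega$ is a positive measure on $\Omega$, and $F:\Omega\to\Omega$ is measurable and preserves $\omega$. The Koopman operator $\mathcal{K}g=g\circ F$ is an isometry on $L^2(\Omega,\omega)$, whose inner product (linear in the first argument) and norm are $\langle\cdot,\cdot\rangle$ and $\|\cdot\|$. $\mathbb{T}$ is the unit circle in $\mathbb{C}$. Spectral measure of $\mathcal{K}$. There is a unitary operator $\mathcal{K}'$ on a Hilbert space $\mathcal{H}'\supseteq L^2(\Omega,\omega)$ (closed subspace) with $\mathcal{K}'|_{L^2(\Omega,\omega)}=\mathcal{K}$. Let $\mathcal{E}'$ be the projection-valued spectral measure of $\mathcal{K}'$ on $\mathbb{T}$ and $\mathcal{P}:\mathcal{H}'\to L^2(\Omega,\omega)$ the orthogonal projection. The spectral measure of $\mathcal{K}$ is $\mathcal{E}(U)=\mathcal{P}\mathcal{E}'(U)\mathcal{P}^*$, $U\subset\mathbb{T}$ Borel; it does not depend on the choice of unitary extension. If $\mathcal{K}$ is unitary it is the usual spectral measure of $\mathcal{K}$. mpEDMD. The dictionary is $\psi_1,\dots,\psi_N\in L^2(\Omega,\omega)$, $\Psi(\pmb{x})=[\psi_1(\pmb{x})\ \cdots\ \psi_N(\pmb{x})]$, and for $\pmb{c}\in\mathbb{C}^N$, $\Psi\pmb{c}=\sum_j c_j\psi_j\in L^2(\Omega,\omega)$. Thus for $B\in\mathbb{C}^{N\times N}$, $\Psi B$ is the linear map $\pmb{c}\mapsto\Psi(B\pmb{c})$ from $\mathbb{C}^N$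 to $L^2(\Omega,\omega)$, and $\|\Psi B\|$ is its operator norm with respect to the Euclidean norm $\|\cdot\|_2$ on $\mathbb{C}^N$ and the $L^2(\Omega,\omega)$ norm. The data are points $\pmb{x}^{(m)}\in\Omega$, $\pmb{y}^{(m)}=F(\pmb{x}^{(m)})$, $m=1,\dots,M$, with quadrature weights $w_m\ge 0$; $W=\mathrm{diag}(w_1,\dots,w_M)$. $\Psi_X,\Psi_Y\in\mathbb{C}^{M\times N}$ are the matrices whose $m$th rows are $\Psi(\pmb{x}^{(m)})$ and $\Psi(\pmb{y}^{(m)})$. Put $G=\Psi_X^*W\Psi_X$ and $A=\Psi_X^*W\Psi_Y$; $G$ is assumed invertible (hence Hermitian positive definite). Take any singular value decomposition $G^{-1/2}A^*G^{-1/2}=U_1\Sigma U_2^*$ with $U_1,U_2$ unitary, and set $\mathbb{K}=G^{-1/2}U_2U_1^*G^{1/2}$. Take an eigendecomposition $U_2U_1^*=\hat V\Lambda\hat V^*$ with $\hat V$ unitary and $\Lambda=\mathrm{diag}(\lambda_1,\dots,\lambda_N)$, and let $v_j$ be the $j$th column of $V=G^{-1/2}\hat V$, so that $\mathbb{K}v_j=\lambda_jv_j$. The measure $\mathcal{E}_{N,M}$ is the $\mathbb{C}^{N\times N}$-valued measure $\mathcal{E}_{N,M}=\sum_{j=1}^N v_jv_j^*G\,\delta_{\lambda_j}$ ($\delta_\lambda$ the Dirac measure at $\lambda$), so $\int_{\mathbb{T}}\phi\,d\mathcal{E}_{N,M}\,\pmb{g}=\sum_j\phi(\lambda_j)v_jv_j^*G\pmb{g}$.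 Lipschitz constants on $\mathbb{T}$ are with respect to $|\lambda-\lambda'|$, and $\|\phi\|_\infty=\sup_{\mathbb{T}}|\phi|$.
   Formalization: The bound is proved for L ≥ 2: at L = 1 the term log(L)/L vanishes and the bound fails for every C (cyclic shift on at least 4 points, dictionary {Kg, g, K*g}, φ(z) = Re(z²)/2), and L = 0 is meaningless. *)

theory Defs
  imports
    "HOL-Analysis.Analysis"
    "HOL-Library.Function_Algebras"
    "Jordan_Normal_Form.Schur_Decomposition"
    "Jordan_Normal_Form.Gauss_Jordan_Elimination"
begin

unbundle no vec_syntax

section \<open>Complex inner product spaces on a carrier\<close>

text \<open>
  The constant of the theorem has to be uniform in all spaces involved, so spaces are
  carriers inside fixed types and not types.  Addition is that of the ambient type.
  The record carries no axioms, since it also has to represent the space of square-integrable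
  functions, whose elements below are functions and not classes modulo null functions, so that
  its inner product is only semi-definite.
\<close>

record 'v cips =
  vecs :: "'v set"
  smul :: "complex \<Rightarrow> 'v \<Rightarrow> 'v"
  ip :: "'v \<Rightarrow> 'v \<Rightarrow> complex"

definition hnorm :: "'v cips \<Rightarrow> 'v \<Rightarrow> real" where
  "hnorm H x = sqrt (Re (ip H x x))"

definition hilbert_space :: "'v::ab_group_add cips \<Rightarrow> bool" where
  "hilbert_space H \<longleftrightarrow>
     vector_space (smul H) \<and> module.subspace (smul H) (vecs H) \<and>
     (\<forall>x\<in>vecs H. \<forall>y\<in>vecs H. \<forall>z\<in>vecs H. ip H (x + y) z = ip H x z + ip H y z) \<and>
     (\<forall>a. \<forall>x\<in>vecs H. \<forall>y\<in>vecs H. ip H (smul H a x) y = a * ip H x y) \<and>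
     (\<forall>x\<in>vecs H. \<forall>y\<in>vecs H. ip H y x = cnj (ip H x y)) \<and>
     (\<forall>x\<in>vecs H. 0 \<le> Re (ip H x x)) \<and>
     (\<forall>x\<in>vecs H. ip H x x = 0 \<longrightarrow> x = 0) \<and>
     (\<forall>X. (\<forall>n. X n \<in> vecs H) \<and>
          (\<forall>e>0. \<exists>n0::nat. \<forall>m\<ge>n0. \<forall>n\<ge>n0. hnorm H (X m - X n) < e) \<longrightarrow>
          (\<exists>x\<in>vecs H. (\<lambda>n. hnorm H (X n - x)) \<longlonglongrightarrow> 0))"

definition linear_map ::
    "'v::ab_group_add cips \<Rightarrow> 'w::ab_group_add cips \<Rightarrow> ('v \<Rightarrow> 'w) \<Rightarrow> bool" where
  "linear_map H H' T \<longleftrightarrow>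
     T ` vecs H \<subseteq> vecs H' \<and>
     (\<forall>x\<in>vecs H. \<forall>y\<in>vecs H. T (x + y) = T x + T y) \<and>
     (\<forall>a. \<forall>x\<in>vecs H. T (smul H a x) = smul H' a (T x))"

definition linear_isometry ::
    "'v::ab_group_add cips \<Rightarrow> 'w::ab_group_add cips \<Rightarrow> ('v \<Rightarrow> 'w) \<Rightarrow> bool" where
  "linear_isometry H H' T \<longleftrightarrow>
     linear_map H H' T \<and> (\<forall>x\<in>vecs H. \<forall>y\<in>vecs H. ip H' (T x) (T y) = ip H x y)"

definition unitary_operator :: "'v::ab_group_add cips \<Rightarrow> ('v \<Rightarrow> 'v) \<Rightarrow> bool" where
  "unitary_operator H T \<longleftrightarrow> linear_isometry H H T \<and> T ` vecs H = vecs H"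

definition orthogonal_projection :: "'v::ab_group_add cips \<Rightarrow> ('v \<Rightarrow> 'v) \<Rightarrow> bool" where
  "orthogonal_projection H T \<longleftrightarrow>
     linear_map H H T \<and> (\<forall>x\<in>vecs H. T (T x) = T x) \<and>
     (\<forall>x\<in>vecs H. \<forall>y\<in>vecs H. ip H (T x) y = ip H x (T y))"

text \<open>For a bounded \<open>T\<close>, the value of the adjoint is determined up to vectors of norm zero.\<close>

definition hadjoint :: "'v cips \<Rightarrow> ('v \<Rightarrow> 'v) \<Rightarrow> 'v \<Rightarrow> 'v" where
  "hadjoint H T y = (SOME z. z \<in> vecs H \<and> (\<forall>x\<in>vecs H. ip H (T x) y = ip H x z))"


section \<open>Operator-valued measures on the unit circle\<close>

abbreviation circle :: "complex set" where
  "circle \<equiv> sphere 0 1"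

abbreviation circle_borel :: "complex measure" where
  "circle_borel \<equiv> restrict_space borel circle"

definition projection_valued_measure ::
    "'v::ab_group_add cips \<Rightarrow> (complex set \<Rightarrow> 'v \<Rightarrow> 'v) \<Rightarrow> bool" where
  "projection_valued_measure H E \<longleftrightarrow>
     (\<forall>U\<in>sets circle_borel. orthogonal_projection H (E U)) \<and>
     (\<forall>x\<in>vecs H. E {} x = 0 \<and> E circle x = x) \<and>
     (\<forall>U\<in>sets circle_borel. \<forall>V\<in>sets circle_borel. \<forall>x\<in>vecs H. E (U \<inter> V) x = E U (E V x)) \<and>
     (\<forall>U::nat \<Rightarrow> complex set. range U \<subseteq> sets circle_borel \<and> disjoint_family U \<longrightarrow>
        (\<forall>x\<in>vecs H. (\<lambda>n. hnorm H ((\<Sum>k<n. E (U k) x) - E (\<Union>k. U k) x)) \<longlonglongrightarrow> 0))"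

definition simple_spectral_integral ::
    "'v::ab_group_add cips \<Rightarrow> (complex set \<Rightarrow> 'v \<Rightarrow> 'v) \<Rightarrow> (complex \<Rightarrow> complex) \<Rightarrow> 'v \<Rightarrow> 'v" where
  "simple_spectral_integral H E s x =
     (\<Sum>z\<in>s ` circle. smul H z (E {t \<in> circle. s t = z} x))"

text \<open>
  \<open>\<integral> f dE x\<close> for bounded Borel \<open>f\<close>: the limit of the integrals of simple functions
  converging to \<open>f\<close> uniformly on the circle.  It is applied to bounded Borel \<open>f\<close> only
  (otherwise no simple function is uniformly close to \<open>f\<close> and every \<open>y\<close> qualifies).
  In a semi-definite space the value is unique up to vectors of norm zero.
\<close>

definition has_spectral_integral ::
    "'v::ab_group_add cips \<Rightarrow> (complex set \<Rightarrow> 'v \<Rightarrow> 'v) \<Rightarrow> (complex \<Rightarrow> complex) \<Rightarrow> 'v \<Rightarrow> 'v \<Rightarrow> bool"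
  where
  "has_spectral_integral H E f x y \<longleftrightarrow>
     y \<in> vecs H \<and>
     (\<forall>e>0. \<exists>\<delta>>0. \<forall>s. simple_function circle_borel s \<and> (\<forall>t\<in>circle. cmod (s t - f t) < \<delta>) \<longrightarrow>
        hnorm H (simple_spectral_integral H E s x - y) < e)"

definition spectral_integral ::
    "'v::ab_group_add cips \<Rightarrow> (complex set \<Rightarrow> 'v \<Rightarrow> 'v) \<Rightarrow> (complex \<Rightarrow> complex) \<Rightarrow> 'v \<Rightarrow> 'v" where
  "spectral_integral H E f x = (SOME y. has_spectral_integral H E f x y)"

definition spectral_measure_of_unitary ::
    "'v::ab_group_add cips \<Rightarrow> ('v \<Rightarrow> 'v) \<Rightarrow> (complex set \<Rightarrow> 'v \<Rightarrow> 'v) \<Rightarrow> bool" where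
  "spectral_measure_of_unitary H T E \<longleftrightarrow>
     projection_valued_measure H E \<and> (\<forall>x\<in>vecs H. has_spectral_integral H E (\<lambda>z. z) x (T x))"


section \<open>Koopman operators\<close>

text \<open>
  A point of \<open>\<real>\<^sup>d\<close> is an extensional function on \<open>{..<d}\<close>, so that \<open>d\<close> is an ordinary variable.
\<close>

type_synonym point = "nat \<Rightarrow> real"

definition measure_preserving_system :: "nat \<Rightarrow> point measure \<Rightarrow> (point \<Rightarrow> point) \<Rightarrow> bool" where
  "measure_preserving_system d \<omega> F \<longleftrightarrow>
     space \<omega> \<subseteq> (\<Pi>\<^sub>E i\<in>{..<d}. UNIV) \<and> F \<in> measurable \<omega> \<omega> \<and> distr \<omega> \<omega> F = \<omega>"

definition L2 :: "point measure \<Rightarrow> (point \<Rightarrow> complex) cips" where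
  "L2 \<omega> =
     \<lparr>vecs = {f \<in> borel_measurable \<omega>. integrable \<omega> (\<lambda>x. (cmod (f x))\<^sup>2)},
      smul = (\<lambda>a f x. a * f x),
      ip = (\<lambda>f g. \<integral>x. f x * cnj (g x) \<partial>\<omega>)\<rparr>"

definition koopman :: "(point \<Rightarrow> point) \<Rightarrow> (point \<Rightarrow> complex) \<Rightarrow> point \<Rightarrow> complex" where
  "koopman F g = g \<circ> F"

text \<open>
  \<open>J\<close> is the inclusion of the space of square-integrable functions in \<open>H'\<close>, and \<open>P\<close> is the
  orthogonal projection onto it.  The type of the vectors of \<open>H'\<close> is fixed but large enough for
  every system to have such an extension: for an isometry \<open>K\<close> on a Hilbert space \<open>H\<close> with
  \<open>D = (K H)\<^sup>\<bottom>\<close>, the map \<open>(h, d\<^sub>0, d\<^sub>1, \<dots>) \<mapsto> (K h + d\<^sub>0, d\<^sub>1, d\<^sub>2, \<dots>)\<close> is a unitary extension on the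
  direct sum of \<open>H\<close> and countably many copies of \<open>D\<close>, whose vectors are sequences of functions
  (with representatives chosen linearly in the classes modulo null functions).
\<close>

definition koopman_spectral_measure ::
    "point measure \<Rightarrow> (point \<Rightarrow> point) \<Rightarrow>
     (complex set \<Rightarrow> (point \<Rightarrow> complex) \<Rightarrow> (point \<Rightarrow> complex)) \<Rightarrow> bool" where
  "koopman_spectral_measure \<omega> F E \<longleftrightarrow>
     (\<exists>(H' :: (nat \<Rightarrow> point \<Rightarrow> complex) cips) K' E' J P.
        hilbert_space H' \<and> unitary_operator H' K' \<and>
        linear_isometry (L2 \<omega>) H' J \<and>
        (\<forall>g\<in>vecs (L2 \<omega>). K' (J g) = J (koopman F g)) \<and>
        spectral_measure_of_unitary H' K' E' \<and>
        (\<forall>h\<in>vecs H'. P h \<in> vecs (L2 \<omega>) \<and> (\<forall>g\<in>vecs (L2 \<omega>). ip H' (h - J (P h)) (J g) = 0)) \<and>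
        (\<forall>U\<in>sets circle_borel. \<forall>g\<in>vecs (L2 \<omega>). E U g = P (E' U (J g))))"


section \<open>mpEDMD\<close>

definition mat_inv :: "complex mat \<Rightarrow> complex mat" where
  "mat_inv B = the (mat_inverse B)"

definition vnorm :: "complex vec \<Rightarrow> real" where
  "vnorm c = sqrt (\<Sum>i<dim_vec c. (cmod (c $ i))\<^sup>2)"

definition unitary_matrix :: "nat \<Rightarrow> complex mat \<Rightarrow> bool" where
  "unitary_matrix n U \<longleftrightarrow>
     U \<in> carrier_mat n n \<and> U * mat_adjoint U = 1\<^sub>m n \<and> mat_adjoint U * U = 1\<^sub>m n"

definition positive_definite :: "nat \<Rightarrow> complex mat \<Rightarrow> bool" where
  "positive_definite n B \<longleftrightarrow>
     B \<in> carrier_mat n n \<and> mat_adjoint B = B \<and>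
     (\<forall>c\<in>carrier_vec n. c \<noteq> 0\<^sub>v n \<longrightarrow> 0 < Re ((B *\<^sub>v c) \<bullet>c c))"

definition is_matrix_sqrt :: "nat \<Rightarrow> complex mat \<Rightarrow> complex mat \<Rightarrow> bool" where
  "is_matrix_sqrt n G R \<longleftrightarrow> positive_definite n R \<and> R * R = G"

text \<open>The dictionary is \<open>\<psi> 0, \<dots>, \<psi> (N - 1)\<close>, and likewise for the snapshots.\<close>

definition Psi :: "nat \<Rightarrow> (nat \<Rightarrow> point \<Rightarrow> complex) \<Rightarrow> complex vec \<Rightarrow> point \<Rightarrow> complex" where
  "Psi N \<psi> c = (\<lambda>x. \<Sum>j<N. c $ j * \<psi> j x)"

definition Psi_opnorm ::
    "point measure \<Rightarrow> nat \<Rightarrow> (nat \<Rightarrow> point \<Rightarrow> complex) \<Rightarrow> complex mat \<Rightarrow> real" where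
  "Psi_opnorm \<omega> N \<psi> B =
     (SUP c\<in>{c \<in> carrier_vec N. vnorm c \<le> 1}. hnorm (L2 \<omega>) (Psi N \<psi> (B *\<^sub>v c)))"

definition data_matrix ::
    "nat \<Rightarrow> nat \<Rightarrow> (nat \<Rightarrow> point \<Rightarrow> complex) \<Rightarrow> (nat \<Rightarrow> point) \<Rightarrow> complex mat" where
  "data_matrix N M \<psi> x = mat M N (\<lambda>(m, j). \<psi> j (x m))"

definition weight_matrix :: "nat \<Rightarrow> (nat \<Rightarrow> real) \<Rightarrow> complex mat" where
  "weight_matrix M w = mat_diag M (\<lambda>m. complex_of_real (w m))"

definition gram_G ::
    "nat \<Rightarrow> nat \<Rightarrow> (nat \<Rightarrow> point \<Rightarrow> complex) \<Rightarrow> (nat \<Rightarrow> point) \<Rightarrow> (nat \<Rightarrow> real) \<Rightarrow> complex mat" where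
  "gram_G N M \<psi> x w =
     mat_adjoint (data_matrix N M \<psi> x) * weight_matrix M w * data_matrix N M \<psi> x"

definition cross_A ::
    "nat \<Rightarrow> nat \<Rightarrow> (nat \<Rightarrow> point \<Rightarrow> complex) \<Rightarrow> (nat \<Rightarrow> point) \<Rightarrow> (nat \<Rightarrow> point) \<Rightarrow> (nat \<Rightarrow> real) \<Rightarrow>
     complex mat" where
  "cross_A N M \<psi> x y w =
     mat_adjoint (data_matrix N M \<psi> x) * weight_matrix M w * data_matrix N M \<psi> y"

text \<open>
  \<open>R\<close> is \<open>G\<^bsup>1/2\<^esup>\<close>.  The singular values \<open>\<sigma>\<close> are not required to be sorted.
\<close>

definition mpedmd_factorization ::
    "nat \<Rightarrow> complex mat \<Rightarrow> complex mat \<Rightarrow> complex mat \<Rightarrow> complex mat \<Rightarrow> (nat \<Rightarrow> real) \<Rightarrow> complex mat \<Rightarrow>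
     complex mat \<Rightarrow> (nat \<Rightarrow> complex) \<Rightarrow> bool" where
  "mpedmd_factorization N G A R U1 \<sigma> U2 Vh lam \<longleftrightarrow>
     is_matrix_sqrt N G R \<and>
     unitary_matrix N U1 \<and> unitary_matrix N U2 \<and> (\<forall>i<N. 0 \<le> \<sigma> i) \<and>
     mat_inv R * mat_adjoint A * mat_inv R =
       U1 * mat_diag N (\<lambda>i. complex_of_real (\<sigma> i)) * mat_adjoint U2 \<and>
     unitary_matrix N Vh \<and>
     U2 * mat_adjoint U1 = Vh * mat_diag N lam * mat_adjoint Vh"

definition mpedmd_matrix :: "complex mat \<Rightarrow> complex mat \<Rightarrow> complex mat \<Rightarrow> complex mat" where
  "mpedmd_matrix R U1 U2 = mat_inv R * U2 * mat_adjoint U1 * R"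

definition outer_product :: "complex vec \<Rightarrow> complex mat" where
  "outer_product v = mat (dim_vec v) (dim_vec v) (\<lambda>(a, b). v $ a * cnj (v $ b))"

text \<open>
  The matrix-valued measure \<open>\<Sum>j. v\<^sub>j v\<^sub>j\<^sup>* G \<delta>\<^bsub>lam j\<^esub>\<close>, where \<open>v\<^sub>j\<close> is the \<open>j\<close>-th column of
  \<open>R\<^bsup>-1\<^esup> Vh\<close>, and integration against a matrix-valued measure carried by a finite set \<open>S\<close>.
\<close>

definition mpedmd_measure ::
    "nat \<Rightarrow> complex mat \<Rightarrow> complex mat \<Rightarrow> complex mat \<Rightarrow> (nat \<Rightarrow> complex) \<Rightarrow>
     complex set \<Rightarrow> complex mat" where
  "mpedmd_measure N G R Vh lam U =
     mat N N (\<lambda>(a, b). \<Sum>j | j < N \<and> lam j \<in> U.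
       (outer_product (col (mat_inv R * Vh) j) * G) $$ (a, b))"

definition atomic_integral ::
    "nat \<Rightarrow> complex set \<Rightarrow> (complex set \<Rightarrow> complex mat) \<Rightarrow> (complex \<Rightarrow> complex) \<Rightarrow> complex mat" where
  "atomic_integral N S E f = mat N N (\<lambda>(a, b). \<Sum>z\<in>S. f z * E {z} $$ (a, b))"

end

theory Submission
  imports Defs
begin

text \<open>
  Every function with Lipschitz constant \<open>1\<close> on the circle is within \<open>\<pi> / (L + 2)\<close> of a trigonometric
  polynomial \<open>\<Sum>\<bar>l\<bar>\<le>L. a\<^sub>l z\<^sup>l\<close> with \<open>\<bar>a\<^sub>0\<bar> \<le> \<parallel>\<phi>\<parallel>\<^sub>\<infinity>\<close> and \<open>\<bar>a\<^sub>l\<bar> \<le> \<pi> / (2 \<bar>l\<bar>)\<close>.  Both functional calculi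
  are contractive for the supremum norm, the one of the Koopman operator because it is a compression
  of the calculus of a unitary operator and the one of mpEDMD because the eigenvalues are unimodular
  and \<open>G\<^bsup>1/2\<^esup> v\<^sub>j\<close> is an orthonormal basis.  So replacing \<open>\<phi>\<close> by the polynomial costs
  \<open>O(1/L) (\<parallel>g\<parallel> + \<parallel>\<Psi> G\<^bsup>-1/2\<^esup>\<parallel> \<parallel>G\<^bsup>1/2\<^esup> c\<parallel>)\<close>, and for the polynomial the two sides are compared power by power.
\<close>

section \<open>Approximation by trigonometric polynomials\<close>

text \<open>The weight \<open>1/l\<close> in the error sum is the decay of the Fourier coefficients
  of a Lipschitz function; the factor \<open>log(L)/L\<close> only has to absorb the rate
  \<open>1/L\<close> of a positive kernel. Convolving over roots of unity makes every average a
  finite sum that is exact for the degrees involved. Two obstacles shape the operator side. The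
  compressed measure is in general not projection-valued, so integrals against it are not
  multiplicative; powers are computed in the space of the unitary extension and only then projected
  down. And square-integrable functions are not identified modulo null functions, so the values of
  \<open>spectral_integral\<close>, \<open>hadjoint\<close> and \<open>P\<close> are determined only
  up to null functions; equalities are proved after applying \<open>J\<close>, which maps null
  functions to \<open>0\<close>. The calculus upstairs is built from one fixed sequence of simple
  functions tending uniformly to the identity of the circle. At each stage, integrating functions of
  it is exactly linear, multiplicative and contractive, and these properties survive in the
  limit.\<close>

lemma unit_cnj_mult: "cmod u = 1 \<Longrightarrow> u * cnj u = 1"
  by (simp add: complex_norm_square [symmetric])

lemma unit_powr_cancel:
  assumes "cmod u = 1" "j \<le> k"
  shows "u ^ k * cnj u ^ j = u ^ (k - j)" "u ^ j * cnj u ^ k = cnj u ^ (k - j)"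
proof -
  obtain i where k: "k = i + j" using assms(2) by (metis le_add_diff_inverse2)
  have "u ^ j * cnj u ^ j = 1" using unit_cnj_mult[OF assms(1)] by (simp flip: power_mult_distrib)
  then show "u ^ k * cnj u ^ j = u ^ (k - j)" "u ^ j * cnj u ^ k = cnj u ^ (k - j)"
    by (simp_all add: k power_add algebra_simps)
qed

text \<open>For \<open>l > 0\<close> this is the coefficient of \<open>u\<^sup>l\<close> and of \<open>u\<^bsup>-l\<^esup>\<close> in \<open>\<bar>\<Sum>k\<le>D. s k * u\<^sup>k\<bar>\<^sup>2\<close>.\<close>

definition autocorrelation :: "(nat \<Rightarrow> real) \<Rightarrow> nat \<Rightarrow> nat \<Rightarrow> real" where
  "autocorrelation s D l = (\<Sum>k=l..D. s k * s (k - l))"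

lemma autocorrelation_0: "autocorrelation s D 0 = (\<Sum>k\<le>D. (s k)\<^sup>2)"
  by (simp add: autocorrelation_def power2_eq_square atLeast0AtMost)

text \<open>Each product is at most half a sum of two squares, and both shifted sums of squares are
  at most the full one. Once the kernel is normalised to have constant coefficient 1, its other
  coefficients are thus at most 1 in modulus, and convolution with it does not enlarge Fourier
  coefficients.\<close>

lemma abs_autocorrelation_le: "\<bar>autocorrelation s D l\<bar> \<le> autocorrelation s D 0"
proof (cases "l \<le> D")
  case True
  have "\<bar>s k * s (k - l)\<bar> \<le> ((s k)\<^sup>2 + (s (k - l))\<^sup>2) / 2" for k
    using sum_squares_bound[of "\<bar>s k\<bar>" "\<bar>s (k - l)\<bar>"] by (simp add: abs_mult)
  then have "\<bar>autocorrelation s D l\<bar> \<le> (\<Sum>k=l..D. ((s k)\<^sup>2 + (s (k - l))\<^sup>2) / 2)"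
    unfolding autocorrelation_def by (intro order_trans[OF sum_abs] sum_mono)
  also have "\<dots> = ((\<Sum>k=l..D. (s k)\<^sup>2) + (\<Sum>k=l..D. (s (k - l))\<^sup>2)) / 2"
    by (simp add: sum.distrib flip: sum_divide_distrib)
  also have "(\<Sum>k=l..D. (s (k - l))\<^sup>2) = (\<Sum>k\<le>D - l. (s k)\<^sup>2)"
    by (rule sum.reindex_bij_witness[of _ "\<lambda>k. k + l" "\<lambda>k. k - l"]) (use True in auto)
  also have "\<dots> \<le> (\<Sum>k\<le>D. (s k)\<^sup>2)" by (rule sum_mono2) auto
  also have "(\<Sum>k=l..D. (s k)\<^sup>2) \<le> (\<Sum>k\<le>D. (s k)\<^sup>2)" by (rule sum_mono2) auto
  finally show ?thesis by (simp add: autocorrelation_0)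
next
  case False
  then show ?thesis by (simp add: autocorrelation_0 sum_nonneg autocorrelation_def[of _ _ l])
qed

text \<open>Induction on the degree: a new top term \<open>t * u ^ Suc D\<close> contributes
  \<open>t * t\<close> and its cross terms with the old polynomial. This exhibits the manifestly
  nonnegative kernel as a trigonometric polynomial with explicit coefficients.\<close>

lemma norm_poly_circle_square:
  fixes s :: "nat \<Rightarrow> real" and u :: complex
  assumes u: "cmod u = 1"
  shows "complex_of_real ((cmod (\<Sum>k\<le>D. s k * u ^ k))\<^sup>2) =
     autocorrelation s D 0 + (\<Sum>l=1..D. autocorrelation s D l * (u ^ l + cnj u ^ l))"
proof (induction D)
  case 0
  show ?case by (simp add: autocorrelation_def power2_eq_square)
next
  case (Suc D)
  define P where "P = (\<Sum>k\<le>D. s k * u ^ k)"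
  define t where "t = s (Suc D)"
  have ac: "autocorrelation s (Suc D) l = autocorrelation s D l + t * s (Suc D - l)" if "l \<le> Suc D" for l
    using that by (simp add: autocorrelation_def t_def)
  \<comment> \<open>The cross term with index \<open>k\<close> carries the exponent
    \<open>Suc D - k\<close>; reversing the index sorts the terms by exponent.\<close>
  have reidx: "(\<Sum>k\<le>D. s k * h (Suc D - k)) = (\<Sum>l=1..Suc D. s (Suc D - l) * h l)" for h :: "nat \<Rightarrow> complex"
    by (rule sum.reindex_bij_witness[of _ "\<lambda>k. Suc D - k" "\<lambda>k. Suc D - k"]) auto
  have 1: "u ^ Suc D * cnj P = (\<Sum>l=1..Suc D. s (Suc D - l) * u ^ l)"
    unfolding reidx[symmetric] P_def sum_distrib_left cnj_sum
    by (rule sum.cong) (auto simp: unit_powr_cancel(1)[OF u, symmetric] simp del: power_Suc)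
  have 2: "P * cnj u ^ Suc D = (\<Sum>l=1..Suc D. s (Suc D - l) * cnj u ^ l)"
    unfolding reidx[symmetric] P_def sum_distrib_right
    by (rule sum.cong) (auto simp: unit_powr_cancel(2)[OF u, symmetric] simp del: power_Suc)
  have tt: "(u ^ Suc D) * cnj u ^ Suc D = 1" using unit_powr_cancel(1)[OF u, of "Suc D" "Suc D"] by simp
  have "complex_of_real ((cmod (\<Sum>k\<le>Suc D. s k * u ^ k))\<^sup>2) = (P + t * u ^ Suc D) * cnj (P + t * u ^ Suc D)"
    using complex_norm_square[of "P + t * u ^ Suc D"] by (simp add: P_def t_def)
  also have "\<dots> = P * cnj P + t * (u ^ Suc D * cnj P) + t * (P * cnj u ^ Suc D) + t * t * (u ^ Suc D * cnj u ^ Suc D)"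
    by (simp add: algebra_simps)
  also have "\<dots> = P * cnj P + t * t + (\<Sum>l=1..Suc D. t * s (Suc D - l) * (u ^ l + cnj u ^ l))"
    unfolding 1 2 tt by (simp add: sum_distrib_left distrib_left sum.distrib algebra_simps)
  also have "P * cnj P = complex_of_real ((cmod P)\<^sup>2)" using complex_norm_square[of P] by simp
  also have "\<dots> = autocorrelation s D 0 + (\<Sum>l=1..D. autocorrelation s D l * (u ^ l + cnj u ^ l))"
    using Suc.IH by (simp add: P_def)
  \<comment> \<open>The autocorrelation at \<open>l = Suc D\<close> is an empty sum, so the range
    extends at no cost.\<close>
  also have "(\<Sum>l=1..D. autocorrelation s D l * (u ^ l + cnj u ^ l)) = (\<Sum>l=1..Suc D. autocorrelation s D l * (u ^ l + cnj u ^ l))"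
    by (simp add: autocorrelation_def)
  also have "of_real (autocorrelation s D 0) + (\<Sum>l=1..Suc D. autocorrelation s D l * (u ^ l + cnj u ^ l)) + t * t + (\<Sum>l=1..Suc D. t * s (Suc D - l) * (u ^ l + cnj u ^ l))
     = autocorrelation s (Suc D) 0 + (\<Sum>l=1..Suc D. autocorrelation s (Suc D) l * (u ^ l + cnj u ^ l))"
  proof -
    have "(\<Sum>l=1..Suc D. complex_of_real (autocorrelation s (Suc D) l) * (u ^ l + cnj u ^ l))
       = (\<Sum>l=1..Suc D. autocorrelation s D l * (u ^ l + cnj u ^ l) + t * s (Suc D - l) * (u ^ l + cnj u ^ l))"
      by (rule sum.cong[OF refl]) (simp add: ac distrib_right)
    moreover have "autocorrelation s (Suc D) 0 = autocorrelation s D 0 + t * t" by (simp add: ac t_def)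
    ultimately show ?thesis by (simp add: sum.distrib)
  qed
  finally show ?case by (simp only: ac_simps)
qed

section \<open>Averages over roots of unity, the discrete counterpart of Haar measure on the
  circle\<close>

lemma sum_roots_unity_shift:
  fixes z :: complex
  assumes "z ^ n = 1" "z \<noteq> 0"
  shows "(\<Sum>w | w ^ n = 1. h (z * w)) = (\<Sum>w | w ^ n = 1. h w)"
  by (rule sum.reindex_bij_witness[of _ "\<lambda>w. w / z" "\<lambda>w. z * w"])
    (use assms in \<open>auto simp: power_mult_distrib power_divide\<close>)

text \<open>Rotation by a primitive root \<open>z\<close> leaves the sum unchanged and also
  multiplies it by \<open>z ^ k\<close>, which is not 1 because \<open>n\<close> does not divide
  \<open>k\<close>.\<close>

lemma sum_roots_unity_power:
  assumes "0 < k" "k < n"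
  shows "(\<Sum>w::complex | w ^ n = 1. w ^ k) = 0"
proof -
  define z where "z = cis (2 * pi / n)"
  have zn: "z ^ n = 1" using complex_root_unity[of n 1] assms by (simp add: z_def cis_conv_exp mult_ac)
  have "z ^ k \<noteq> 1"
  proof
    assume "z ^ k = 1"
    then have "Re (z ^ k) = 1" by simp
    then have "cos (2 * pi * k / n) = 1"
      by (simp add: z_def Complex.DeMoivre mult_ac)
    then obtain m :: int where "2 * pi * k / n = m * 2 * pi" by (auto simp: cos_one_2pi_int)
    then have "real k = m * n" using assms by (simp add: field_simps)
    then have "int k = m * int n" by (metis of_int_eq_iff of_int_mult of_int_of_nat_eq)
    then show False using assms
      by (metis dvd_triv_right nat_dvd_not_less of_nat_dvd_iff)
  qed
  moreover have "(\<Sum>w::complex | w ^ n = 1. w ^ k) = z ^ k * (\<Sum>w::complex | w ^ n = 1. w ^ k)"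
    using sum_roots_unity_shift[OF zn, of "\<lambda>w. w ^ k"]
    by (simp add: z_def power_mult_distrib sum_distrib_left)
  ultimately show ?thesis by simp
qed

lemma norm_root_unity: "n > 0 \<Longrightarrow> (w::complex) ^ n = 1 \<Longrightarrow> cmod w = 1"
  using power_eq_1_iff by blast

text \<open>The exponents \<open>l\<close> in the expansion of the squared modulus satisfy
  \<open>0 < l < n\<close>, so no frequency is aliased to the constant one, and summing over the
  roots keeps the constant coefficient alone.\<close>

lemma discrete_parseval:
  fixes s :: "nat \<Rightarrow> real"
  assumes n: "D < n" and z: "cmod z = 1"
  shows "(\<Sum>w::complex | w ^ n = 1. (cmod (\<Sum>k\<le>D. s k * (z * cnj w) ^ k))\<^sup>2) = n * (\<Sum>k\<le>D. (s k)\<^sup>2)"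
proof -
  have card: "card {w::complex. w ^ n = 1} = n" using n by (intro card_roots_unity_eq) auto
  have "complex_of_real (\<Sum>w::complex | w ^ n = 1. (cmod (\<Sum>k\<le>D. s k * (z * cnj w) ^ k))\<^sup>2)
     = (\<Sum>w::complex | w ^ n = 1. autocorrelation s D 0 + (\<Sum>l=1..D. autocorrelation s D l * ((z * cnj w) ^ l + cnj (z * cnj w) ^ l)))"
    unfolding of_real_sum
  proof (intro sum.cong refl)
    fix w :: complex assume "w \<in> {w. w ^ n = 1}"
    then have "cmod (z * cnj w) = 1" using z n norm_root_unity[of n w] by (simp add: norm_mult)
    then show "complex_of_real ((cmod (\<Sum>k\<le>D. s k * (z * cnj w) ^ k))\<^sup>2) = autocorrelation s D 0
        + (\<Sum>l=1..D. autocorrelation s D l * ((z * cnj w) ^ l + cnj (z * cnj w) ^ l))"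
      by (rule norm_poly_circle_square)
  qed
  also have "\<dots> = n * autocorrelation s D 0 + (\<Sum>l=1..D. autocorrelation s D l * (z ^ l * cnj (\<Sum>w | w ^ n = 1. w ^ l) + cnj z ^ l * (\<Sum>w | w ^ n = 1. w ^ l)))"
    unfolding sum.distrib by (subst sum.swap) (simp add: card power_mult_distrib distrib_left sum.distrib sum_distrib_left mult_ac)
  also have "\<dots> = n * autocorrelation s D 0"
    using n by (simp add: sum_roots_unity_power)
  finally have "complex_of_real (\<Sum>w::complex | w ^ n = 1. (cmod (\<Sum>k\<le>D. s k * (z * cnj w) ^ k))\<^sup>2)
     = complex_of_real (n * autocorrelation s D 0)" by (simp only: of_real_mult of_real_of_nat_eq)
  then show ?thesis by (simp only: of_real_eq_iff autocorrelation_0)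
qed

text \<open>Summation by parts: the sequence \<open>sin (k * t)\<close> is an eigenvector of the
  second difference operator with eigenvalue \<open>2 - 2 * cos t\<close> up to sign, so the energy
  of its differences is this eigenvalue times its squared norm plus a boundary term. At
  \<open>t = pi / (n + 1)\<close> the boundary term vanishes.\<close>

lemma sum_sin_differences:
  "(\<Sum>k\<le>n. (sin ((k + 1) * t) - sin (k * t))\<^sup>2) = (2 - 2 * cos t) * (\<Sum>k\<le>n. (sin (k * t))\<^sup>2)
     + sin ((n + 1) * t) * (sin ((n + 1) * t) - sin (n * t))" for t :: real and n :: nat
proof (induction n)
  case 0
  show ?case by (simp add: power2_eq_square)
next
  case (Suc n)
  have "sin ((Suc n + 1) * t) + sin (n * t) = 2 * cos t * sin (Suc n * t)"
  proof -
    have "sin ((Suc n + 1) * t) = sin (Suc n * t + t)" "sin (n * t) = sin (Suc n * t - t)" by (simp_all add: algebra_simps)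
    then show ?thesis by (simp add: sin_add sin_diff)
  qed
  then have c: "sin (n * t) = 2 * cos t * sin (Suc n * t) - sin ((Suc n + 1) * t)" by simp
  have "real n + 1 = Suc n" by simp
  with Suc.IH have IH: "(\<Sum>k\<le>n. (sin ((k + 1) * t) - sin (k * t))\<^sup>2) = (2 - 2 * cos t) * (\<Sum>k\<le>n. (sin (k * t))\<^sup>2)
     + sin (Suc n * t) * (sin (Suc n * t) - sin (n * t))" by simp
  show ?case unfolding sum.atMost_Suc IH c by (simp add: algebra_simps power2_eq_square)
qed

lemma norm_1_minus_cis_le: "cmod (1 - cis t) \<le> \<bar>t\<bar>"
proof (rule power2_le_imp_le)
  have "(cmod (1 - cis t))\<^sup>2 = (1 - cos t)\<^sup>2 + (sin t)\<^sup>2" by (simp add: cmod_power2)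
  also have "\<dots> = 2 - 2 * cos t" using sin_cos_squared_add[of t] by (simp add: power2_eq_square algebra_simps)
  also have "\<dots> = 4 * (sin (t / 2))\<^sup>2" using cos_double_sin[of "t / 2"] by simp
  also have "\<dots> \<le> 4 * (t / 2)\<^sup>2" using abs_sin_x_le_abs_x[of "t / 2"] by (intro mult_left_mono) (auto simp flip: abs_le_square_iff)
  finally show "(cmod (1 - cis t))\<^sup>2 \<le> \<bar>t\<bar>\<^sup>2" by (simp add: power_divide)
qed simp

text \<open>Rotation by half a period, \<open>z = cis (pi / l)\<close>, changes the sign of
  \<open>cnj w ^ l\<close>. Twice the sum is therefore a sum of increments
  \<open>\<phi> w - \<phi> (z * w)\<close>, each bounded by the chord \<open>cmod (1 - z)\<close>
  and so by \<open>pi / l\<close>. The divisibility makes this rotation a permutation of the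
  \<open>n\<close>-th roots of unity.\<close>

lemma lipschitz_circle_coefficient_bound:
  fixes \<phi> :: "complex \<Rightarrow> real"
  assumes lip: "1-lipschitz_on (sphere 0 1) \<phi>" and l: "0 < l" and n: "0 < n" "2 * l dvd n"
  shows "cmod (\<Sum>w | w ^ n = 1. \<phi> w * cnj w ^ l) \<le> n * (pi / (2 * l))"
proof -
  define z where "z = cis (pi / l)"
  define S where "S = (\<Sum>w | w ^ n = 1. \<phi> w * cnj w ^ l)"
  have zl: "z ^ l = -1" using l by (simp add: z_def Complex.DeMoivre)
  have zn: "z ^ n = 1" using n by (auto elim!: dvdE simp: power_mult zl mult.commute[of 2])
  have cz: "cnj z ^ l = -1" using zl by (metis complex_cnj_minus complex_cnj_one complex_cnj_power)
  have nz: "cmod z = 1" by (simp add: z_def)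
  have "S = (\<Sum>w | w ^ n = 1. \<phi> (z * w) * cnj (z * w) ^ l)"
    unfolding S_def using zn nz by (intro sum_roots_unity_shift[symmetric]) auto
  also have "\<dots> = - (\<Sum>w | w ^ n = 1. \<phi> (z * w) * cnj w ^ l)"
    by (simp add: power_mult_distrib cz sum_negf)
  finally have "2 * S = (\<Sum>w | w ^ n = 1. \<phi> w * cnj w ^ l) - (\<Sum>w | w ^ n = 1. \<phi> (z * w) * cnj w ^ l)"
    by (simp add: S_def)
  also have "\<dots> = (\<Sum>w | w ^ n = 1. complex_of_real (\<phi> w - \<phi> (z * w)) * cnj w ^ l)"
    by (simp add: sum_subtractf left_diff_distrib)
  also have "cmod \<dots> \<le> (\<Sum>w::complex | w ^ n = 1. pi / l)"
  proof (rule sum_norm_le)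
    fix w :: complex assume "w \<in> {w. w ^ n = 1}"
    then have w: "cmod w = 1" using norm_root_unity n by auto
    have "\<bar>\<phi> w - \<phi> (z * w)\<bar> \<le> dist w (z * w)"
      using lipschitz_onD[OF lip, of w "z * w"] w nz by (simp add: dist_real_def norm_mult)
    also have "\<dots> = cmod (1 - z)" by (metis dist_norm left_diff_distrib mult_1 norm_mult w mult.right_neutral)
    also have "\<dots> \<le> pi / l" using norm_1_minus_cis_le[of "pi / l"] by (simp add: z_def)
    finally show "cmod (complex_of_real (\<phi> w - \<phi> (z * w)) * cnj w ^ l) \<le> pi / l"
      by (simp add: norm_mult norm_power w flip: of_real_diff)
  qed
  also have "\<dots> = n * (pi / l)" using n by (simp add: card_roots_unity_eq)
  finally show ?thesis by (simp add: S_def norm_mult field_simps)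
qed

text \<open>The approximation is the convolution of \<open>\<phi>\<close>, over a large group of roots of unity, with the
  Fejer-Korovkin kernel \<open>\<bar>\<Sum>k\<le>L. sin ((k + 1) \<pi> / (L + 2)) u\<^sup>k\<bar>\<^sup>2\<close>, whose second moment
  about \<open>u = 1\<close> is minimal among the nonnegative kernels of degree \<open>L\<close>.\<close>

lemma lipschitz_circle_trig_approximation:
  fixes \<phi> :: "complex \<Rightarrow> real"
  assumes lip: "1-lipschitz_on (sphere 0 1) \<phi>" and B: "\<And>z. cmod z = 1 \<Longrightarrow> \<bar>\<phi> z\<bar> \<le> B"
  obtains a :: "nat \<Rightarrow> complex" where "cmod (a 0) \<le> B"
    and "\<And>l. l \<in> {1..L} \<Longrightarrow> cmod (a l) \<le> pi / (2 * real l)"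
    and "\<And>z. cmod z = 1 \<Longrightarrow>
      cmod (\<phi> z - (a 0 + (\<Sum>l=1..L. a l * z ^ l + cnj (a l) * cnj z ^ l))) \<le> pi / (real L + 2)"
proof -
  \<comment> \<open>The factorial makes \<open>2 * l\<close> a divisor of \<open>n\<close> for every
    \<open>l\<close> in \<open>{1..L}\<close>, as the half-period rotations require. Moreover
    \<open>n > L + 1\<close>, so that averages are exact even for the polynomial of degree
    \<open>L + 1\<close> in the second moment.\<close>
  define n :: nat where "n = 2 * fact (L + 1)"
  define t where "t = pi / (real L + 2)"
  \<comment> \<open>The sines vanish at the indices \<open>-1\<close> and \<open>L + 1\<close>, just
    outside the support: \<open>s\<close> is the lowest Dirichlet eigenvector of the second
    difference operator on \<open>L + 1\<close> points.\<close>
  define s where "s k = sin ((k + 1) * t)" for k :: nat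
  define S where "S = (\<Sum>k\<le>L. (s k)\<^sup>2)"
  have n: "L + 1 < n" using fact_ge_self[of "L + 1"] fact_gt_zero[of "L+1"] by (simp add: n_def del: fact_Suc)
  then have n0: "0 < n" by simp
  have dvdn: "2 * l dvd n" if "l \<in> {1..L}" for l
    unfolding n_def using that by (intro mult_dvd_mono dvd_fact) auto
  have t: "0 < t" "t < pi" by (simp_all add: t_def field_simps add_pos_nonneg)
  have "real (Suc L + 1) * t = (real L + 2) * t" by simp
  also have "\<dots> = pi" unfolding t_def by simp
  finally have last: "real (Suc L + 1) * t = pi" .
  have "0 < s 0" using t by (simp add: s_def sin_gt_zero)
  then have S0: "S > 0" unfolding S_def by (intro sum_pos2[of _ 0]) auto
  have card: "card {w::complex. w ^ n = 1} = n" using n by (intro card_roots_unity_eq) auto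
  have unit: "cmod w = 1" if "w \<in> {w::complex. w ^ n = 1}" for w using that norm_root_unity n0 by auto
  define K :: "complex \<Rightarrow> real" where "K u = (cmod (\<Sum>k\<le>L. complex_of_real (s k) * u ^ k))\<^sup>2 / (n * S)" for u
  have K0: "K u \<ge> 0" for u using S0 by (simp add: K_def)
  have mass: "(\<Sum>w | w ^ n = 1. K (z * cnj w)) = 1" if "cmod z = 1" for z
    unfolding K_def using discrete_parseval[of L n z s] n n0 that S0
    by (simp add: S_def flip: sum_divide_distrib)
  have moment: "(\<Sum>w | w ^ n = 1. (cmod (z - w))\<^sup>2 * K (z * cnj w)) \<le> t\<^sup>2" if z: "cmod z = 1" for z
  proof -
    define b where "b k = sin ((k + 1) * t) - sin (k * t)" for k :: nat
    \<comment> \<open>Multiplication by \<open>1 - u\<close> replaces coefficients by consecutive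
      differences. Because the sines vanish just beyond both ends, the formula for \<open>b\<close>
      is right at the indices \<open>0\<close> and \<open>L + 1\<close> as well.\<close>
    have id: "(cmod (1 - u))\<^sup>2 * (cmod (\<Sum>k\<le>L. s k * u ^ k))\<^sup>2 = (cmod (\<Sum>k\<le>L+1. b k * u ^ k))\<^sup>2" for u :: complex
    proof -
      have e: "sin (real (Suc L + 1) * t) = 0" by (simp only: last sin_pi)
      have "(\<Sum>k\<le>L+1. b k * u ^ k) = (\<Sum>k\<le>Suc L. sin ((k + 1) * t) * u ^ k) - (\<Sum>k\<le>Suc L. sin (k * t) * u ^ k)"
        by (simp add: b_def left_diff_distrib sum_subtractf algebra_simps)
      also have "(\<Sum>k\<le>Suc L. sin ((k + 1) * t) * u ^ k) = (\<Sum>k\<le>L. s k * u ^ k)"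
        unfolding sum.atMost_Suc e by (simp add: s_def)
      also have "(\<Sum>k\<le>Suc L. sin (k * t) * u ^ k) = u * (\<Sum>k\<le>L. s k * u ^ k)"
        unfolding sum.atMost_Suc_shift by (simp add: s_def sum_distrib_left algebra_simps)
      finally show ?thesis by (simp flip: power_mult_distrib norm_mult) (simp add: algebra_simps)
    qed
    have "(\<Sum>w | w ^ n = 1. (cmod (z - w))\<^sup>2 * K (z * cnj w))
       = (\<Sum>w | w ^ n = 1. (cmod (\<Sum>k\<le>L+1. b k * (z * cnj w) ^ k))\<^sup>2 / (n * S))"
    proof (rule sum.cong[OF refl])
      fix w :: complex assume w: "w \<in> {w. w ^ n = 1}"
      have "z - w = - w * (1 - z * cnj w)" using unit_cnj_mult[OF unit[OF w]] by (simp add: algebra_simps)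
      then have "cmod (z - w) = cmod (1 - z * cnj w)" using unit[OF w] by (simp add: norm_mult)
      then show "(cmod (z - w))\<^sup>2 * K (z * cnj w) = (cmod (\<Sum>k\<le>L+1. b k * (z * cnj w) ^ k))\<^sup>2 / (n * S)"
        using id[of "z * cnj w"] by (simp add: K_def)
    qed
    \<comment> \<open>The second moment has become a Rayleigh quotient, the energy of the
      differences of \<open>s\<close> over its squared norm; its value is the eigenvalue
      \<open>2 - 2 * cos t\<close>.\<close>
    also have "\<dots> = (\<Sum>k\<le>L+1. (b k)\<^sup>2) / S"
      using discrete_parseval[OF n z, of b] n0 by (simp flip: sum_divide_distrib)
    also have "(\<Sum>k\<le>L+1. (b k)\<^sup>2) = (2 - 2 * cos t) * (\<Sum>k\<le>L+1. (sin (k * t))\<^sup>2)"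
      unfolding b_def sum_sin_differences using last by simp
    also have "(\<Sum>k\<le>L+1. (sin (k * t))\<^sup>2) = S"
      unfolding S_def s_def Suc_eq_plus1[symmetric] sum.atMost_Suc_shift by simp
    also have "(2 - 2 * cos t) * S / S = 2 - 2 * cos t" using S0 by simp
    also have "\<dots> = (cmod (1 - cis t))\<^sup>2"
      using sin_cos_squared_add[of t] unfolding cmod_power2 by (simp add: power2_eq_square algebra_simps)
    also have "\<dots> \<le> t\<^sup>2" using norm_1_minus_cis_le[of t] t by (intro power_mono) auto
    finally show ?thesis .
  qed
  \<comment> \<open>The \<open>l\<close>-th discrete Fourier coefficient of \<phi> damped by the
    factor \<open>autocorrelation s L l / S\<close>, which is 1 at \<open>l = 0\<close>, so that
    \<open>a 0\<close> is the mean of \<phi> over the roots.\<close>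
  define a where "a l = autocorrelation s L l / (n * S) * (\<Sum>w | w ^ n = 1. \<phi> w * cnj w ^ l)" for l
  have p: "complex_of_real (\<Sum>w | w ^ n = 1. \<phi> w * K (z * cnj w)) = a 0 + (\<Sum>l=1..L. a l * z ^ l + cnj (a l) * cnj z ^ l)"
    if z: "cmod z = 1" for z
  proof -
    have "complex_of_real (\<Sum>w | w ^ n = 1. \<phi> w * K (z * cnj w)) = (\<Sum>w | w ^ n = 1. \<phi> w *
        (autocorrelation s L 0 + (\<Sum>l=1..L. autocorrelation s L l * ((z * cnj w) ^ l + cnj (z * cnj w) ^ l)))) / (n * S)"
      unfolding of_real_sum sum_divide_distrib
    proof (intro sum.cong refl)
      fix w :: complex assume w: "w \<in> {w. w ^ n = 1}"
      have "cmod (z * cnj w) = 1" using z unit[OF w] by (simp add: norm_mult)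
      from norm_poly_circle_square[OF this, of s L]
      show "complex_of_real (\<phi> w * K (z * cnj w)) = \<phi> w *
        (autocorrelation s L 0 + (\<Sum>l=1..L. autocorrelation s L l * ((z * cnj w) ^ l + cnj (z * cnj w) ^ l))) / (n * S)"
        by (simp only: K_def of_real_mult of_real_divide) simp
    qed
    also have "(\<Sum>w::complex | w ^ n = 1. \<phi> w *
        (autocorrelation s L 0 + (\<Sum>l=1..L. autocorrelation s L l * ((z * cnj w) ^ l + cnj (z * cnj w) ^ l))))
      = (\<Sum>w::complex | w ^ n = 1. autocorrelation s L 0 * complex_of_real (\<phi> w) + (\<Sum>l=1..L.
          autocorrelation s L l * z ^ l * (\<phi> w * cnj w ^ l) + autocorrelation s L l * cnj z ^ l * (\<phi> w * w ^ l)))"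
      by (intro sum.cong refl) (simp add: distrib_left power_mult_distrib sum_distrib_left mult_ac)
    also have "\<dots> = autocorrelation s L 0 * (\<Sum>w::complex | w ^ n = 1. complex_of_real (\<phi> w)) + (\<Sum>l=1..L.
          autocorrelation s L l * z ^ l * (\<Sum>w::complex | w ^ n = 1. \<phi> w * cnj w ^ l)
          + autocorrelation s L l * cnj z ^ l * (\<Sum>w::complex | w ^ n = 1. \<phi> w * w ^ l))"
      unfolding sum.distrib[of _ _ "{w. w ^ n = 1}"]
      by (subst sum.swap) (simp add: sum.distrib flip: sum_distrib_left)
    also have "\<dots> / (n * S) = a 0 + (\<Sum>l=1..L. a l * z ^ l + cnj (a l) * cnj z ^ l)"
      unfolding a_def by (simp add: add_divide_distrib sum_divide_distrib mult_ac)
    finally show ?thesis by simp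
  qed
  show ?thesis
  proof
    have "a 0 = complex_of_real ((\<Sum>w | w ^ n = 1. \<phi> w) / n)"
      using S0 by (simp add: a_def autocorrelation_0 S_def)
    moreover have "\<bar>\<Sum>w | w ^ n = 1. \<phi> w\<bar> \<le> (\<Sum>w::complex | w ^ n = 1. B)"
      by (intro order_trans[OF sum_abs] sum_mono B unit)
    ultimately show "cmod (a 0) \<le> B" using n0 card by (simp only: norm_of_real) (simp add: field_simps)
  next
    fix l assume l: "l \<in> {1..L}"
    have "cmod (a l) = \<bar>autocorrelation s L l\<bar> / (n * S) * cmod (\<Sum>w | w ^ n = 1. \<phi> w * cnj w ^ l)"
      using S0 by (simp add: a_def norm_mult norm_divide)
    also have "\<dots> \<le> S / (n * S) * (n * (pi / (2 * l)))"
      using abs_autocorrelation_le[of s L l] lipschitz_circle_coefficient_bound[OF lip, of l n] l n0 dvdn[OF l] S0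
      by (intro mult_mono divide_right_mono) (auto simp: autocorrelation_0 S_def)
    finally show "cmod (a l) \<le> pi / (2 * real l)" using S0 n0 by simp
  next
    fix z assume z: "cmod z = 1"
    have "\<phi> z - (\<Sum>w | w ^ n = 1. \<phi> w * K (z * cnj w)) = (\<Sum>w | w ^ n = 1. (\<phi> z - \<phi> w) * K (z * cnj w))"
      using mass[OF z] by (simp add: left_diff_distrib sum_subtractf flip: sum_distrib_left)
    also have "\<bar>\<dots>\<bar> \<le> (\<Sum>w | w ^ n = 1. (cmod (z - w))\<^sup>2 * K (z * cnj w) / (2 * t) + t / 2 * K (z * cnj w))"
    proof (intro order_trans[OF sum_abs] sum_mono)
      fix w :: complex assume w: "w \<in> {w. w ^ n = 1}"
      have "\<bar>\<phi> z - \<phi> w\<bar> \<le> cmod (z - w)"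
        using lipschitz_onD[OF lip, of z w] z unit[OF w] by (simp add: dist_norm)
      \<comment> \<open>The arithmetic-geometric mean inequality with weight \<open>t\<close> trades
        the first moment for the second, the one that Parseval evaluates. After averaging, the two
        summands contribute \<open>t / 2\<close> each.\<close>
      also have "\<dots> \<le> (cmod (z - w))\<^sup>2 / (2 * t) + t / 2"
        using sum_squares_bound[of "cmod (z - w)" t] t by (simp add: field_simps power2_eq_square)
      finally have "\<bar>\<phi> z - \<phi> w\<bar> * K (z * cnj w) \<le> ((cmod (z - w))\<^sup>2 / (2 * t) + t / 2) * K (z * cnj w)"
        by (rule mult_right_mono[OF _ K0])
      then show "\<bar>(\<phi> z - \<phi> w) * K (z * cnj w)\<bar> \<le> (cmod (z - w))\<^sup>2 * K (z * cnj w) / (2 * t) + t / 2 * K (z * cnj w)"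
        using K0 by (simp add: abs_mult distrib_right)
    qed
    also have "\<dots> \<le> t\<^sup>2 / (2 * t) + t / 2"
      unfolding sum.distrib sum_divide_distrib[symmetric] sum_distrib_left[symmetric] mass[OF z]
      using moment[OF z] t by (intro add_mono divide_right_mono) auto
    also have "\<dots> = pi / (real L + 2)" using t by (simp add: power2_eq_square) (simp add: t_def)
    finally show "cmod (\<phi> z - (a 0 + (\<Sum>l=1..L. a l * z ^ l + cnj (a l) * cnj z ^ l))) \<le> pi / (real L + 2)"
      unfolding p[OF z, symmetric] of_real_diff[symmetric] norm_of_real .
  qed
qed


section \<open>Spectral integrals\<close>

text \<open>Compactness provides a finite \<delta>-net in the circle, and overriding a simple
  function by the constant \<open>a\<close> on \<open>ball a \<delta>\<close>, one centre after
  another, keeps it simple. Values on the circle, and not merely near it, later give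
  \<open>cnj z * z = 1\<close> exactly and make bounds on the circle available at rounded
  points.\<close>

lemma circle_rounding:
  assumes "0 < \<delta>"
  shows "\<exists>r. simple_function circle_borel r \<and> r ` circle \<subseteq> circle \<and> (\<forall>t\<in>circle. cmod (r t - t) < \<delta>)"
proof -
  have *: "\<exists>r. simple_function circle_borel r \<and> r ` circle \<subseteq> circle \<and>
      (\<forall>t\<in>circle \<inter> (\<Union>a\<in>k. ball a \<delta>). cmod (r t - t) < \<delta>)" if "finite k" "k \<subseteq> circle" for k
    using that
  proof (induction k)
    case empty
    show ?case by (intro exI[of _ "\<lambda>_. 1"]) auto
  next
    case (insert a k)
    then obtain r where r: "simple_function circle_borel r" "r ` circle \<subseteq> circle"
      "\<forall>t\<in>circle \<inter> (\<Union>a\<in>k. ball a \<delta>). cmod (r t - t) < \<delta>" by blast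
    have near: "cmod (r t - t) < \<delta>" if "cmod t = 1" "b \<in> k" "cmod (b - t) < \<delta>" for t b
      using that by (intro bspec[OF r(3)]) (auto simp: dist_norm)
    have "ball a \<delta> \<inter> space circle_borel \<in> sets circle_borel"
      unfolding sets_restrict_space space_restrict_space by (intro image_eqI[of _ _ "ball a \<delta>"]) auto
    with r(1) have "simple_function circle_borel (\<lambda>t. if t \<in> ball a \<delta> then a else r t)"
      by (intro simple_function_If_set) auto
    then show ?case
      using r(1,2) near insert.prems by (intro exI[of _ "\<lambda>t. if t \<in> ball a \<delta> then a else r t"]) (auto simp: dist_norm)
  qed
  have "seq_compact circle" by (simp add: compact_imp_seq_compact)
  then obtain k where k: "finite k" "k \<subseteq> circle" "circle \<subseteq> (\<Union>a\<in>k. ball a \<delta>)"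
    using seq_compact_imp_totally_bounded[of circle] assms by blast
  have "circle \<inter> (\<Union>a\<in>k. ball a \<delta>) = circle" using k(3) by blast
  with *[OF k(1,2)] show ?thesis by (simp only:)
qed

section \<open>Geometry of a Hilbert space given by its carrier\<close>

locale hilbert =
  fixes H :: "'v::ab_group_add cips"
  assumes hilbert_space: "hilbert_space H"
begin

lemmas hilbert_conjuncts = hilbert_space[unfolded hilbert_space_def]

sublocale vs: vector_space "smul H"
  by (rule hilbert_conjuncts[THEN conjunct1])

abbreviation "hn \<equiv> hnorm H"

lemma subspace: "vs.subspace (vecs H)"
  by (rule hilbert_conjuncts[THEN conjunct2, THEN conjunct1])

lemma zero_mem [simp]: "0 \<in> vecs H"
  and add_mem: "x \<in> vecs H \<Longrightarrow> y \<in> vecs H \<Longrightarrow> x + y \<in> vecs H"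
  and diff_mem: "x \<in> vecs H \<Longrightarrow> y \<in> vecs H \<Longrightarrow> x - y \<in> vecs H"
  and smul_mem: "x \<in> vecs H \<Longrightarrow> smul H a x \<in> vecs H"
  and sum_mem: "(\<And>i. i \<in> I \<Longrightarrow> f i \<in> vecs H) \<Longrightarrow> sum f I \<in> vecs H"
  by (auto intro: subspace vs.subspace_0 vs.subspace_add vs.subspace_diff vs.subspace_scale vs.subspace_sum)

lemmas mem = zero_mem add_mem diff_mem smul_mem sum_mem

lemma ip_add_left: "x \<in> vecs H \<Longrightarrow> y \<in> vecs H \<Longrightarrow> z \<in> vecs H \<Longrightarrow> ip H (x + y) z = ip H x z + ip H y z"
  using hilbert_conjuncts[THEN conjunct2, THEN conjunct2, THEN conjunct1] by blast

lemma ip_smul_left: "x \<in> vecs H \<Longrightarrow> y \<in> vecs H \<Longrightarrow> ip H (smul H a x) y = a * ip H x y"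
  using hilbert_conjuncts[THEN conjunct2, THEN conjunct2, THEN conjunct2, THEN conjunct1] by blast

lemma ip_cnj: "x \<in> vecs H \<Longrightarrow> y \<in> vecs H \<Longrightarrow> ip H y x = cnj (ip H x y)"
  using hilbert_conjuncts[THEN conjunct2, THEN conjunct2, THEN conjunct2, THEN conjunct2, THEN conjunct1] by blast

lemma ip_self_nonneg: "x \<in> vecs H \<Longrightarrow> 0 \<le> Re (ip H x x)"
  using hilbert_conjuncts[THEN conjunct2, THEN conjunct2, THEN conjunct2, THEN conjunct2, THEN conjunct2, THEN conjunct1]
  by blast

lemma ip_self_eq_0: "x \<in> vecs H \<Longrightarrow> ip H x x = 0 \<Longrightarrow> x = 0"
  using hilbert_conjuncts[THEN conjunct2, THEN conjunct2, THEN conjunct2, THEN conjunct2, THEN conjunct2,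
    THEN conjunct2, THEN conjunct1] by blast

lemma complete:
  assumes "\<And>n. X n \<in> vecs H"
    and "\<And>e. e > 0 \<Longrightarrow> \<exists>n0::nat. \<forall>m\<ge>n0. \<forall>n\<ge>n0. hn (X m - X n) < e"
  obtains x where "x \<in> vecs H" "(\<lambda>n. hn (X n - x)) \<longlonglongrightarrow> 0"
proof -
  have "\<exists>x\<in>vecs H. (\<lambda>n. hn (X n - x)) \<longlonglongrightarrow> 0"
    using assms
    by (intro hilbert_conjuncts[THEN conjunct2, THEN conjunct2, THEN conjunct2, THEN conjunct2, THEN conjunct2,
      THEN conjunct2, THEN conjunct2, rule_format]) auto
  then show ?thesis using that by blast
qed

lemma ip_zero_left [simp]: "x \<in> vecs H \<Longrightarrow> ip H 0 x = 0"
  using ip_add_left[of 0 0 x] by simp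

lemma ip_zero_right [simp]: "x \<in> vecs H \<Longrightarrow> ip H x 0 = 0"
  using ip_cnj[of 0 x] by simp

lemma ip_diff_left:
  assumes "x \<in> vecs H" "y \<in> vecs H" "z \<in> vecs H"
  shows "ip H (x - y) z = ip H x z - ip H y z"
  using ip_add_left[of "x - y" y z] assms by (simp add: diff_mem)

lemma ip_add_right:
  "x \<in> vecs H \<Longrightarrow> y \<in> vecs H \<Longrightarrow> z \<in> vecs H \<Longrightarrow> ip H z (x + y) = ip H z x + ip H z y"
  using ip_cnj[of "x + y" z] ip_cnj[of x z] ip_cnj[of y z] by (simp add: add_mem ip_add_left)

lemma ip_diff_right:
  "x \<in> vecs H \<Longrightarrow> y \<in> vecs H \<Longrightarrow> z \<in> vecs H \<Longrightarrow> ip H z (x - y) = ip H z x - ip H z y"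
  using ip_cnj[of "x - y" z] ip_cnj[of x z] ip_cnj[of y z] by (simp add: diff_mem ip_diff_left)

lemma ip_smul_right:
  "x \<in> vecs H \<Longrightarrow> y \<in> vecs H \<Longrightarrow> ip H x (smul H a y) = cnj a * ip H x y"
  using ip_cnj[of "smul H a y" x] ip_cnj[of y x] by (simp add: smul_mem ip_smul_left)

lemma ip_sum_right_0:
  assumes "\<And>i. i \<in> I \<Longrightarrow> f i \<in> vecs H" "x \<in> vecs H" "\<And>i. i \<in> I \<Longrightarrow> ip H x (f i) = 0"
  shows "ip H x (sum f I) = 0"
  using assms by (induction I rule: infinite_finite_induct) (simp_all add: ip_add_right sum_mem)

lemma ip_self: "x \<in> vecs H \<Longrightarrow> ip H x x = complex_of_real ((hn x)\<^sup>2)"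
  using arg_cong[OF ip_cnj[of x x], of Im] ip_self_nonneg[of x]
  by (simp add: hnorm_def complex_eq_iff del: of_real_power)

lemma hnorm_square: "x \<in> vecs H \<Longrightarrow> (hn x)\<^sup>2 = Re (ip H x x)"
  by (simp add: hnorm_def ip_self_nonneg)

lemma hnorm_nonneg [simp]: "x \<in> vecs H \<Longrightarrow> 0 \<le> hn x"
  by (simp add: hnorm_def ip_self_nonneg)

lemma hnorm_zero [simp]: "hn 0 = 0"
  by (simp add: hnorm_def)

lemma hnorm_eq_0: "x \<in> vecs H \<Longrightarrow> hn x = 0 \<Longrightarrow> x = 0"
  using ip_self_eq_0[of x] ip_self[of x] by simp

lemma hnorm_smul: "x \<in> vecs H \<Longrightarrow> hn (smul H a x) = cmod a * hn x"
proof -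
  assume x: "x \<in> vecs H"
  have "ip H (smul H a x) (smul H a x) = complex_of_real ((cmod a * hn x)\<^sup>2)"
    using x by (simp add: ip_smul_left ip_smul_right smul_mem ip_self[OF x] power_mult_distrib complex_norm_square
        del: of_real_power)
  then have "(hn (smul H a x))\<^sup>2 = (cmod a * hn x)\<^sup>2" using x by (simp add: hnorm_square smul_mem del: of_real_power)
  then show ?thesis by (rule power2_eq_imp_eq) (simp_all add: smul_mem x)
qed

lemma hnorm_minus_commute:
  assumes "x \<in> vecs H" "y \<in> vecs H"
  shows "hn (x - y) = hn (y - x)"
proof -
  have "y - x = smul H (-1) (x - y)" by simp
  then show ?thesis using hnorm_smul[of "x - y" "-1"] assms by (simp only: diff_mem) simp
qed

lemma hnorm_add_square:
  assumes "x \<in> vecs H" "y \<in> vecs H"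
  shows "(hn (x + y))\<^sup>2 = (hn x)\<^sup>2 + 2 * Re (ip H x y) + (hn y)\<^sup>2"
  using ip_cnj[OF assms] assms by (simp add: hnorm_square ip_add_left ip_add_right add_mem)

lemma pythagoras:
  "x \<in> vecs H \<Longrightarrow> y \<in> vecs H \<Longrightarrow> ip H x y = 0 \<Longrightarrow> (hn (x + y))\<^sup>2 = (hn x)\<^sup>2 + (hn y)\<^sup>2"
  by (simp add: hnorm_add_square)

text \<open>Cauchy-Schwarz from the nonnegative squared norm of \<open>hn y\<close> times
  \<open>x\<close> minus \<open>hn x\<close> times \<open>y\<close>, which expands to
  \<open>2 * (hn x * hn y) * (hn x * hn y - Re (ip H x y))\<close>. The first factor cancels unless
  one of the vectors is zero.\<close>

lemma Re_ip_le:
  assumes x: "x \<in> vecs H" and y: "y \<in> vecs H"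
  shows "Re (ip H x y) \<le> hn x * hn y"
proof (cases "hn y = 0")
  case True
  then have "y = 0" using hnorm_eq_0 y by blast
  then show ?thesis using x by simp
next
  case False
  then have y0: "0 < hn y" using hnorm_nonneg[OF y] by linarith
  define u where "u = smul H (hn y) x"
  define v where "v = smul H (complex_of_real (- hn x)) y"
  have uv: "u \<in> vecs H" "v \<in> vecs H" unfolding u_def v_def by (intro smul_mem x y)+
  have "0 \<le> (hn (u + v))\<^sup>2" by simp
  also have "\<dots> = 2 * (hn x * hn y) * (hn x * hn y - Re (ip H x y))"
    unfolding hnorm_add_square[OF uv]
    unfolding u_def v_def hnorm_smul[OF x] hnorm_smul[OF y]
    using x y by (simp del: of_real_minus add: ip_smul_left ip_smul_right smul_mem power_mult_distrib power2_eq_square algebra_simps)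
  finally have *: "0 \<le> 2 * (hn x * hn y) * (hn x * hn y - Re (ip H x y))" .
  show ?thesis
  proof (cases "hn x = 0")
    case True
    then have "x = 0" using hnorm_eq_0 x by blast
    then show ?thesis using y by simp
  next
    case False
    then have "0 < hn x * hn y" using y0 hnorm_nonneg[OF x] by simp
    with * show ?thesis by (simp add: zero_le_mult_iff)
  qed
qed

lemma hnorm_triangle:
  assumes "x \<in> vecs H" "y \<in> vecs H"
  shows "hn (x + y) \<le> hn x + hn y"
proof (rule power2_le_imp_le)
  show "(hn (x + y))\<^sup>2 \<le> (hn x + hn y)\<^sup>2"
    using Re_ip_le[OF assms] hnorm_add_square[OF assms] by (simp add: power2_sum)
qed (use assms in simp)

lemma hnorm_diff_triangle:
  assumes "x \<in> vecs H" "y \<in> vecs H" "z \<in> vecs H"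
  shows "hn (x - z) \<le> hn (x - y) + hn (y - z)"
  using hnorm_triangle[of "x - y" "y - z"] assms by (simp add: diff_mem)

lemma hnorm_sum_le:
  assumes "\<And>i. i \<in> I \<Longrightarrow> f i \<in> vecs H"
  shows "hn (sum f I) \<le> (\<Sum>i\<in>I. hn (f i))"
  using assms
proof (induction I rule: infinite_finite_induct)
  case (insert i I)
  then show ?case using hnorm_triangle[of "f i" "sum f I"] by (simp add: sum_mem)
qed simp_all

lemma pythagoras_sum:
  assumes "finite I" "\<And>i. i \<in> I \<Longrightarrow> f i \<in> vecs H"
    and "\<And>i j. i \<in> I \<Longrightarrow> j \<in> I \<Longrightarrow> i \<noteq> j \<Longrightarrow> ip H (f i) (f j) = 0"
  shows "(hn (sum f I))\<^sup>2 = (\<Sum>i\<in>I. (hn (f i))\<^sup>2)"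
  using assms
proof (induction I rule: finite_induct)
  case (insert i I)
  have "ip H (f i) (sum f I) = 0"
    using insert.prems insert.hyps by (intro ip_sum_right_0) auto
  then have "(hn (f i + sum f I))\<^sup>2 = (hn (f i))\<^sup>2 + (hn (sum f I))\<^sup>2"
    using insert.prems by (intro pythagoras) (auto intro: sum_mem)
  then show ?case using insert by simp
qed simp

end

section \<open>Step integrals against a projection-valued measure\<close>

locale spectral_measure = hilbert H for H :: "'v::ab_group_add cips" +
  fixes E :: "complex set \<Rightarrow> 'v \<Rightarrow> 'v"
  assumes pvm: "projection_valued_measure H E"
begin

lemma E_projection: "U \<in> sets circle_borel \<Longrightarrow> orthogonal_projection H (E U)"
  and E_empty: "x \<in> vecs H \<Longrightarrow> E {} x = 0"
  and E_circle: "x \<in> vecs H \<Longrightarrow> E circle x = x"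
  and E_Int: "U \<in> sets circle_borel \<Longrightarrow> V \<in> sets circle_borel \<Longrightarrow> x \<in> vecs H \<Longrightarrow> E (U \<inter> V) x = E U (E V x)"
  using pvm by (simp_all add: projection_valued_measure_def)

lemma E_mem: "U \<in> sets circle_borel \<Longrightarrow> x \<in> vecs H \<Longrightarrow> E U x \<in> vecs H"
  and E_add: "U \<in> sets circle_borel \<Longrightarrow> x \<in> vecs H \<Longrightarrow> y \<in> vecs H \<Longrightarrow> E U (x + y) = E U x + E U y"
  and E_smul: "U \<in> sets circle_borel \<Longrightarrow> x \<in> vecs H \<Longrightarrow> E U (smul H a x) = smul H a (E U x)"
  and E_selfadjoint: "U \<in> sets circle_borel \<Longrightarrow> x \<in> vecs H \<Longrightarrow> y \<in> vecs H \<Longrightarrow> ip H (E U x) y = ip H x (E U y)"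
  using E_projection[of U] unfolding orthogonal_projection_def linear_map_def by blast+

lemma E_zero: "U \<in> sets circle_borel \<Longrightarrow> E U 0 = 0"
  using E_add[of U 0 0] by simp

lemma E_sum:
  "U \<in> sets circle_borel \<Longrightarrow> (\<And>i. i \<in> I \<Longrightarrow> f i \<in> vecs H) \<Longrightarrow> E U (sum f I) = (\<Sum>i\<in>I. E U (f i))"
  by (induction I rule: infinite_finite_induct) (simp_all add: E_zero E_add sum_mem)

lemma E_orthogonal:
  assumes "U \<in> sets circle_borel" "V \<in> sets circle_borel" "U \<inter> V = {}" "x \<in> vecs H" "y \<in> vecs H"
  shows "ip H (E U x) (E V y) = 0"
  using E_Int[of U V y] assms by (simp add: E_selfadjoint E_mem E_empty)

text \<open>Countable additivity is given as convergence in norm. With finitely many nonempty sets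
  the partial sums are eventually constant, so their distance to the limit is 0 and definiteness of
  the norm yields an equality.\<close>

lemma E_Union:
  fixes A :: "nat \<Rightarrow> complex set"
  assumes A: "\<And>k. A k \<in> sets circle_borel" "disjoint_family A" and x: "x \<in> vecs H"
    and empty: "\<And>k. n \<le> k \<Longrightarrow> A k = {}"
  shows "E (\<Union>k. A k) x = (\<Sum>k<n. E (A k) x)"
proof -
  have lim: "(\<lambda>m. hn ((\<Sum>k<m. E (A k) x) - E (\<Union>k. A k) x)) \<longlonglongrightarrow> 0"
    using A x by (intro pvm[unfolded projection_valued_measure_def, THEN conjunct2, THEN conjunct2, THEN conjunct2,
      rule_format]) auto
  have eq: "(\<Sum>k<m. E (A k) x) = (\<Sum>k<n. E (A k) x)" if "n \<le> m" for m
    by (rule sum.mono_neutral_right) (use that empty x in \<open>auto simp: E_empty\<close>)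
  have "\<forall>\<^sub>F m in sequentially. hn ((\<Sum>k<m. E (A k) x) - E (\<Union>k. A k) x)
      = hn ((\<Sum>k<n. E (A k) x) - E (\<Union>k. A k) x)"
    by (intro eventually_sequentiallyI[of n] arg_cong[where f = "\<lambda>u. hn (u - E (\<Union>k. A k) x)"] eq)
  with lim have "(\<lambda>m::nat. hn ((\<Sum>k<n. E (A k) x) - E (\<Union>k. A k) x)) \<longlonglongrightarrow> 0"
    by (rule tendsto_cong[THEN iffD1, rotated])
  then have "hn ((\<Sum>k<n. E (A k) x) - E (\<Union>k. A k) x) = 0"
    by (simp add: LIMSEQ_const_iff)
  moreover have "(\<Union>k. A k) \<in> sets circle_borel" using A(1) by blast
  ultimately have "(\<Sum>k<n. E (A k) x) - E (\<Union>k. A k) x = 0"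
    using A(1) x by (intro hnorm_eq_0 diff_mem sum_mem E_mem)
  then show ?thesis by simp
qed

lemma E_UN_finite:
  assumes "finite I" "\<And>i. i \<in> I \<Longrightarrow> A i \<in> sets circle_borel" "disjoint_family_on A I" "x \<in> vecs H"
  shows "E (\<Union>i\<in>I. A i) x = (\<Sum>i\<in>I. E (A i) x)"
proof -
  obtain f n where f: "bij_betw f {..<n::nat} I"
    using assms(1) by (metis atLeast0LessThan ex_bij_betw_nat_finite)
  \<comment> \<open>Padding with empty sets turns the finite family into a disjoint
    sequence.\<close>
  define B where "B k = (if k < n then A (f k) else {})" for k
  have "E (\<Union>k. B k) x = (\<Sum>k<n. E (B k) x)"
  proof (rule E_Union)
    show "B k \<in> sets circle_borel" for k
      using bij_betwE[OF f] assms(2) by (simp only: B_def sets.empty_sets split: if_split) blast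
    show "disjoint_family B"
      unfolding disjoint_family_on_def
    proof (intro ballI impI)
      fix i j :: nat assume "i \<noteq> j"
      show "B i \<inter> B j = {}"
      proof (cases "i < n \<and> j < n")
        case True
        then have "f i \<in> I" "f j \<in> I" "f i \<noteq> f j"
          using f \<open>i \<noteq> j\<close> by (auto simp: bij_betw_def inj_on_def)
        then show ?thesis using assms(3) by (simp add: B_def disjoint_family_on_def)
      qed (auto simp: B_def)
    qed
  qed (use assms in \<open>auto simp: B_def\<close>)
  also have "(\<Union>k. B k) = (\<Union>i\<in>I. A i)"
    using f by (auto simp: B_def bij_betw_def split: if_splits)
  also have "(\<Sum>k<n. E (B k) x) = (\<Sum>k<n. E (A (f k)) x)" by (simp add: B_def)
  also have "\<dots> = (\<Sum>i\<in>I. E (A i) x)" by (rule sum.reindex_bij_betw[OF f])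
  finally show ?thesis .
qed

definition level :: "(complex \<Rightarrow> 'b) \<Rightarrow> 'b \<Rightarrow> complex set" where
  "level r z = {t \<in> circle. r t = z}"

text \<open>The integral of \<open>h \<circ> r\<close>, but decomposed along the level sets of
  \<open>r\<close> even where \<open>h\<close> identifies values; with \<open>r\<close> fixed this
  is linear and multiplicative in \<open>h\<close>. The value type of \<open>r\<close> is arbitrary,
  so that a pair of simple functions can serve as a common refinement.\<close>

definition step_integral :: "(complex \<Rightarrow> 'b) \<Rightarrow> ('b \<Rightarrow> complex) \<Rightarrow> 'v \<Rightarrow> 'v" where
  "step_integral r h x = (\<Sum>z\<in>r ` circle. smul H (h z) (E (level r z) x))"

lemma level_set: "simple_function circle_borel r \<Longrightarrow> level r z \<in> sets circle_borel"
proof (cases "z \<in> r ` circle")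
  case True
  assume "simple_function circle_borel r"
  then have "r -` {z} \<inter> circle \<in> sets circle_borel"
    using True unfolding simple_function_def by (simp only: space_restrict_space space_borel Int_UNIV_right)
  moreover have "r -` {z} \<inter> circle = level r z" by (auto simp: level_def)
  ultimately show ?thesis by simp
next
  case False
  then have "level r z = {}" by (auto simp: level_def)
  then show ?thesis by simp
qed

lemma finite_values: "simple_function circle_borel r \<Longrightarrow> finite (r ` circle)"
  by (simp add: simple_function_def space_restrict_space)

context
  fixes r :: "complex \<Rightarrow> 'b"
  assumes r: "simple_function circle_borel r"
begin

lemma step_integral_mem: "x \<in> vecs H \<Longrightarrow> step_integral r h x \<in> vecs H"
  by (auto simp: step_integral_def intro!: mem E_mem level_set r)

lemma level_sum:
  assumes "x \<in> vecs H" "I \<subseteq> r ` circle"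
  shows "E (\<Union>z\<in>I. level r z) x = (\<Sum>z\<in>I. E (level r z) x)"
  using assms finite_subset[OF assms(2) finite_values[OF r]]
  by (intro E_UN_finite level_set r) (auto simp: disjoint_family_on_def level_def)

text \<open>The level sets of \<open>r\<close> are grouped by the value that \<open>h\<close> takes
  there, and finite additivity merges each group into one level set of the composition.\<close>

lemma simple_spectral_integral_comp:
  assumes "x \<in> vecs H"
  shows "simple_spectral_integral H E (\<lambda>t. h (r t)) x = step_integral r h x"
proof -
  let ?R = "r ` circle"
  have "step_integral r h x = (\<Sum>w\<in>h ` ?R. \<Sum>z\<in>{z \<in> ?R. h z = w}. smul H (h z) (E (level r z) x))"
    unfolding step_integral_def by (rule sum.image_gen[OF finite_values[OF r]])
  also have "\<dots> = (\<Sum>w\<in>h ` ?R. smul H w (E {t \<in> circle. h (r t) = w} x))"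
  proof (rule sum.cong[OF refl])
    fix w
    have "E (\<Union>z\<in>{z \<in> ?R. h z = w}. level r z) x = (\<Sum>z\<in>{z \<in> ?R. h z = w}. E (level r z) x)"
      by (rule level_sum) (use assms in auto)
    moreover have "(\<Union>z\<in>{z \<in> ?R. h z = w}. level r z) = {t \<in> circle. h (r t) = w}" by (auto simp: level_def)
    ultimately show "(\<Sum>z\<in>{z \<in> ?R. h z = w}. smul H (h z) (E (level r z) x)) = smul H w (E {t \<in> circle. h (r t) = w} x)"
      by (simp add: vs.scale_sum_right)
  qed
  finally show ?thesis by (simp add: simple_spectral_integral_def image_image)
qed

lemma step_integral_1: "x \<in> vecs H \<Longrightarrow> step_integral r (\<lambda>_. 1) x = x"
proof -
  have "(\<Union>z\<in>r ` circle. level r z) = circle" by (auto simp: level_def)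
  then show "x \<in> vecs H \<Longrightarrow> ?thesis"
    using level_sum[of x "r ` circle"] E_circle[of x] by (simp only: step_integral_def vs.scale_one)
qed

lemma step_integral_diff_fun:
  "step_integral r (\<lambda>z. h z - k z) x = step_integral r h x - step_integral r k x"
  by (simp add: step_integral_def vs.scale_left_diff_distrib sum_subtractf)

lemma step_integral_add_fun:
  "step_integral r (\<lambda>z. h z + k z) x = step_integral r h x + step_integral r k x"
  by (simp add: step_integral_def vs.scale_left_distrib sum.distrib)

lemma step_integral_smul_fun:
  "step_integral r (\<lambda>z. a * h z) x = smul H a (step_integral r h x)"
  by (simp add: step_integral_def vs.scale_sum_right)

lemma step_integral_sum_fun:
  "step_integral r (\<lambda>z. \<Sum>i\<in>I. h i z) x = (\<Sum>i\<in>I. step_integral r (h i) x)"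
  unfolding step_integral_def vs.scale_sum_left by (rule sum.swap)

lemma step_integral_diff:
  assumes "x \<in> vecs H" "y \<in> vecs H"
  shows "step_integral r h (x - y) = step_integral r h x - step_integral r h y"
proof -
  have "E (level r z) (x - y) = E (level r z) x - E (level r z) y" for z
    using E_add[OF level_set[OF r], of "x - y" y z] assms by (simp add: diff_mem)
  then show ?thesis by (simp add: step_integral_def vs.scale_right_diff_distrib sum_subtractf)
qed

text \<open>\<open>E\<close> turns intersections into compositions, so projections of different
  level sets annihilate each other and only the diagonal of the double sum survives.\<close>

lemma step_integral_mult:
  assumes x: "x \<in> vecs H"
  shows "step_integral r h (step_integral r k x) = step_integral r (\<lambda>z. h z * k z) x"
  unfolding step_integral_def[of r h] step_integral_def[of r "\<lambda>z. h z * k z"]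
proof (rule sum.cong[OF refl])
  fix z assume z: "z \<in> r ` circle"
  have "E (level r z) (step_integral r k x) = (\<Sum>y\<in>r ` circle. smul H (k y) (E (level r z \<inter> level r y) x))"
    unfolding step_integral_def using x
    by (simp add: E_sum E_smul E_Int smul_mem E_mem level_set r)
  also have "\<dots> = (\<Sum>y\<in>r ` circle. if y = z then smul H (k z) (E (level r z) x) else 0)"
  proof (rule sum.cong[OF refl])
    fix y
    have "level r z \<inter> level r y = (if y = z then level r z else {})" by (auto simp: level_def)
    then show "smul H (k y) (E (level r z \<inter> level r y) x) = (if y = z then smul H (k z) (E (level r z) x) else 0)"
      using x by (simp add: E_empty)
  qed
  also have "\<dots> = smul H (k z) (E (level r z) x)" using z finite_values[OF r] by simp
  finally show "smul H (h z) (E (level r z) (step_integral r k x)) = smul H (h z * k z) (E (level r z) x)" by simp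
qed

text \<open>Disjoint level sets have orthogonal projections, so Pythagoras applies. For
  \<open>h = 1\<close> the formula says that the weights add up to the squared norm of
  \<open>x\<close>, which is how contractivity follows.\<close>

lemma hnorm_step_integral:
  assumes x: "x \<in> vecs H"
  shows "(hn (step_integral r h x))\<^sup>2 = (\<Sum>z\<in>r ` circle. (cmod (h z))\<^sup>2 * (hn (E (level r z) x))\<^sup>2)"
proof -
  have "(hn (step_integral r h x))\<^sup>2 = (\<Sum>z\<in>r ` circle. (hn (smul H (h z) (E (level r z) x)))\<^sup>2)"
    unfolding step_integral_def
  proof (rule pythagoras_sum[OF finite_values[OF r]])
    fix y z :: 'b assume "y \<noteq> z"
    then have "ip H (E (level r y) x) (E (level r z) x) = 0"
      by (intro E_orthogonal level_set r x) (auto simp: level_def)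
    then show "ip H (smul H (h y) (E (level r y) x)) (smul H (h z) (E (level r z) x)) = 0"
      by (simp add: ip_smul_left ip_smul_right smul_mem E_mem level_set r x)
  qed (auto intro!: smul_mem E_mem level_set r x)
  then show ?thesis by (simp add: hnorm_smul E_mem level_set r x power_mult_distrib)
qed

lemma hnorm_step_integral_le:
  assumes x: "x \<in> vecs H" and h: "\<And>z. z \<in> r ` circle \<Longrightarrow> cmod (h z) \<le> B" and B: "0 \<le> B"
  shows "hn (step_integral r h x) \<le> B * hn x"
proof (rule power2_le_imp_le)
  have "(hn (step_integral r h x))\<^sup>2 \<le> (\<Sum>z\<in>r ` circle. B\<^sup>2 * (hn (E (level r z) x))\<^sup>2)"
    unfolding hnorm_step_integral[OF x] by (intro sum_mono mult_right_mono power_mono h) auto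
  also have "\<dots> = B\<^sup>2 * (hn x)\<^sup>2"
    using hnorm_step_integral[OF x, of "\<lambda>_. 1"] step_integral_1[OF x] by (simp add: sum_distrib_left)
  finally show "(hn (step_integral r h x))\<^sup>2 \<le> (B * hn x)\<^sup>2" by (simp add: power_mult_distrib)
qed (use x B in simp)

end

lemma simple_spectral_integral_mem:
  assumes "simple_function circle_borel s" "x \<in> vecs H"
  shows "simple_spectral_integral H E s x \<in> vecs H"
  using step_integral_mem[OF assms, of "\<lambda>z. z"] simple_spectral_integral_comp[OF assms, of "\<lambda>z. z"] by simp

text \<open>The pair \<open>r\<close> of both functions refines them simultaneously, and the
  difference becomes one step integral, that of \<open>fst z - snd z\<close>.\<close>

lemma simple_spectral_integral_diff_le:
  assumes s: "simple_function circle_borel s" and t: "simple_function circle_borel t" and x: "x \<in> vecs H"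
    and B: "\<And>z. z \<in> circle \<Longrightarrow> cmod (s z - t z) \<le> B" "0 \<le> B"
  shows "hn (simple_spectral_integral H E s x - simple_spectral_integral H E t x) \<le> B * hn x"
proof -
  define r where "r z = (s z, t z)" for z
  have r: "simple_function circle_borel r" unfolding r_def using s t by (rule simple_function_Pair)
  have "simple_spectral_integral H E s x - simple_spectral_integral H E t x = step_integral r (\<lambda>z. fst z - snd z) x"
    using simple_spectral_integral_comp[OF r x, of fst] simple_spectral_integral_comp[OF r x, of snd]
    by (simp add: r_def step_integral_diff_fun[OF r])
  also have "hn \<dots> \<le> B * hn x"
    by (rule hnorm_step_integral_le[OF r x]) (use B in \<open>auto simp: r_def\<close>)
  finally show ?thesis .
qed

end

section \<open>Rounding on the circle and existence of spectral integrals\<close>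

definition rounding :: "nat \<Rightarrow> complex \<Rightarrow> complex" where
  "rounding n = (SOME r. simple_function circle_borel r \<and> r ` circle \<subseteq> circle \<and>
     (\<forall>t\<in>circle. cmod (r t - t) < inverse (Suc n)))"

lemma rounding:
  "simple_function circle_borel (rounding n)" "rounding n ` circle \<subseteq> circle"
  "t \<in> circle \<Longrightarrow> cmod (rounding n t - t) < inverse (Suc n)"
proof -
  have *: "simple_function circle_borel (rounding n) \<and> rounding n ` circle \<subseteq> circle \<and>
     (\<forall>t\<in>circle. cmod (rounding n t - t) < inverse (Suc n))"
    unfolding rounding_def by (rule someI_ex[OF circle_rounding]) simp
  show "simple_function circle_borel (rounding n)" by (rule *[THEN conjunct1])
  show "rounding n ` circle \<subseteq> circle" by (rule *[THEN conjunct2, THEN conjunct1])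
  show "t \<in> circle \<Longrightarrow> cmod (rounding n t - t) < inverse (Suc n)"
    by (rule *[THEN conjunct2, THEN conjunct2, rule_format])
qed

lemma rounding_mem: "t \<in> circle \<Longrightarrow> rounding n t \<in> circle"
  using rounding(2) by blast

lemma simple_function_rounding: "simple_function circle_borel (\<lambda>t. f (rounding n t))"
  using simple_function_compose[OF rounding(1)[of n], of f] by (simp add: comp_def)

lemma lipschitz_rounding_le:
  assumes f: "1-lipschitz_on circle f" and t: "t \<in> circle"
  shows "dist (f (rounding n t)) (f t) \<le> inverse (Suc n)"
proof -
  have "dist (f (rounding n t)) (f t) \<le> 1 * dist (rounding n t) t"
    by (rule lipschitz_onD[OF f rounding_mem[OF t] t])
  also have "\<dots> \<le> inverse (Suc n)" using rounding(3)[OF t, of n] by (simp add: dist_norm)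
  finally show ?thesis .
qed

text \<open>Kept free of Hilbert space assumptions, because it is applied both in the space of the
  extension and in the semi-definite space of square-integrable functions. In either, the rounded
  integrals approach every value that the definition admits.\<close>

lemma has_spectral_integral_rounding:
  fixes f :: "complex \<Rightarrow> complex"
  assumes y: "has_spectral_integral H E f x y" and f: "1-lipschitz_on circle f" and e: "e > 0"
  shows "\<forall>\<^sub>F n in sequentially. hnorm H (simple_spectral_integral H E (\<lambda>t. f (rounding n t)) x - y) < e"
proof -
  from y[unfolded has_spectral_integral_def, THEN conjunct2, THEN spec, THEN mp, OF e] obtain \<delta> where \<delta>: "\<delta> > 0"
    "\<And>s. simple_function circle_borel s \<Longrightarrow> (\<forall>t\<in>circle. cmod (s t - f t) < \<delta>) \<Longrightarrow>
        hnorm H (simple_spectral_integral H E s x - y) < e"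
    by blast
  have "\<forall>\<^sub>F n in sequentially. inverse (real (Suc n)) < \<delta>"
    using order_tendstoD(2)[OF LIMSEQ_inverse_real_of_nat \<delta>(1)] .
  then show ?thesis
  proof (rule eventually_mono)
    fix n assume n: "inverse (real (Suc n)) < \<delta>"
    show "hnorm H (simple_spectral_integral H E (\<lambda>t. f (rounding n t)) x - y) < e"
    proof (rule \<delta>(2)[OF simple_function_rounding], rule ballI)
      fix t :: complex assume "t \<in> circle"
      from lipschitz_rounding_le[OF f this, of n] n
      show "cmod (f (rounding n t) - f t) < \<delta>" by (simp only: dist_norm)
    qed
  qed
qed

context spectral_measure
begin

lemma simple_integral_rounding:
  "x \<in> vecs H \<Longrightarrow> simple_spectral_integral H E (\<lambda>t. f (rounding n t)) x = step_integral (rounding n) f x"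
  by (rule simple_spectral_integral_comp[OF rounding(1)])

lemma rounding_integral_mem: "x \<in> vecs H \<Longrightarrow> step_integral (rounding n) f x \<in> vecs H"
  by (rule step_integral_mem[OF rounding(1)])

lemma hnorm_LIMSEQ_0_iff:
  assumes "\<And>n. X n \<in> vecs H"
  shows "(\<lambda>n. hn (X n)) \<longlonglongrightarrow> 0 \<longleftrightarrow> (\<forall>e>0. \<forall>\<^sub>F n in sequentially. hn (X n) < e)"
  using assms by (simp add: tendsto_iff)

lemma rounding_integral_LIMSEQ:
  assumes y: "has_spectral_integral H E f x y" and f: "1-lipschitz_on circle f" and x: "x \<in> vecs H"
  shows "(\<lambda>n. hn (step_integral (rounding n) f x - y)) \<longlonglongrightarrow> 0"
proof -
  have "y \<in> vecs H" using y unfolding has_spectral_integral_def by (rule conjunct1)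
  then show ?thesis
    using has_spectral_integral_rounding[OF y f] x
    by (subst hnorm_LIMSEQ_0_iff) (simp_all add: diff_mem rounding_integral_mem simple_integral_rounding)
qed

text \<open>Contractivity makes the rounded integrals a Cauchy sequence. Its limit must then be
  compared with every simple function near \<open>f\<close>, as the definition demands, and not only
  with the roundings.\<close>

lemma spectral_integral_exists:
  fixes f :: "complex \<Rightarrow> complex"
  assumes f: "1-lipschitz_on circle f" and x: "x \<in> vecs H"
  obtains y where "has_spectral_integral H E f x y"
proof -
  define X where "X n = simple_spectral_integral H E (\<lambda>t. f (rounding n t)) x" for n
  have X: "X n \<in> vecs H" for n
    unfolding X_def by (rule simple_spectral_integral_mem[OF simple_function_rounding x])
  \<comment> \<open>One estimate against an arbitrary simple \<open>s\<close> serves twice: with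
    \<open>s\<close> another rounding it gives the Cauchy property, and as \<open>m\<close> grows it
    gives the defining property of the integral.\<close>
  have dist_X: "hn (X m - simple_spectral_integral H E s x) \<le> (inverse (Suc m) + d) * hn x"
    if s: "simple_function circle_borel s" "\<And>t. t \<in> circle \<Longrightarrow> cmod (s t - f t) \<le> d" and d: "0 \<le> d" for m s d
    unfolding X_def
  proof (rule simple_spectral_integral_diff_le[OF simple_function_rounding s(1) x])
    fix t :: complex assume t: "t \<in> circle"
    have "dist (f (rounding m t)) (s t) \<le> dist (f (rounding m t)) (f t) + dist (s t) (f t)"
      by (rule dist_triangle2)
    also have "\<dots> \<le> inverse (Suc m) + d"
      using lipschitz_rounding_le[OF f t, of m] s(2)[OF t] by (simp add: dist_norm)
    finally show "cmod (f (rounding m t) - s t) \<le> inverse (Suc m) + d" by (simp add: dist_norm)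
  qed (use d in simp)
  have XX: "hn (X m - X n) \<le> (inverse (Suc m) + inverse (Suc n)) * hn x" for m n
    unfolding X_def[of n]
    by (rule dist_X[OF simple_function_rounding])
      (use lipschitz_rounding_le[OF f] in \<open>simp_all add: dist_norm\<close>)
  have "\<exists>n0::nat. \<forall>m\<ge>n0. \<forall>n\<ge>n0. hn (X m - X n) < e" if e: "e > 0" for e
  proof -
    have "(\<lambda>n. 2 * inverse (real (Suc n)) * hn x) \<longlonglongrightarrow> 2 * 0 * hn x"
      by (intro tendsto_intros LIMSEQ_inverse_real_of_nat)
    then have "\<forall>\<^sub>F n in sequentially. 2 * inverse (real (Suc n)) * hn x < e"
      using e by (intro order_tendstoD(2)) simp_all
    then obtain n0 where n0: "2 * inverse (real (Suc n0)) * hn x < e"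
      by (auto simp: eventually_sequentially)
    have "hn (X m - X n) < e" if "m \<ge> n0" "n \<ge> n0" for m n
    proof -
      have "inverse (real (Suc m)) \<le> inverse (Suc n0)" "inverse (real (Suc n)) \<le> inverse (Suc n0)"
        using that by (simp_all add: le_imp_inverse_le)
      then have "inverse (real (Suc m)) + inverse (Suc n) \<le> 2 * inverse (Suc n0)" by linarith
      from mult_right_mono[OF this hnorm_nonneg[OF x]]
      have "(inverse (real (Suc m)) + inverse (Suc n)) * hn x \<le> 2 * inverse (Suc n0) * hn x" .
      with XX[of m n] n0 show ?thesis by linarith
    qed
    then show ?thesis by blast
  qed
  from complete[OF X this] obtain y where y: "y \<in> vecs H" "(\<lambda>n. hn (X n - y)) \<longlonglongrightarrow> 0" by blast
  have close: "hn (simple_spectral_integral H E s x - y) \<le> d * hn x"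
    if s: "simple_function circle_borel s" "\<And>t. t \<in> circle \<Longrightarrow> cmod (s t - f t) \<le> d" and d: "0 \<le> d" for s d
  proof -
    let ?S = "simple_spectral_integral H E s x"
    have S: "?S \<in> vecs H" by (rule simple_spectral_integral_mem[OF s(1) x])
    have "(\<lambda>n. (inverse (real (Suc n)) + d) * hn x + hn (X n - y)) \<longlonglongrightarrow> (0 + d) * hn x + 0"
      by (intro tendsto_intros LIMSEQ_inverse_real_of_nat y(2))
    moreover have "hn (?S - y) \<le> (inverse (real (Suc n)) + d) * hn x + hn (X n - y)" for n
      using hnorm_diff_triangle[OF S X y(1), of n] dist_X[OF s d, of n] hnorm_minus_commute[OF S X, of n] by linarith
    ultimately have "hn (?S - y) \<le> (0 + d) * hn x + 0"
      by (intro LIMSEQ_le_const) auto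
    then show ?thesis by simp
  qed
  have "has_spectral_integral H E f x y"
    unfolding has_spectral_integral_def
  proof (intro conjI y(1) allI impI)
    fix e :: real assume e: "e > 0"
    \<comment> \<open>The summand 1 keeps the denominator positive when \<open>x\<close> has norm
      0.\<close>
    define \<delta> where "\<delta> = e / (hn x + 1)"
    have h: "0 < hn x + 1" using hnorm_nonneg[OF x] by linarith
    then have \<delta>: "\<delta> > 0" using e by (simp add: \<delta>_def)
    have "\<delta> * hn x < \<delta> * (hn x + 1)" using \<delta> by simp
    also have "\<dots> = e" using h by (simp add: \<delta>_def)
    finally have le: "\<delta> * hn x < e" .
    show "\<exists>\<delta>>0. \<forall>s. simple_function circle_borel s \<and> (\<forall>t\<in>circle. cmod (s t - f t) < \<delta>) \<longrightarrow>
        hn (simple_spectral_integral H E s x - y) < e"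
    proof (intro exI[of _ \<delta>] conjI \<delta> allI impI)
      fix s assume s: "simple_function circle_borel s \<and> (\<forall>t\<in>circle. cmod (s t - f t) < \<delta>)"
      have "hn (simple_spectral_integral H E s x - y) \<le> \<delta> * hn x"
      proof (rule close[OF s[THEN conjunct1]])
        show "cmod (s t - f t) \<le> \<delta>" if "t \<in> circle" for t
          using s[THEN conjunct2, rule_format, OF that] by simp
      qed (use \<delta> in simp)
      with le show "hn (simple_spectral_integral H E s x - y) < e" by simp
    qed
  qed
  then show ?thesis by (rule that)
qed

text \<open>Step integrals are multiplicative and contractive, so strong limits of them inherit powers.\<close>

lemma rounding_integral_power_LIMSEQ:
  assumes T: "\<And>x. x \<in> vecs H \<Longrightarrow> T x \<in> vecs H"
    and lim: "\<And>x. x \<in> vecs H \<Longrightarrow> (\<lambda>n. hn (step_integral (rounding n) h x - T x)) \<longlonglongrightarrow> 0"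
    and h: "\<And>z. z \<in> circle \<Longrightarrow> cmod (h z) \<le> 1"
    and x: "x \<in> vecs H"
  shows "(T ^^ l) x \<in> vecs H \<and> (\<lambda>n. hn (step_integral (rounding n) (\<lambda>z. h z ^ l) x - (T ^^ l) x)) \<longlonglongrightarrow> 0"
  using x
proof (induction l arbitrary: x)
  case 0
  then show ?case by (simp add: step_integral_1[OF rounding(1)])
next
  case (Suc l)
  let ?S = "\<lambda>n h. step_integral (rounding n) h"
  have Tx: "T x \<in> vecs H" using T Suc.prems .
  have IH: "(T ^^ l) (T x) \<in> vecs H" "(\<lambda>n. hn (?S n (\<lambda>z. h z ^ l) (T x) - (T ^^ l) (T x))) \<longlonglongrightarrow> 0"
    using Suc.IH[OF Tx] by blast+
  \<comment> \<open>One factor \<open>h\<close> is split off: multiplicativity applies the step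
    integral of \<open>h ^ l\<close> to that of \<open>h\<close>, and contractivity carries the
    error of the split factor through the remaining \<open>l\<close> ones.\<close>
  have bound: "hn (?S n (\<lambda>z. h z ^ Suc l) x - (T ^^ l) (T x))
      \<le> hn (?S n h x - T x) + hn (?S n (\<lambda>z. h z ^ l) (T x) - (T ^^ l) (T x))" for n
  proof -
    have m: "?S n h x \<in> vecs H" by (rule rounding_integral_mem[OF Suc.prems])
    have "?S n (\<lambda>z. h z ^ Suc l) x = ?S n (\<lambda>z. h z ^ l) (?S n h x)"
      by (subst step_integral_mult[OF rounding(1) Suc.prems]) (simp add: mult.commute)
    then have "hn (?S n (\<lambda>z. h z ^ Suc l) x - (T ^^ l) (T x))
        \<le> hn (?S n (\<lambda>z. h z ^ l) (?S n h x) - ?S n (\<lambda>z. h z ^ l) (T x)) + hn (?S n (\<lambda>z. h z ^ l) (T x) - (T ^^ l) (T x))"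
      using hnorm_diff_triangle IH(1) m Tx by (simp only: rounding_integral_mem)
    also have "hn (?S n (\<lambda>z. h z ^ l) (?S n h x) - ?S n (\<lambda>z. h z ^ l) (T x)) \<le> 1 * hn (?S n h x - T x)"
      unfolding step_integral_diff[OF rounding(1) m Tx, symmetric]
    proof (rule hnorm_step_integral_le[OF rounding(1) diff_mem[OF m Tx]])
      fix z assume "z \<in> rounding n ` circle"
      then have "z \<in> circle" using rounding(2) by blast
      from h[OF this] show "cmod (h z ^ l) \<le> 1" by (simp add: norm_power power_le_one)
    qed simp
    finally show ?thesis by simp
  qed
  have "(\<lambda>n. hn (?S n h x - T x) + hn (?S n (\<lambda>z. h z ^ l) (T x) - (T ^^ l) (T x))) \<longlonglongrightarrow> 0 + 0"
    by (intro tendsto_add lim Suc.prems IH)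
  then have "(\<lambda>n. hn (?S n (\<lambda>z. h z ^ Suc l) x - (T ^^ l) (T x))) \<longlonglongrightarrow> 0"
    unfolding add_0_left
  proof (rule Lim_null_comparison[rotated], intro always_eventually allI)
    fix n
    have "0 \<le> hn (?S n (\<lambda>z. h z ^ Suc l) x - (T ^^ l) (T x))"
      by (intro hnorm_nonneg diff_mem rounding_integral_mem Suc.prems IH)
    then show "norm (hn (?S n (\<lambda>z. h z ^ Suc l) x - (T ^^ l) (T x)))
       \<le> hn (?S n h x - T x) + hn (?S n (\<lambda>z. h z ^ l) (T x) - (T ^^ l) (T x))"
      using bound[of n] by simp
  qed
  then show ?case using IH(1) by (simp only: funpow_Suc_right o_apply simp_thms)
qed

end

section \<open>Functional calculus of a unitary operator\<close>

locale unitary_spectral = spectral_measure H E for H :: "'v::ab_group_add cips" and E +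
  fixes T :: "'v \<Rightarrow> 'v"
  assumes unitary: "unitary_operator H T"
    and spectral: "x \<in> vecs H \<Longrightarrow> has_spectral_integral H E (\<lambda>z. z) x (T x)"
begin

text \<open>As \<open>T\<close> is a surjective isometry, its inverse is also its adjoint. After
  compression, its powers become those of the adjoint of the Koopman operator.\<close>

definition Tinv :: "'v \<Rightarrow> 'v" where
  "Tinv = inv_into (vecs H) T"

lemma T_image: "T ` vecs H = vecs H"
  and T_isometry: "linear_isometry H H T"
  using unitary by (simp_all add: unitary_operator_def)

lemma T_mem: "x \<in> vecs H \<Longrightarrow> T x \<in> vecs H"
  using T_image by blast

lemma Tinv_mem: "x \<in> vecs H \<Longrightarrow> Tinv x \<in> vecs H"
  unfolding Tinv_def by (rule inv_into_into) (simp add: T_image)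

lemma T_Tinv: "x \<in> vecs H \<Longrightarrow> T (Tinv x) = x"
  unfolding Tinv_def by (rule f_inv_into_f) (simp add: T_image)

lemma T_ip: "x \<in> vecs H \<Longrightarrow> y \<in> vecs H \<Longrightarrow> ip H (T x) (T y) = ip H x y"
  using T_isometry by (simp add: linear_isometry_def)

lemma funpow_T_mem: "x \<in> vecs H \<Longrightarrow> (T ^^ l) x \<in> vecs H"
  and funpow_Tinv_mem: "x \<in> vecs H \<Longrightarrow> (Tinv ^^ l) x \<in> vecs H"
  by (induction l) (simp_all add: T_mem Tinv_mem)

lemma T_adjoint: "x \<in> vecs H \<Longrightarrow> y \<in> vecs H \<Longrightarrow> ip H (T x) y = ip H x (Tinv y)"
  using T_ip[of x "Tinv y"] by (simp add: Tinv_mem T_Tinv)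

lemma T_funpow_adjoint: "x \<in> vecs H \<Longrightarrow> y \<in> vecs H \<Longrightarrow> ip H ((T ^^ l) x) y = ip H x ((Tinv ^^ l) y)"
  by (induction l arbitrary: x) (simp_all add: T_adjoint funpow_T_mem funpow_Tinv_mem T_mem funpow_swap1)

lemma rounding_T_LIMSEQ: "x \<in> vecs H \<Longrightarrow> (\<lambda>n. hn (step_integral (rounding n) (\<lambda>z. z) x - T x)) \<longlonglongrightarrow> 0"
  by (rule rounding_integral_LIMSEQ[OF spectral]) (auto intro: lipschitz_on_leI simp: lipschitz_on_def)

text \<open>Rounded points lie on the circle, so the step integral of \<open>cnj\<close> exactly
  inverts that of the identity function. The error at \<open>x\<close> is hence the step integral of
  \<open>cnj\<close> applied to the error for \<open>T\<close> at \<open>Tinv x\<close>, and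
  contractivity bounds it by the latter.\<close>

lemma rounding_Tinv_LIMSEQ:
  assumes x: "x \<in> vecs H"
  shows "(\<lambda>n. hn (step_integral (rounding n) cnj x - Tinv x)) \<longlonglongrightarrow> 0"
proof (rule Lim_null_comparison[OF always_eventually rounding_T_LIMSEQ[OF Tinv_mem[OF x]]], rule allI)
  fix n
  let ?S = "step_integral (rounding n)" and ?u = "Tinv x"
  have u: "?u \<in> vecs H" by (rule Tinv_mem[OF x])
  have m: "?S (\<lambda>z. z) ?u \<in> vecs H" by (rule rounding_integral_mem[OF u])
  have "?S cnj (?S (\<lambda>z. z) ?u) = ?S (\<lambda>_. 1) ?u"
    unfolding step_integral_mult[OF rounding(1) u] unfolding step_integral_def
  proof (rule sum.cong[OF refl])
    fix z assume "z \<in> rounding n ` circle"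
    then have "cmod z = 1" using rounding_mem[of _ n] by auto
    then have "cnj z * z = 1" by (simp add: mult.commute[of "cnj z"] flip: complex_norm_square)
    then show "smul H (cnj z * z) (E (level (rounding n) z) ?u) = smul H 1 (E (level (rounding n) z) ?u)" by simp
  qed
  then have "?S cnj x - ?u = ?S cnj (T ?u - ?S (\<lambda>z. z) ?u)"
    using T_Tinv[OF x] step_integral_1[OF rounding(1) u] step_integral_diff[OF rounding(1) x m] by simp
  also have "hn \<dots> \<le> 1 * hn (T ?u - ?S (\<lambda>z. z) ?u)"
  proof (rule hnorm_step_integral_le[OF rounding(1) diff_mem[OF T_mem[OF u] m]])
    fix z assume "z \<in> rounding n ` circle"
    then show "cmod (cnj z) \<le> 1" using rounding_mem[of _ n] by auto
  qed simp
  finally have "hn (?S cnj x - ?u) \<le> hn (?S (\<lambda>z. z) ?u - T ?u)"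
    using hnorm_minus_commute[OF T_mem[OF u] m] by simp
  moreover have "0 \<le> hn (?S cnj x - ?u)" by (intro hnorm_nonneg diff_mem rounding_integral_mem x u)
  ultimately show "norm (hn (?S cnj x - ?u)) \<le> hn (?S (\<lambda>z. z) ?u - T ?u)" by simp
qed

text \<open>At each stage \<open>n\<close> contractivity bounds the difference of the step integrals
  of \<open>f\<close> and of the trigonometric polynomial by \<open>\<epsilon> * hn x\<close>. The
  step integrals of \<open>f\<close> tend to \<open>y\<close>, those of the powers to powers of
  \<open>T\<close> and \<open>Tinv\<close>, so the bound passes to the limit.\<close>

lemma spectral_integral_trig_approximation:
  fixes f :: "complex \<Rightarrow> complex" and a b :: "nat \<Rightarrow> complex"
  assumes y: "has_spectral_integral H E f x y" and f: "1-lipschitz_on circle f" and x: "x \<in> vecs H"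
    and approx: "\<And>z. z \<in> circle \<Longrightarrow> cmod (f z - (a 0 + (\<Sum>l=1..L. a l * z ^ l + b l * cnj z ^ l))) \<le> \<epsilon>"
  shows "hn (y - (smul H (a 0) x + (\<Sum>l=1..L. smul H (a l) ((T ^^ l) x) + smul H (b l) ((Tinv ^^ l) x)))) \<le> \<epsilon> * hn x"
proof -
  let ?S = "\<lambda>n. step_integral (rounding n)"
  define p where "p z = a 0 + (\<Sum>l=1..L. a l * z ^ l + b l * cnj z ^ l)" for z
  define D1 where "D1 n l = ?S n (\<lambda>z. z ^ l) x - (T ^^ l) x" for n l
  define D2 where "D2 n l = ?S n (\<lambda>z. cnj z ^ l) x - (Tinv ^^ l) x" for n l
  let ?q = "smul H (a 0) x + (\<Sum>l=1..L. smul H (a l) ((T ^^ l) x) + smul H (b l) ((Tinv ^^ l) x))"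
  have ym: "y \<in> vecs H" using y unfolding has_spectral_integral_def by (rule conjunct1)
  have q: "?q \<in> vecs H" by (intro mem funpow_T_mem funpow_Tinv_mem x)
  have D: "D1 n l \<in> vecs H" "D2 n l \<in> vecs H" for n l
    unfolding D1_def D2_def by (intro diff_mem rounding_integral_mem funpow_T_mem funpow_Tinv_mem x)+
  have lim: "(\<lambda>n. hn (D1 n l)) \<longlonglongrightarrow> 0" "(\<lambda>n. hn (D2 n l)) \<longlonglongrightarrow> 0" for l
    unfolding D1_def D2_def
    by (rule conjunct2, rule rounding_integral_power_LIMSEQ[OF T_mem rounding_T_LIMSEQ _ x], assumption, assumption, simp)
       (rule conjunct2, rule rounding_integral_power_LIMSEQ[OF Tinv_mem rounding_Tinv_LIMSEQ _ x], assumption, assumption, simp)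
  have p_diff: "?S n p x - ?q = (\<Sum>l=1..L. smul H (a l) (D1 n l) + smul H (b l) (D2 n l))" for n
  proof -
    have "?S n p x = smul H (a 0) x + (\<Sum>l=1..L. smul H (a l) (?S n (\<lambda>z. z ^ l) x) + smul H (b l) (?S n (\<lambda>z. cnj z ^ l) x))"
      unfolding p_def
      using step_integral_smul_fun[OF rounding(1), of n "a 0" "\<lambda>_. 1" x] step_integral_1[OF rounding(1) x, of n]
      by (simp add: step_integral_add_fun[OF rounding(1)] step_integral_sum_fun[OF rounding(1)] step_integral_smul_fun[OF rounding(1)] sum.distrib)
    then show ?thesis
      by (simp add: D1_def D2_def vs.scale_right_diff_distrib sum.distrib sum_subtractf)
  qed
  have bound: "hn (y - ?q) \<le> hn (?S n f x - y) + \<epsilon> * hn x + (\<Sum>l=1..L. cmod (a l) * hn (D1 n l) + cmod (b l) * hn (D2 n l))" for n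
  proof -
    have m: "?S n f x \<in> vecs H" "?S n p x \<in> vecs H" by (intro rounding_integral_mem x)+
    have "hn (?S n f x - ?S n p x) \<le> \<epsilon> * hn x"
      unfolding step_integral_diff_fun[OF rounding(1), symmetric]
    proof (rule hnorm_step_integral_le[OF rounding(1) x])
      fix z assume "z \<in> rounding n ` circle"
      then have "z \<in> circle" using rounding(2) by blast
      from approx[OF this] show "cmod (f z - p z) \<le> \<epsilon>" by (simp only: p_def)
    next
      \<comment> \<open>The approximation at a single point already forces \<epsilon> to be
        nonnegative.\<close>
      have "1 \<in> circle" by simp
      from order_trans[OF norm_ge_zero approx[OF this]] show "0 \<le> \<epsilon>" .
    qed
    moreover have "hn (?S n p x - ?q) \<le> (\<Sum>l=1..L. cmod (a l) * hn (D1 n l) + cmod (b l) * hn (D2 n l))"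
      unfolding p_diff
    proof (rule order_trans[OF hnorm_sum_le sum_mono])
      fix l
      show "smul H (a l) (D1 n l) + smul H (b l) (D2 n l) \<in> vecs H" by (intro add_mem smul_mem D)
      show "hn (smul H (a l) (D1 n l) + smul H (b l) (D2 n l)) \<le> cmod (a l) * hn (D1 n l) + cmod (b l) * hn (D2 n l)"
        using hnorm_triangle[OF smul_mem[OF D(1)] smul_mem[OF D(2)]] by (simp add: hnorm_smul D)
    qed
    ultimately show ?thesis
      using hnorm_diff_triangle[OF ym m(1) q] hnorm_diff_triangle[OF m q] hnorm_minus_commute[OF m(1) ym] by linarith
  qed
  have "(\<lambda>n. hn (?S n f x - y) + \<epsilon> * hn x + (\<Sum>l=1..L. cmod (a l) * hn (D1 n l) + cmod (b l) * hn (D2 n l)))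
      \<longlonglongrightarrow> 0 + \<epsilon> * hn x + (\<Sum>l=1..L. cmod (a l) * 0 + cmod (b l) * 0)"
    by (intro tendsto_intros lim rounding_integral_LIMSEQ[OF y f x])
  then have "hn (y - ?q) \<le> 0 + \<epsilon> * hn x + (\<Sum>l=1..L. cmod (a l) * 0 + cmod (b l) * 0)"
    using bound by (intro LIMSEQ_le_const) auto
  then show ?thesis by simp
qed

end


section \<open>The mpEDMD matrix\<close>

lemma mat_adjoint_carrier: "A \<in> carrier_mat n m \<Longrightarrow> mat_adjoint A \<in> carrier_mat m n"
  by (auto simp: mat_adjoint_def)

lemma mat_adjoint_index:
  "i < dim_col A \<Longrightarrow> j < dim_row A \<Longrightarrow> mat_adjoint A $$ (i, j) = conjugate (A $$ (j, i))"
  by (simp add: mat_adjoint_def mat_of_rows_index)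

lemma mat_adjoint_mult:
  fixes A B :: "complex mat"
  assumes A: "A \<in> carrier_mat n m" and B: "B \<in> carrier_mat m k"
  shows "mat_adjoint (A * B) = mat_adjoint B * mat_adjoint A"
  using A B mat_adjoint_carrier[OF A] mat_adjoint_carrier[OF B]
    mat_adjoint_carrier[OF mult_carrier_mat[OF A B]]
  by (intro eq_matI) (auto simp: mat_adjoint_index scalar_prod_def mult.commute)

lemma mat_adjoint_one: "mat_adjoint (1\<^sub>m n :: complex mat) = 1\<^sub>m n"
  using mat_adjoint_carrier[of "1\<^sub>m n :: complex mat" n n] by (intro eq_matI) (auto simp: mat_adjoint_index)

lemma mat_adjoint_cscalar_prod:
  fixes A :: "complex mat"
  assumes A: "A \<in> carrier_mat n m" and u: "u \<in> carrier_vec m" and v: "v \<in> carrier_vec n"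
  shows "(A *\<^sub>v u) \<bullet>c v = u \<bullet>c (mat_adjoint A *\<^sub>v v)"
proof -
  have "(A *\<^sub>v u) \<bullet>c v = (\<Sum>i<n. \<Sum>j<m. A $$ (i, j) * u $ j * cnj (v $ i))"
    using A u v by (simp add: scalar_prod_def sum_distrib_right atLeast0LessThan)
  also have "\<dots> = (\<Sum>j<m. \<Sum>i<n. A $$ (i, j) * u $ j * cnj (v $ i))" by (rule sum.swap)
  also have "\<dots> = u \<bullet>c (mat_adjoint A *\<^sub>v v)"
    using A u v mat_adjoint_carrier[OF A]
    by (simp add: scalar_prod_def mat_adjoint_index sum_distrib_left atLeast0LessThan mult_ac)
  finally show ?thesis .
qed

lemma vnorm_square: "complex_of_real ((vnorm c)\<^sup>2) = c \<bullet>c c"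
  by (simp add: vnorm_def scalar_prod_def atLeast0LessThan sum_nonneg complex_norm_square del: of_real_power)

lemma vnorm_nonneg: "0 \<le> vnorm c"
  by (simp add: vnorm_def sum_nonneg)

lemma vnorm_isometry:
  assumes A: "A \<in> carrier_mat n n" "mat_adjoint A * A = 1\<^sub>m n" and u: "u \<in> carrier_vec n"
  shows "vnorm (A *\<^sub>v u) = vnorm u"
proof -
  have "(A *\<^sub>v u) \<bullet>c (A *\<^sub>v u) = u \<bullet>c (mat_adjoint A *\<^sub>v (A *\<^sub>v u))"
    using A u by (intro mat_adjoint_cscalar_prod) auto
  also have "mat_adjoint A *\<^sub>v (A *\<^sub>v u) = u"
    using A u mat_adjoint_carrier[OF A(1)] by (simp flip: assoc_mult_mat_vec)
  finally have "complex_of_real ((vnorm (A *\<^sub>v u))\<^sup>2) = complex_of_real ((vnorm u)\<^sup>2)"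
    by (simp only: vnorm_square)
  then have "(vnorm (A *\<^sub>v u))\<^sup>2 = (vnorm u)\<^sup>2" by (simp only: of_real_eq_iff)
  then show ?thesis by (rule power2_eq_imp_eq) (rule vnorm_nonneg)+
qed

lemma mat_inv_eqI:
  assumes A: "A \<in> carrier_mat n n" and B: "B \<in> carrier_mat n n" and "A * B = 1\<^sub>m n" "B * A = 1\<^sub>m n"
  shows "mat_inv A = B"
proof -
  have "A \<in> Units (ring_mat TYPE(complex) n ())"
    using assms by (auto simp: Units_def ring_mat_def)
  then obtain B' where "mat_inverse A = Some B'" using mat_inverse(1)[OF A, of "()"] by (cases "mat_inverse A") auto
  moreover from mat_inverse(2)[OF A this] have "B' * A = 1\<^sub>m n" "B' \<in> carrier_mat n n" by auto
  then have "B' = B' * (A * B)" using assms by simp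
  with \<open>B' * A = 1\<^sub>m n\<close> have "B' = B"
    using A B \<open>B' \<in> carrier_mat n n\<close> by (simp flip: assoc_mult_mat)
  ultimately show ?thesis by (simp add: mat_inv_def)
qed

text \<open>Positivity of the form excludes a kernel, so the determinant is nonzero and
  \<open>mat_inverse\<close> does return a matrix.\<close>

lemma positive_definite_mat_inv:
  assumes "positive_definite n R"
  shows "mat_inv R \<in> carrier_mat n n" "R * mat_inv R = 1\<^sub>m n" "mat_inv R * R = 1\<^sub>m n"
proof -
  have R: "R \<in> carrier_mat n n" and pos: "\<And>c. c \<in> carrier_vec n \<Longrightarrow> c \<noteq> 0\<^sub>v n \<Longrightarrow> 0 < Re ((R *\<^sub>v c) \<bullet>c c)"
    using assms by (auto simp: positive_definite_def)
  have "det R \<noteq> 0"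
  proof
    assume "det R = 0"
    then obtain v where v: "v \<in> carrier_vec n" "v \<noteq> 0\<^sub>v n" "R *\<^sub>v v = 0\<^sub>v n"
      using det_0_iff_vec_prod_zero[OF R] by auto
    with pos[OF v(1,2)] show False by simp
  qed
  from det_non_zero_imp_unit[OF R this, of "()"] obtain B where "mat_inverse R = Some B"
    using mat_inverse(1)[OF R, of "()"] by (cases "mat_inverse R") auto
  with mat_inverse(2)[OF R this]
  show "mat_inv R \<in> carrier_mat n n" "R * mat_inv R = 1\<^sub>m n" "mat_inv R * R = 1\<^sub>m n"
    by (auto simp: mat_inv_def)
qed

lemma mat_diag_vec_index:
  fixes h :: "nat \<Rightarrow> complex"
  assumes "z \<in> carrier_vec n" "i < n"
  shows "(mat_diag n h *\<^sub>v z) $ i = h i * z $ i"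
proof -
  have "(mat_diag n h *\<^sub>v z) $ i = (\<Sum>k<n. (if i = k then h k else 0) * z $ k)"
    using assms by (simp add: mat_diag_def scalar_prod_def atLeast0LessThan)
  also have "\<dots> = (\<Sum>k<n. if k = i then h i * z $ i else 0)" by (rule sum.cong) auto
  finally show ?thesis using assms by simp
qed

lemma mat_diag_mult_index:
  fixes h :: "nat \<Rightarrow> complex"
  assumes "V \<in> carrier_mat n n" "z \<in> carrier_vec n" "i < n"
  shows "(V *\<^sub>v (mat_diag n h *\<^sub>v z)) $ i = (\<Sum>j<n. h j * (V $$ (i, j) * z $ j))"
proof -
  define u where "u = mat_diag n h *\<^sub>v z"
  have "dim_vec u = n" by (simp add: u_def mat_diag_def)
  then have "(V *\<^sub>v u) $ i = (\<Sum>j<n. V $$ (i, j) * u $ j)"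
    using assms by (simp add: scalar_prod_def atLeast0LessThan)
  also have "\<dots> = (\<Sum>j<n. h j * (V $$ (i, j) * z $ j))"
    unfolding u_def by (intro sum.cong refl) (simp only: mat_diag_vec_index[OF assms(2)] lessThan_iff mult_ac)
  finally show ?thesis by (simp only: u_def)
qed

lemma vnorm_mat_diag_le:
  assumes z: "z \<in> carrier_vec n" and h: "\<And>j. j < n \<Longrightarrow> cmod (h j) \<le> B" and B: "0 \<le> B"
  shows "vnorm (mat_diag n h *\<^sub>v z) \<le> B * vnorm z"
proof (rule power2_le_imp_le)
  have d: "dim_vec (mat_diag n h *\<^sub>v z) = n" "dim_vec z = n" using z by (simp_all add: mat_diag_def)
  have "(vnorm (mat_diag n h *\<^sub>v z))\<^sup>2 = (\<Sum>i<n. (cmod (h i))\<^sup>2 * (cmod (z $ i))\<^sup>2)"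
    unfolding vnorm_def d by (simp add: sum_nonneg mat_diag_vec_index[OF z] norm_mult power_mult_distrib del: index_mult_mat_vec)
  also have "\<dots> \<le> (\<Sum>i<n. B\<^sup>2 * (cmod (z $ i))\<^sup>2)"
    by (intro sum_mono mult_right_mono power_mono h) auto
  also have "\<dots> = (B * vnorm z)\<^sup>2"
    unfolding vnorm_def d by (simp add: sum_nonneg power_mult_distrib sum_distrib_left)
  finally show "(vnorm (mat_diag n h *\<^sub>v z))\<^sup>2 \<le> (B * vnorm z)\<^sup>2" .
qed (use B vnorm_nonneg in simp)

text \<open>\<open>Z\<close> is the inverse of \<open>V\<close>, so
  \<open>V * mat_diag N h * Z\<close> is multiplicative in \<open>h\<close>. Powers of the mpEDMD
  matrix, powers of its inverse and integrals against its measure all take this one form and can be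
  compared through their diagonals.\<close>

lemma mpedmd_diagonalization:
  assumes fac: "mpedmd_factorization N G A R U1 \<sigma> U2 Vh lam"
  defines "V \<equiv> mat_inv R * Vh" and "Z \<equiv> mat_adjoint Vh * R" and "KK \<equiv> mpedmd_matrix R U1 U2"
  shows "V \<in> carrier_mat N N" "Z \<in> carrier_mat N N" "V * Z = 1\<^sub>m N"
    and "\<And>j. j < N \<Longrightarrow> cmod (lam j) = 1"
    and "KK ^\<^sub>m l = V * mat_diag N (\<lambda>j. lam j ^ l) * Z"
    and "mat_inv KK ^\<^sub>m l = V * mat_diag N (\<lambda>j. cnj (lam j) ^ l) * Z"
    and "atomic_integral N (lam ` {..<N}) (mpedmd_measure N G R Vh lam) f = V * mat_diag N (\<lambda>j. f (lam j)) * Z"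
proof -
  from fac have pd: "positive_definite N R" and G: "R * R = G" and U: "unitary_matrix N U1" "unitary_matrix N U2"
    and Vh: "unitary_matrix N Vh" and eig: "U2 * mat_adjoint U1 = Vh * mat_diag N lam * mat_adjoint Vh"
    by (simp_all add: mpedmd_factorization_def is_matrix_sqrt_def)
  let ?W = "mat_adjoint Vh" and ?Ri = "mat_inv R"
  have Rc: "R \<in> carrier_mat N N" and Ra: "mat_adjoint R = R" using pd by (auto simp: positive_definite_def)
  note Ri = positive_definite_mat_inv[OF pd]
  have Vc: "Vh \<in> carrier_mat N N" and VW: "Vh * ?W = 1\<^sub>m N" and WV: "?W * Vh = 1\<^sub>m N"
    using Vh by (auto simp: unitary_matrix_def)
  have Wc: "?W \<in> carrier_mat N N" by (rule mat_adjoint_carrier[OF Vc])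
  have Uc: "U1 \<in> carrier_mat N N" "U2 \<in> carrier_mat N N" "mat_adjoint U1 \<in> carrier_mat N N"
    using U mat_adjoint_carrier by (auto simp: unitary_matrix_def)
  note assoc = assoc_mult_mat[of _ N N _ N _ N] mult_carrier_mat[of _ N N _ N]
  show V: "V \<in> carrier_mat N N" and Z: "Z \<in> carrier_mat N N"
    using Ri(1) Vc Wc Rc by (auto simp: V_def Z_def)
  have "V * Z = ?Ri * (Vh * ?W) * R" using Ri(1) Vc Wc Rc by (simp add: V_def Z_def assoc)
  then show VZ: "V * Z = 1\<^sub>m N" using Ri Rc by (simp add: VW)
  have "Z * V = ?W * (R * ?Ri) * Vh" using Ri(1) Vc Wc Rc by (simp add: V_def Z_def assoc)
  then have ZV: "Z * V = 1\<^sub>m N" using Ri Wc by (simp add: WV)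
  have mult: "V * mat_diag N h * Z * (V * mat_diag N k * Z) = V * mat_diag N (\<lambda>j. h j * k j) * Z" for h k
  proof -
    have "V * mat_diag N h * Z * (V * mat_diag N k * Z) = V * (mat_diag N h * (Z * V) * mat_diag N k) * Z"
      using V Z by (simp add: assoc)
    then show ?thesis by (simp add: ZV right_mult_one_mat[OF mat_diag_dim])
  qed
  have one: "V * mat_diag N (\<lambda>j. 1) * Z = 1\<^sub>m N" using V by (simp add: VZ)
  have pow: "B ^\<^sub>m l = V * mat_diag N (\<lambda>j. h j ^ l) * Z" if "B = V * mat_diag N h * Z" for B h l
  proof (induction l)
    case 0
    have "dim_row B = N" using that V by simp
    then show ?case using one by simp
  next
    case (Suc l)
    then show ?case using mult[of "\<lambda>j. h j ^ l" h] by (simp add: that mult.commute)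
  qed
  have "KK = ?Ri * (U2 * mat_adjoint U1) * R"
    using Ri(1) Uc Rc by (simp add: KK_def mpedmd_matrix_def assoc)
  also have "\<dots> = V * mat_diag N lam * Z"
    unfolding eig using Ri(1) Vc Wc Rc by (simp add: V_def Z_def assoc)
  finally have KK: "KK = V * mat_diag N lam * Z" .
  then show "KK ^\<^sub>m l = V * mat_diag N (\<lambda>j. lam j ^ l) * Z" by (rule pow)
  \<comment> \<open>The diagonal matrix is a product of unitary matrices and hence an isometry; the
    norm of its value at the \<open>j\<close>-th unit vector is \<open>cmod (lam j)\<close>.\<close>
  show unit: "cmod (lam j) = 1" if j: "j < N" for j
  proof -
    define e :: "complex vec" where "e = unit_vec N j"
    have e: "e \<in> carrier_vec N" by (simp add: e_def)
    have D: "mat_diag N lam = ?W * (U2 * mat_adjoint U1) * Vh"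
    proof -
      have "?W * (U2 * mat_adjoint U1) * Vh = (?W * Vh) * mat_diag N lam * (?W * Vh)"
        unfolding eig using Vc Wc by (simp add: assoc)
      then show ?thesis by (simp add: WV left_mult_one_mat[OF mat_diag_dim] right_mult_one_mat[OF mat_diag_dim])
    qed
    have iso: "vnorm (mat_adjoint B *\<^sub>v u) = vnorm u" if "unitary_matrix N B" "u \<in> carrier_vec N" for B u
    proof -
      have B: "B \<in> carrier_mat N N" "B * mat_adjoint B = 1\<^sub>m N" using that by (auto simp: unitary_matrix_def)
      have "mat_adjoint (mat_adjoint B) = B"
        using B mat_adjoint_carrier[OF B(1)] mat_adjoint_carrier[OF mat_adjoint_carrier[OF B(1)]] by (intro eq_matI) (auto simp: mat_adjoint_index)
      then show ?thesis using vnorm_isometry[OF mat_adjoint_carrier[OF B(1)]] B(2) that(2) by simp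
    qed
    have "vnorm (mat_diag N lam *\<^sub>v e) = vnorm (?W *\<^sub>v (U2 *\<^sub>v (mat_adjoint U1 *\<^sub>v (Vh *\<^sub>v e))))"
      unfolding D using Uc Vc Wc e by (simp add: assoc_mult_mat_vec[of _ N N _ N])
    also have "\<dots> = vnorm e"
      using U Vh Uc Vc e by (simp add: iso vnorm_isometry[of _ N] unitary_matrix_def)
    also have "vnorm e = 1"
      using j by (simp add: vnorm_def e_def unit_vec_def if_distrib[of "\<lambda>x. (cmod x)\<^sup>2"] cong: if_cong)
    also have "vnorm (mat_diag N lam *\<^sub>v e) = cmod (lam j)"
    proof -
      have "mat_diag N lam *\<^sub>v e = lam j \<cdot>\<^sub>v e"
      proof (rule eq_vecI)
        fix i assume "i < dim_vec (lam j \<cdot>\<^sub>v e)"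
        then have i: "i < N" using e by simp
        show "(mat_diag N lam *\<^sub>v e) $ i = (lam j \<cdot>\<^sub>v e) $ i"
          unfolding mat_diag_vec_index[OF e i] using i by (simp add: e_def unit_vec_def)
      qed (simp add: e_def mat_diag_def)
      then show ?thesis using j
        by (simp add: vnorm_def e_def unit_vec_def if_distrib[of "\<lambda>x. (cmod (lam j * x))\<^sup>2"] cong: if_cong)
    qed
    finally show ?thesis by simp
  qed
  have diag_cnj: "mat_diag N (\<lambda>j. lam j * cnj (lam j)) = 1\<^sub>m N" "mat_diag N (\<lambda>j. cnj (lam j) * lam j) = 1\<^sub>m N"
    using unit by (auto intro!: eq_matI simp: mat_diag_def mult.commute[of "cnj _"] simp flip: complex_norm_square)
  have "mat_inv KK = V * mat_diag N (\<lambda>j. cnj (lam j)) * Z"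
    unfolding KK
    by (rule mat_inv_eqI) (use V Z mult diag_cnj VZ in auto)
  then show "mat_inv KK ^\<^sub>m l = V * mat_diag N (\<lambda>j. cnj (lam j) ^ l) * Z" by (rule pow)
  show "atomic_integral N (lam ` {..<N}) (mpedmd_measure N G R Vh lam) f = V * mat_diag N (\<lambda>j. f (lam j)) * Z"
  proof (rule eq_matI)
    fix a b assume "a < dim_row (V * mat_diag N (\<lambda>j. f (lam j)) * Z)" "b < dim_col (V * mat_diag N (\<lambda>j. f (lam j)) * Z)"
    then have ab: "a < N" "b < N" using V Z by auto
    \<comment> \<open>Since \<open>R\<close> is Hermitian and squares to \<open>G\<close>,
      multiplying by \<open>G\<close> turns the adjoint of \<open>V\<close> into its inverse
      \<open>Z\<close>: the columns of \<open>V\<close> are orthonormal for the inner product given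
      by \<open>G\<close>.\<close>
    have adj: "mat_adjoint V * G = Z"
    proof -
      have "mat_adjoint V * G = ?W * ?Ri * (R * R)"
      proof -
        have "mat_adjoint ?Ri * R = mat_adjoint (R * ?Ri)"
          using mat_adjoint_mult[OF Rc Ri(1)] by (simp only: Ra)
        then have "mat_adjoint ?Ri * R = 1\<^sub>m N" by (simp add: Ri mat_adjoint_one)
        then have "mat_adjoint ?Ri * (R * ?Ri) = ?Ri"
          using Ri(1) Rc mat_adjoint_carrier[OF Ri(1)] by (simp flip: assoc(1))
        then have "mat_adjoint ?Ri = ?Ri" using mat_adjoint_carrier[OF Ri(1)] by (simp add: Ri)
        then show ?thesis by (simp only: V_def mat_adjoint_mult[OF Ri(1) Vc] G)
      qed
      also have "\<dots> = ?W * (?Ri * R) * R" using Ri(1) Wc Rc by (simp add: assoc)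
      finally show ?thesis using Wc by (simp add: Ri Z_def)
    qed
    have outer: "(outer_product (col V j) * G) $$ (a, b) = V $$ (a, j) * Z $$ (j, b)" if j: "j < N" for j
    proof -
      have Gc: "G \<in> carrier_mat N N" using Rc by (auto simp flip: G)
      have "(outer_product (col V j) * G) $$ (a, b) = (\<Sum>k<N. V $$ (a, j) * cnj (V $$ (k, j)) * G $$ (k, b))"
        using ab j V Gc by (simp add: outer_product_def scalar_prod_def atLeast0LessThan)
      also have "\<dots> = V $$ (a, j) * (mat_adjoint V * G) $$ (j, b)"
        using ab j V Gc mat_adjoint_carrier[OF V]
        by (simp add: scalar_prod_def atLeast0LessThan mat_adjoint_index sum_distrib_left mult_ac)
      finally show ?thesis by (simp add: adj)
    qed
    \<comment> \<open>Coinciding eigenvalues share one atom, so the sum over points is a sum over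
      indices grouped by eigenvalue.\<close>
    have "atomic_integral N (lam ` {..<N}) (mpedmd_measure N G R Vh lam) f $$ (a, b)
        = (\<Sum>z\<in>lam ` {..<N}. \<Sum>j\<in>{j \<in> {..<N}. lam j = z}. f (lam j) * (V $$ (a, j) * Z $$ (j, b)))"
      using ab by (auto simp: atomic_integral_def mpedmd_measure_def sum_distrib_left V_def[symmetric] outer intro!: sum.cong)
    also have "\<dots> = (\<Sum>j<N. f (lam j) * (V $$ (a, j) * Z $$ (j, b)))"
      by (rule sum.image_gen[symmetric]) simp
    also have "\<dots> = (V * mat_diag N (\<lambda>j. f (lam j)) * Z) $$ (a, b)"
      using ab V Z by (simp add: mat_diag_mult_right[OF V] scalar_prod_def atLeast0LessThan mult_ac)
    finally show "atomic_integral N (lam ` {..<N}) (mpedmd_measure N G R Vh lam) f $$ (a, b)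
        = (V * mat_diag N (\<lambda>j. f (lam j)) * Z) $$ (a, b)" .
  qed (use V Z in \<open>auto simp: atomic_integral_def\<close>)
qed


section \<open>The Koopman operator\<close>

lemma L2_iff: "f \<in> vecs (L2 \<omega>) \<longleftrightarrow> f \<in> borel_measurable \<omega> \<and> integrable \<omega> (\<lambda>x. (cmod (f x))\<^sup>2)"
  by (simp add: L2_def)

lemma L2_add:
  assumes f: "f \<in> vecs (L2 \<omega>)" and g: "g \<in> vecs (L2 \<omega>)"
  shows "(\<lambda>x. f x + g x) \<in> vecs (L2 \<omega>)"
  unfolding L2_iff
proof
  show m: "(\<lambda>x. f x + g x) \<in> borel_measurable \<omega>"
    using f g by (auto simp: L2_iff)
  have "integrable \<omega> (\<lambda>x. 2 * (cmod (f x))\<^sup>2 + 2 * (cmod (g x))\<^sup>2)"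
    using f g by (auto simp: L2_iff)
  then show "integrable \<omega> (\<lambda>x. (cmod (f x + g x))\<^sup>2)"
  proof (rule Bochner_Integration.integrable_bound, goal_cases)
    case 1
    show ?case using m by measurable
  next
    case 2
    have "(cmod (u + v))\<^sup>2 \<le> 2 * (cmod u)\<^sup>2 + 2 * (cmod v)\<^sup>2" for u v
    proof -
      have "(cmod (u + v))\<^sup>2 \<le> (cmod u + cmod v)\<^sup>2" by (intro power_mono norm_triangle_ineq) simp
      also have "\<dots> \<le> 2 * (cmod u)\<^sup>2 + 2 * (cmod v)\<^sup>2"
        using sum_squares_bound[of "cmod u" "cmod v"] by (simp add: power2_sum)
      finally show ?thesis .
    qed
    then show ?case by (intro always_eventually allI) simp
  qed
qed

lemma L2_smul: "f \<in> vecs (L2 \<omega>) \<Longrightarrow> (\<lambda>x. a * f x) \<in> vecs (L2 \<omega>)"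
  by (auto simp: L2_iff norm_mult power_mult_distrib)

lemma L2_zero: "(\<lambda>x. 0) \<in> vecs (L2 \<omega>)"
  by (simp add: L2_iff)

lemma L2_diff: "f \<in> vecs (L2 \<omega>) \<Longrightarrow> g \<in> vecs (L2 \<omega>) \<Longrightarrow> (\<lambda>x. f x - g x) \<in> vecs (L2 \<omega>)"
  using L2_add[OF _ L2_smul[of g \<omega> "-1"], of f] by simp

lemma L2_sum: "(\<And>i. i \<in> I \<Longrightarrow> f i \<in> vecs (L2 \<omega>)) \<Longrightarrow> (\<lambda>x. \<Sum>i\<in>I. f i x) \<in> vecs (L2 \<omega>)"
  by (induction I rule: infinite_finite_induct) (simp_all add: L2_zero L2_add)

lemma smul_L2: "smul (L2 \<omega>) a f = (\<lambda>x. a * f x)"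
  by (simp add: L2_def)

lemma koopman_L2:
  assumes mps: "measure_preserving_system d \<omega> F" and g: "g \<in> vecs (L2 \<omega>)"
  shows "koopman F g \<in> vecs (L2 \<omega>)"
proof -
  have F: "F \<in> measurable \<omega> \<omega>" and d: "distr \<omega> \<omega> F = \<omega>"
    using mps by (simp_all add: measure_preserving_system_def)
  have g': "g \<in> borel_measurable \<omega>" "integrable \<omega> (\<lambda>x. (cmod (g x))\<^sup>2)" using g by (simp_all add: L2_iff)
  have "integrable (distr \<omega> \<omega> F) (\<lambda>x. (cmod (g x))\<^sup>2)" unfolding d by (rule g')
  then have "integrable \<omega> (\<lambda>x. (cmod (g (F x)))\<^sup>2)"
    by (subst (asm) integrable_distr_eq[OF F]) (use g' in \<open>auto\<close>)
  then show ?thesis using measurable_comp[OF F g'(1)] by (simp add: L2_iff koopman_def)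
qed

section \<open>The unitary extension and its compression to square-integrable functions\<close>

locale koopman_extension = unitary_spectral H E T for H :: "'v::ab_group_add cips" and E T +
  fixes d :: nat and \<omega> :: "point measure" and F :: "point \<Rightarrow> point"
    and J :: "(point \<Rightarrow> complex) \<Rightarrow> 'v" and P :: "'v \<Rightarrow> point \<Rightarrow> complex"
    and EK :: "complex set \<Rightarrow> (point \<Rightarrow> complex) \<Rightarrow> (point \<Rightarrow> complex)"
  assumes mps: "measure_preserving_system d \<omega> F"
    and J: "linear_isometry (L2 \<omega>) H J"
    and J_koopman: "g \<in> vecs (L2 \<omega>) \<Longrightarrow> T (J g) = J (koopman F g)"
    and P_mem: "h \<in> vecs H \<Longrightarrow> P h \<in> vecs (L2 \<omega>)"
    and P_orthogonal: "h \<in> vecs H \<Longrightarrow> g \<in> vecs (L2 \<omega>) \<Longrightarrow> ip H (h - J (P h)) (J g) = 0"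
    and EK: "U \<in> sets circle_borel \<Longrightarrow> g \<in> vecs (L2 \<omega>) \<Longrightarrow> EK U g = P (E U (J g))"
begin

abbreviation "X \<equiv> L2 \<omega>"

lemma J_mem: "f \<in> vecs X \<Longrightarrow> J f \<in> vecs H"
  and J_ip: "f \<in> vecs X \<Longrightarrow> g \<in> vecs X \<Longrightarrow> ip X f g = ip H (J f) (J g)"
  using J by (auto simp: linear_isometry_def linear_map_def)

lemma J_add: "f \<in> vecs X \<Longrightarrow> g \<in> vecs X \<Longrightarrow> J (\<lambda>x. f x + g x) = J f + J g"
  using J by (simp add: linear_isometry_def linear_map_def plus_fun_def)

lemma J_smul: "f \<in> vecs X \<Longrightarrow> J (\<lambda>x. a * f x) = smul H a (J f)"
  using J by (simp add: linear_isometry_def linear_map_def smul_L2)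

lemma J_diff:
  assumes "f \<in> vecs X" "g \<in> vecs X"
  shows "J (\<lambda>x. f x - g x) = J f - J g"
  using J_add[OF L2_diff[OF assms] assms(2)] by (simp add: eq_diff_eq)

lemma J_zero: "J (\<lambda>x. 0) = 0"
  using J_smul[OF L2_zero, of 0] by simp

lemma J_sum: "(\<And>i. i \<in> I \<Longrightarrow> f i \<in> vecs X) \<Longrightarrow> J (\<lambda>x. \<Sum>i\<in>I. f i x) = (\<Sum>i\<in>I. J (f i))"
  by (induction I rule: infinite_finite_induct) (simp_all add: J_zero J_add L2_sum)

text \<open>In general \<open>L2 \<omega>\<close> fails \<open>hilbert_space\<close>, as null
  functions need not be \<open>0\<close>. Its triangle inequality and homogeneity are therefore
  pulled back along the isometry \<open>J\<close>.\<close>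

lemma hnorm_J: "f \<in> vecs X \<Longrightarrow> hnorm X f = hn (J f)"
  by (simp add: hnorm_def J_ip)

lemma X_norm_nonneg: "f \<in> vecs X \<Longrightarrow> 0 \<le> hnorm X f"
  by (simp add: hnorm_J J_mem)

lemma X_norm_triangle:
  "f \<in> vecs X \<Longrightarrow> g \<in> vecs X \<Longrightarrow> hnorm X (\<lambda>x. f x + g x) \<le> hnorm X f + hnorm X g"
  by (simp add: hnorm_J L2_add J_add hnorm_triangle J_mem)

lemma X_norm_smul: "f \<in> vecs X \<Longrightarrow> hnorm X (\<lambda>x. a * f x) = cmod a * hnorm X f"
  by (simp add: hnorm_J L2_smul J_smul hnorm_smul J_mem)

lemma X_norm_sum_le:
  "(\<And>i. i \<in> I \<Longrightarrow> f i \<in> vecs X) \<Longrightarrow> hnorm X (\<lambda>x. \<Sum>i\<in>I. f i x) \<le> (\<Sum>i\<in>I. hnorm X (f i))"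
  using hnorm_sum_le[of I "\<lambda>i. J (f i)"] by (simp add: hnorm_J L2_sum J_sum J_mem)

text \<open>Orthogonality determines \<open>P h\<close> only up to a null function, but it
  determines \<open>J (P h)\<close>: the difference of two candidates lies in the range of
  \<open>J\<close> and is orthogonal to that range, hence to itself. Linearity of the projection is
  accordingly stated after \<open>J\<close>.\<close>

lemma JP_unique:
  assumes h: "h \<in> vecs H" and v: "v \<in> vecs X" and orth: "\<And>g. g \<in> vecs X \<Longrightarrow> ip H (h - J v) (J g) = 0"
  shows "J (P h) = J v"
proof -
  let ?d = "J v - J (P h)"
  have m: "J v \<in> vecs H" "J (P h) \<in> vecs H" using P_mem h v by (auto intro: J_mem)
  have d: "J (\<lambda>x. v x - P h x) = ?d" using v P_mem[OF h] by (rule J_diff)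
  have "ip H ?d ?d = ip H ((h - J (P h)) - (h - J v)) ?d" by simp
  also have "\<dots> = 0"
    unfolding ip_diff_left[OF diff_mem[OF h m(2)] diff_mem[OF h m(1)] diff_mem[OF m]]
    using orth[OF L2_diff[OF v P_mem[OF h]]] P_orthogonal[OF h L2_diff[OF v P_mem[OF h]]] by (simp add: d)
  finally have "?d = 0" using m by (intro ip_self_eq_0 diff_mem)
  then show ?thesis by simp
qed

lemma JP_J: "g \<in> vecs X \<Longrightarrow> J (P (J g)) = J g"
  by (rule JP_unique) (simp_all add: J_mem)

lemma JP_add:
  assumes "h \<in> vecs H" "k \<in> vecs H"
  shows "J (P (h + k)) = J (P h) + J (P k)"
proof -
  have "J (P (h + k)) = J (\<lambda>x. P h x + P k x)"
  proof (rule JP_unique[OF add_mem[OF assms] L2_add[OF P_mem[OF assms(1)] P_mem[OF assms(2)]]])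
    fix g assume g: "g \<in> vecs X"
    have e: "h + k - J (\<lambda>x. P h x + P k x) = (h - J (P h)) + (k - J (P k))"
      using assms by (simp add: J_add P_mem)
    have "h - J (P h) \<in> vecs H" "k - J (P k) \<in> vecs H" "J g \<in> vecs H"
      using assms g by (auto intro: diff_mem J_mem P_mem)
    then show "ip H (h + k - J (\<lambda>x. P h x + P k x)) (J g) = 0"
      unfolding e using assms g by (simp add: ip_add_left P_orthogonal)
  qed
  then show ?thesis using assms by (simp add: J_add P_mem)
qed

lemma JP_smul:
  assumes h: "h \<in> vecs H"
  shows "J (P (smul H a h)) = smul H a (J (P h))"
proof -
  have "J (P (smul H a h)) = J (\<lambda>x. a * P h x)"
  proof (rule JP_unique[OF smul_mem[OF h] L2_smul[OF P_mem[OF h]]])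
    fix g assume g: "g \<in> vecs X"
    have e: "smul H a h - J (\<lambda>x. a * P h x) = smul H a (h - J (P h))"
      using h by (simp add: J_smul P_mem vs.scale_right_diff_distrib)
    have "h - J (P h) \<in> vecs H" "J g \<in> vecs H"
      using h g by (auto intro: diff_mem J_mem P_mem)
    then show "ip H (smul H a h - J (\<lambda>x. a * P h x)) (J g) = 0"
      unfolding e using h g by (simp add: ip_smul_left P_orthogonal)
  qed
  then show ?thesis using h by (simp add: J_smul P_mem)
qed

lemma JP_diff:
  assumes "h \<in> vecs H" "k \<in> vecs H"
  shows "J (P (h - k)) = J (P h) - J (P k)"
  using JP_add[of "h - k" k] assms by (simp add: diff_mem eq_diff_eq)

lemma JP_sum: "(\<And>i. i \<in> I \<Longrightarrow> f i \<in> vecs H) \<Longrightarrow> J (P (sum f I)) = (\<Sum>i\<in>I. J (P (f i)))"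
proof (induction I rule: infinite_finite_induct)
  case (insert i I)
  then show ?case by (simp add: JP_add sum_mem)
qed (use JP_J[OF L2_zero] in \<open>simp_all add: J_zero\<close>)

lemma hnorm_JP_le:
  assumes h: "h \<in> vecs H"
  shows "hn (J (P h)) \<le> hn h"
proof (rule power2_le_imp_le)
  have "(hn (h - J (P h) + J (P h)))\<^sup>2 = (hn (h - J (P h)))\<^sup>2 + (hn (J (P h)))\<^sup>2"
    using h by (intro pythagoras P_orthogonal P_mem diff_mem J_mem)
  then show "(hn (J (P h)))\<^sup>2 \<le> (hn h)\<^sup>2" by simp
qed (use h in simp)

lemma EK_mem: "U \<in> sets circle_borel \<Longrightarrow> g \<in> vecs X \<Longrightarrow> EK U g \<in> vecs X"
  by (simp add: EK P_mem E_mem J_mem)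

text \<open>\<open>EK\<close> is the compression of \<open>E\<close>, and a finite sum passes
  through the linear map \<open>J \<circ> P\<close>; without \<open>J\<close> the two sides could
  differ by a null function.\<close>

lemma simple_spectral_integral_EK:
  assumes s: "simple_function circle_borel s" and g: "g \<in> vecs X"
  shows "simple_spectral_integral X EK s g \<in> vecs X"
    "J (simple_spectral_integral X EK s g) = J (P (simple_spectral_integral H E s (J g)))"
proof -
  have lev: "{t \<in> circle. s t = z} \<in> sets circle_borel" for z
    using level_set[OF s, of z] by (simp only: level_def)
  have eq: "simple_spectral_integral X EK s g = (\<lambda>x. \<Sum>z\<in>s ` circle. z * EK {t \<in> circle. s t = z} g x)"
  proof
    fix x
    have "(\<Sum>i\<in>I. f i) x = (\<Sum>i\<in>I. f i x)" for f :: "complex \<Rightarrow> point \<Rightarrow> complex" and I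
      by (induction I rule: infinite_finite_induct) simp_all
    then show "simple_spectral_integral X EK s g x = (\<Sum>z\<in>s ` circle. z * EK {t \<in> circle. s t = z} g x)"
      unfolding simple_spectral_integral_def smul_L2 .
  qed
  show "simple_spectral_integral X EK s g \<in> vecs X"
    unfolding eq by (intro L2_sum L2_smul EK_mem lev g)
  have "J (simple_spectral_integral X EK s g) = (\<Sum>z\<in>s ` circle. smul H z (J (EK {t \<in> circle. s t = z} g)))"
    unfolding eq by (subst J_sum) (intro L2_smul EK_mem lev g, intro sum.cong refl J_smul EK_mem lev g)
  also have "\<dots> = J (P (simple_spectral_integral H E s (J g)))"
    unfolding simple_spectral_integral_def
    by (subst JP_sum) (intro smul_mem E_mem lev J_mem g,
      intro sum.cong refl, simp only: EK[OF lev g] JP_smul[OF E_mem[OF lev J_mem[OF g]]])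
  finally show "J (simple_spectral_integral X EK s g) = J (P (simple_spectral_integral H E s (J g)))" .
qed

text \<open>\<open>spectral_integral\<close> picks some admissible value, so a witness comes first:
  \<open>P h\<close> is one because \<open>J \<circ> P\<close> is a contraction. The picked value
  and the witness are approached by the same rounded integrals, so \<open>J\<close> sends both to
  the same vector.\<close>

lemma spectral_integral_EK:
  assumes f: "1-lipschitz_on circle f" and g: "g \<in> vecs X"
  obtains h where "has_spectral_integral H E f (J g) h"
    "spectral_integral X EK f g \<in> vecs X" "J (spectral_integral X EK f g) = J (P h)"
proof -
  obtain h where h: "has_spectral_integral H E f (J g) h"
    using spectral_integral_exists[OF f J_mem[OF g]] by blast
  have hm: "h \<in> vecs H" using h unfolding has_spectral_integral_def by (rule conjunct1)
  have close: "hnorm X (simple_spectral_integral X EK s g - v) = hn (J (P (simple_spectral_integral H E s (J g))) - J v)"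
    if "simple_function circle_borel s" "v \<in> vecs X" for s v
    using simple_spectral_integral_EK[OF that(1) g] that(2)
    by (simp add: fun_diff_def hnorm_J L2_diff J_diff)
  have "has_spectral_integral X EK f g (P h)"
    unfolding has_spectral_integral_def
  proof (intro conjI P_mem hm allI impI)
    fix e :: real assume "e > 0"
    from h[unfolded has_spectral_integral_def, THEN conjunct2, THEN spec, THEN mp, OF \<open>e > 0\<close>]
    obtain \<delta> where \<delta>: "\<delta> > 0"
      "\<And>s. simple_function circle_borel s \<Longrightarrow> (\<forall>t\<in>circle. cmod (s t - f t) < \<delta>) \<Longrightarrow>
          hn (simple_spectral_integral H E s (J g) - h) < e"
      by blast
    show "\<exists>\<delta>>0. \<forall>s. simple_function circle_borel s \<and> (\<forall>t\<in>circle. cmod (s t - f t) < \<delta>) \<longrightarrow>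
        hnorm X (simple_spectral_integral X EK s g - P h) < e"
    proof (intro exI[of _ \<delta>] conjI \<delta>(1) allI impI, elim conjE)
      fix s assume s: "simple_function circle_borel s" "\<forall>t\<in>circle. cmod (s t - f t) < \<delta>"
      let ?S = "simple_spectral_integral H E s (J g)"
      have S: "?S \<in> vecs H" by (rule simple_spectral_integral_mem[OF s(1) J_mem[OF g]])
      have "hnorm X (simple_spectral_integral X EK s g - P h) = hn (J (P (?S - h)))"
        unfolding close[OF s(1) P_mem[OF hm]] JP_diff[OF S hm] ..
      also have "\<dots> \<le> hn (?S - h)" by (rule hnorm_JP_le[OF diff_mem[OF S hm]])
      also have "\<dots> < e" by (rule \<delta>(2)[OF s])
      finally show "hnorm X (simple_spectral_integral X EK s g - P h) < e" .
    qed
  qed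
  then have y: "has_spectral_integral X EK f g (spectral_integral X EK f g)" (is "has_spectral_integral _ _ _ _ ?y")
    unfolding spectral_integral_def by (rule someI[of "has_spectral_integral X EK f g"])
  then have ym: "?y \<in> vecs X" unfolding has_spectral_integral_def by (rule conjunct1)
  have "hn (J ?y - J (P h)) \<le> e" if e: "e > 0" for e
  proof -
    have "e / 2 > 0" using e by simp
    from eventually_conj[OF has_spectral_integral_rounding[OF y f this] has_spectral_integral_rounding[OF h f this]]
    obtain n where n: "hnorm X (simple_spectral_integral X EK (\<lambda>t. f (rounding n t)) g - ?y) < e / 2"
      "hn (simple_spectral_integral H E (\<lambda>t. f (rounding n t)) (J g) - h) < e / 2"
      by (auto dest: eventually_happens)
    let ?S = "simple_spectral_integral H E (\<lambda>t. f (rounding n t)) (J g)"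
    have S: "?S \<in> vecs H" by (rule simple_spectral_integral_mem[OF simple_function_rounding J_mem[OF g]])
    have "hn (J ?y - J (P h)) \<le> hn (J ?y - J (P ?S)) + hn (J (P ?S) - J (P h))"
      by (intro hnorm_diff_triangle J_mem P_mem ym S hm)
    also have "hn (J ?y - J (P ?S)) = hn (J (P ?S) - J ?y)"
      by (intro hnorm_minus_commute J_mem P_mem ym S)
    also have "\<dots> < e / 2" using n(1) unfolding close[OF simple_function_rounding ym] .
    also have "hn (J (P ?S) - J (P h)) < e / 2"
      unfolding JP_diff[OF S hm, symmetric] by (rule le_less_trans[OF hnorm_JP_le[OF diff_mem[OF S hm]] n(2)])
    finally show ?thesis by simp
  qed
  then have "hn (J ?y - J (P h)) \<le> 0" by (rule field_le_epsilon[of _ 0, simplified])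
  moreover have d: "J ?y - J (P h) \<in> vecs H" by (intro diff_mem J_mem P_mem ym hm)
  ultimately have "J ?y - J (P h) = 0"
    using hnorm_nonneg[OF d] by (intro hnorm_eq_0) simp_all
  with h ym show ?thesis by (intro that) simp_all
qed

section \<open>Powers of the Koopman operator and of its adjoint\<close>

lemma koopman_power_mem: "g \<in> vecs X \<Longrightarrow> (koopman F ^^ l) g \<in> vecs X"
  by (induction l) (simp_all add: koopman_L2[OF mps])

lemma J_koopman_power: "g \<in> vecs X \<Longrightarrow> J ((koopman F ^^ l) g) = (T ^^ l) (J g)"
  by (induction l) (simp_all add: koopman_power_mem flip: J_koopman)

lemma JP_T_power: "g \<in> vecs X \<Longrightarrow> J (P ((T ^^ l) (J g))) = J ((koopman F ^^ l) g)"
  using JP_J[OF koopman_power_mem[of g l]] by (simp only: J_koopman_power)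

text \<open>The compression \<open>P (Tinv (J g))\<close> of the adjoint upstairs witnesses that the
  choice in \<open>hadjoint\<close> is not vacuous, so the chosen function has the defining property
  of an adjoint.\<close>

lemma hadjoint_koopman:
  assumes g: "g \<in> vecs X"
  shows "hadjoint X (koopman F) g \<in> vecs X"
    "f \<in> vecs X \<Longrightarrow> ip X (koopman F f) g = ip X f (hadjoint X (koopman F) g)"
proof -
  let ?z = "P (Tinv (J g))"
  have Tg: "Tinv (J g) \<in> vecs H" by (intro Tinv_mem J_mem g)
  have "?z \<in> vecs X \<and> (\<forall>f\<in>vecs X. ip X (koopman F f) g = ip X f ?z)"
  proof (intro conjI ballI P_mem Tg)
    fix f assume f: "f \<in> vecs X"
    have m: "J f \<in> vecs H" "J ?z \<in> vecs H" by (intro J_mem P_mem f Tg)+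
    have "ip H (J f) (Tinv (J g) - J ?z) = 0"
      using P_orthogonal[OF Tg f] ip_cnj[OF diff_mem[OF Tg m(2)] m(1)] by simp
    then have "ip H (J f) (Tinv (J g)) = ip H (J f) (J ?z)"
      using ip_diff_right[OF Tg m(2) m(1)] by simp
    then show "ip X (koopman F f) g = ip X f ?z"
      using T_adjoint[OF m(1) J_mem[OF g]] koopman_L2[OF mps f] f g
      by (simp add: J_ip P_mem Tg flip: J_koopman)
  qed
  then have *: "hadjoint X (koopman F) g \<in> vecs X \<and> (\<forall>f\<in>vecs X. ip X (koopman F f) g = ip X f (hadjoint X (koopman F) g))"
    unfolding hadjoint_def
    by (rule someI[where P = "\<lambda>z. z \<in> vecs X \<and> (\<forall>f\<in>vecs X. ip X (koopman F f) g = ip X f z)"])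
  show "hadjoint X (koopman F) g \<in> vecs X" by (rule *[THEN conjunct1])
  show "f \<in> vecs X \<Longrightarrow> ip X (koopman F f) g = ip X f (hadjoint X (koopman F) g)"
    by (rule *[THEN conjunct2, THEN bspec])
qed

lemma adjoint_power_mem: "g \<in> vecs X \<Longrightarrow> (hadjoint X (koopman F) ^^ l) g \<in> vecs X"
  by (induction l) (simp_all add: hadjoint_koopman)

lemma ip_koopman_power:
  assumes "f \<in> vecs X" "g \<in> vecs X"
  shows "ip X ((koopman F ^^ l) f) g = ip X f ((hadjoint X (koopman F) ^^ l) g)"
  using assms
proof (induction l arbitrary: f)
  case (Suc l)
  have "ip X ((koopman F ^^ Suc l) f) g = ip X ((koopman F ^^ l) (koopman F f)) g"
    by (simp only: funpow_Suc_right o_apply)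
  also have "\<dots> = ip X (koopman F f) ((hadjoint X (koopman F) ^^ l) g)"
    by (rule Suc.IH[OF koopman_L2[OF mps Suc.prems(1)] Suc.prems(2)])
  also have "\<dots> = ip X f ((hadjoint X (koopman F) ^^ Suc l) g)"
    using hadjoint_koopman(2)[OF adjoint_power_mem[OF Suc.prems(2)] Suc.prems(1)] by simp
  finally show ?case .
qed simp

text \<open>The adjoint is only determined up to null functions, which \<open>J\<close> maps to \<open>0\<close>.\<close>

lemma J_adjoint_power:
  assumes g: "g \<in> vecs X"
  shows "J (P ((Tinv ^^ l) (J g))) = J ((hadjoint X (koopman F) ^^ l) g)"
proof (rule JP_unique[OF funpow_Tinv_mem[OF J_mem[OF g]] adjoint_power_mem[OF g]])
  fix f assume f: "f \<in> vecs X"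
  let ?h = "(Tinv ^^ l) (J g)" and ?k = "J ((hadjoint X (koopman F) ^^ l) g)"
  have m: "?h \<in> vecs H" "?k \<in> vecs H" "J f \<in> vecs H"
    by (intro funpow_Tinv_mem J_mem adjoint_power_mem f g)+
  \<comment> \<open>Powers of \<open>Tinv\<close> may leave the range of \<open>J\<close>, so they
    are moved to the other side of the inner product as powers of \<open>T\<close>, which preserve
    that range and act there as the Koopman operator.\<close>
  have "ip H (J f) ?h = ip H ((T ^^ l) (J f)) (J g)"
    by (rule T_funpow_adjoint[OF m(3) J_mem[OF g], symmetric])
  also have "\<dots> = ip X ((koopman F ^^ l) f) g"
    by (simp only: J_ip[OF koopman_power_mem[OF f] g] J_koopman_power[OF f])
  also have "\<dots> = ip H (J f) ?k"
    by (simp only: ip_koopman_power[OF f g] J_ip[OF f adjoint_power_mem[OF g]])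
  finally have "ip H (J f) (?h - ?k) = 0" by (simp add: ip_diff_right m)
  then show "ip H (?h - ?k) (J f) = 0"
    using ip_cnj[OF m(3) diff_mem[OF m(1,2)]] by simp
qed

text \<open>The estimate is made in \<open>H\<close>, where \<open>E\<close> is projection-valued,
  and the contraction \<open>J \<circ> P\<close> brings it down. The vector \<open>?k\<close>
  upstairs is sent by it to \<open>J q\<close>, as both sorts of powers compress to the right
  ones.\<close>

lemma koopman_trig_approximation:
  fixes f :: "complex \<Rightarrow> complex" and a b :: "nat \<Rightarrow> complex"
  assumes f: "1-lipschitz_on circle f" and g: "g \<in> vecs X"
    and approx: "\<And>z. z \<in> circle \<Longrightarrow> cmod (f z - (a 0 + (\<Sum>l=1..L. a l * z ^ l + b l * cnj z ^ l))) \<le> \<epsilon>"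
  defines "q \<equiv> (\<lambda>x. a 0 * g x + (\<Sum>l=1..L. a l * (koopman F ^^ l) g x + b l * (hadjoint X (koopman F) ^^ l) g x))"
  shows "q \<in> vecs X" "spectral_integral X EK f g \<in> vecs X"
    "hnorm X (\<lambda>x. spectral_integral X EK f g x - q x) \<le> \<epsilon> * hnorm X g"
proof -
  obtain h where h: "has_spectral_integral H E f (J g) h" and y: "spectral_integral X EK f g \<in> vecs X"
    and Jy: "J (spectral_integral X EK f g) = J (P h)"
    using spectral_integral_EK[OF f g] by blast
  have hm: "h \<in> vecs H" using h unfolding has_spectral_integral_def by (rule conjunct1)
  show q: "q \<in> vecs X"
    unfolding q_def by (intro L2_add L2_smul L2_sum koopman_power_mem adjoint_power_mem g)
  show "spectral_integral X EK f g \<in> vecs X" by (rule y)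
  let ?k = "smul H (a 0) (J g) + (\<Sum>l=1..L. smul H (a l) ((T ^^ l) (J g)) + smul H (b l) ((Tinv ^^ l) (J g)))"
  have Jg: "J g \<in> vecs H" by (rule J_mem[OF g])
  have k: "?k \<in> vecs H" by (intro mem funpow_T_mem funpow_Tinv_mem Jg)
  have "J q = smul H (a 0) (J g) + (\<Sum>l=1..L. smul H (a l) (J ((koopman F ^^ l) g)) + smul H (b l) (J ((hadjoint X (koopman F) ^^ l) g)))"
    unfolding q_def
    by (simp add: J_add J_smul J_sum L2_add L2_smul L2_sum koopman_power_mem adjoint_power_mem g sum.distrib)
  also have "\<dots> = J (P ?k)"
    by (simp add: JP_add JP_smul JP_sum JP_J mem funpow_T_mem funpow_Tinv_mem Jg g J_adjoint_power JP_T_power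
      sum.distrib)
  finally have Jq: "J q = J (P ?k)" .
  have "hnorm X (\<lambda>x. spectral_integral X EK f g x - q x) = hn (J (P h) - J (P ?k))"
    by (simp only: hnorm_J[OF L2_diff[OF y q]] J_diff[OF y q] Jy Jq)
  also have "\<dots> \<le> hn (h - ?k)"
    unfolding JP_diff[OF hm k, symmetric] by (rule hnorm_JP_le[OF diff_mem[OF hm k]])
  also have "\<dots> \<le> \<epsilon> * hn (J g)"
    by (rule spectral_integral_trig_approximation[OF h f Jg approx])
  finally show "hnorm X (\<lambda>x. spectral_integral X EK f g x - q x) \<le> \<epsilon> * hnorm X g"
    by (simp only: hnorm_J[OF g])
qed

end


section \<open>The error estimate\<close>

lemma Psi_mem: "(\<And>j. j < N \<Longrightarrow> \<psi> j \<in> vecs (L2 \<omega>)) \<Longrightarrow> Psi N \<psi> c \<in> vecs (L2 \<omega>)"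
  unfolding Psi_def by (intro L2_sum L2_smul) simp

text \<open>Separates the eigencomponents, so that at each point the value is linear in the diagonal
  \<open>h\<close> and diagonals can be added and subtracted like scalars.\<close>

lemma Psi_mat_diag:
  fixes h :: "nat \<Rightarrow> complex"
  assumes V: "V \<in> carrier_mat N N" and z: "z \<in> carrier_vec N"
  shows "Psi N \<psi> (V *\<^sub>v (mat_diag N h *\<^sub>v z)) t = (\<Sum>j<N. h j * (\<Sum>i<N. V $$ (i, j) * z $ j * \<psi> i t))"
proof -
  have "Psi N \<psi> (V *\<^sub>v (mat_diag N h *\<^sub>v z)) t = (\<Sum>i<N. (\<Sum>j<N. h j * (V $$ (i, j) * z $ j)) * \<psi> i t)"
    unfolding Psi_def by (intro sum.cong refl) (simp only: mat_diag_mult_index[OF V z] lessThan_iff)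
  also have "\<dots> = (\<Sum>i<N. \<Sum>j<N. h j * (V $$ (i, j) * z $ j * \<psi> i t))"
    by (simp add: sum_distrib_right mult.assoc)
  also have "\<dots> = (\<Sum>j<N. \<Sum>i<N. h j * (V $$ (i, j) * z $ j * \<psi> i t))" by (rule sum.swap)
  finally show ?thesis by (simp add: sum_distrib_left)
qed

lemma norm_index_le_vnorm: "i < dim_vec u \<Longrightarrow> cmod (u $ i) \<le> vnorm u"
  unfolding vnorm_def by (rule real_le_rsqrt) (rule member_le_sum, auto)

section \<open>The dictionary map and the comparison of the two calculi\<close>

context koopman_extension
begin

text \<open>A crude constant read off from the matrix entries is enough: it bounds the set whose
  supremum is \<open>Psi_opnorm\<close>, and it settles the case of vectors of norm 0, which cannot
  be rescaled to the unit ball.\<close>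

lemma Psi_bounded:
  assumes \<psi>: "\<And>j. j < N \<Longrightarrow> \<psi> j \<in> vecs X" and A: "A \<in> carrier_mat N N"
  shows "\<exists>c. \<forall>v\<in>carrier_vec N. hnorm X (Psi N \<psi> (A *\<^sub>v v)) \<le> c * vnorm v"
    and "bdd_above ((\<lambda>v. hnorm X (Psi N \<psi> (A *\<^sub>v v))) ` {v \<in> carrier_vec N. vnorm v \<le> 1})"
proof -
  define c where "c = (\<Sum>i<N. (\<Sum>j<N. cmod (A $$ (i, j))) * hnorm X (\<psi> i))"
  have bound: "hnorm X (Psi N \<psi> (A *\<^sub>v v)) \<le> c * vnorm v" if v: "v \<in> carrier_vec N" for v
  proof -
    have "hnorm X (Psi N \<psi> (A *\<^sub>v v)) \<le> (\<Sum>i<N. hnorm X (\<lambda>x. (A *\<^sub>v v) $ i * \<psi> i x))"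
      unfolding Psi_def by (rule X_norm_sum_le) (simp add: L2_smul \<psi>)
    also have "\<dots> = (\<Sum>i<N. cmod ((A *\<^sub>v v) $ i) * hnorm X (\<psi> i))"
      by (intro sum.cong refl X_norm_smul \<psi>) simp
    also have "\<dots> \<le> (\<Sum>i<N. ((\<Sum>j<N. cmod (A $$ (i, j))) * vnorm v) * hnorm X (\<psi> i))"
    proof (intro sum_mono mult_right_mono X_norm_nonneg \<psi>)
      fix i assume i: "i \<in> {..<N}"
      have "(A *\<^sub>v v) $ i = (\<Sum>j<N. A $$ (i, j) * v $ j)"
        using A v i by (simp add: scalar_prod_def atLeast0LessThan)
      also have "cmod \<dots> \<le> (\<Sum>j<N. cmod (A $$ (i, j)) * vnorm v)"
      proof (rule sum_norm_le)
        fix j assume "j \<in> {..<N}"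
        then show "cmod (A $$ (i, j) * v $ j) \<le> cmod (A $$ (i, j)) * vnorm v"
          unfolding norm_mult using v by (intro mult_left_mono norm_index_le_vnorm) auto
      qed
      finally show "cmod ((A *\<^sub>v v) $ i) \<le> (\<Sum>j<N. cmod (A $$ (i, j))) * vnorm v"
        by (simp add: sum_distrib_right)
    qed simp
    finally show ?thesis by (simp add: c_def sum_distrib_left mult_ac)
  qed
  have c0: "0 \<le> c" unfolding c_def by (intro sum_nonneg mult_nonneg_nonneg X_norm_nonneg \<psi>) auto
  show "\<exists>c. \<forall>v\<in>carrier_vec N. hnorm X (Psi N \<psi> (A *\<^sub>v v)) \<le> c * vnorm v"
    using bound by blast
  show "bdd_above ((\<lambda>v. hnorm X (Psi N \<psi> (A *\<^sub>v v))) ` {v \<in> carrier_vec N. vnorm v \<le> 1})"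
  proof (rule bdd_aboveI2)
    fix v assume "v \<in> {v \<in> carrier_vec N. vnorm v \<le> 1}"
    then have v: "v \<in> carrier_vec N" "vnorm v \<le> 1" by auto
    from bound[OF v(1)] mult_left_mono[OF v(2) c0] show "hnorm X (Psi N \<psi> (A *\<^sub>v v)) \<le> c" by simp
  qed
qed

lemma Psi_opnorm_nonneg:
  assumes \<psi>: "\<And>j. j < N \<Longrightarrow> \<psi> j \<in> vecs X" and A: "A \<in> carrier_mat N N"
  shows "0 \<le> Psi_opnorm \<omega> N \<psi> A"
proof -
  have "0 \<le> hnorm X (Psi N \<psi> (A *\<^sub>v 0\<^sub>v N))"
    by (intro X_norm_nonneg Psi_mem \<psi>)
  also have "\<dots> \<le> Psi_opnorm \<omega> N \<psi> A"
    unfolding Psi_opnorm_def by (intro cSUP_upper Psi_bounded(2) \<psi> A) (simp_all add: vnorm_def)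
  finally show ?thesis .
qed

lemma Psi_norm_le_opnorm:
  assumes \<psi>: "\<And>j. j < N \<Longrightarrow> \<psi> j \<in> vecs X" and A: "A \<in> carrier_mat N N" and u: "u \<in> carrier_vec N"
  shows "hnorm X (Psi N \<psi> (A *\<^sub>v u)) \<le> Psi_opnorm \<omega> N \<psi> A * vnorm u"
proof -
  obtain c where bound: "\<And>v. v \<in> carrier_vec N \<Longrightarrow> hnorm X (Psi N \<psi> (A *\<^sub>v v)) \<le> c * vnorm v"
    using Psi_bounded(1)[of N \<psi> A, OF \<psi> A] by blast
  show ?thesis
  proof (cases "vnorm u = 0")
    case True
    with bound[OF u] show ?thesis by simp
  next
    case False
    with vnorm_nonneg[of u] have pos: "0 < vnorm u" by simp
    define s where "s = inverse (vnorm u)"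
    have s: "0 < s" "s * vnorm u = 1" using pos by (simp_all add: s_def)
    let ?v = "complex_of_real s \<cdot>\<^sub>v u"
    have v: "?v \<in> carrier_vec N" using u by simp
    have "vnorm ?v = s * vnorm u"
      using s by (simp add: vnorm_def norm_mult power_mult_distrib real_sqrt_mult flip: sum_distrib_left)
    then have "hnorm X (Psi N \<psi> (A *\<^sub>v ?v)) \<le> Psi_opnorm \<omega> N \<psi> A"
      unfolding Psi_opnorm_def using v s by (intro cSUP_upper Psi_bounded(2) \<psi> A) simp_all
    also have "Psi N \<psi> (A *\<^sub>v ?v) = (\<lambda>x. complex_of_real s * Psi N \<psi> (A *\<^sub>v u) x)"
      using A u by (auto simp: Psi_def mult_mat_vec sum_distrib_left mult.assoc intro!: sum.cong)
    also have "hnorm X \<dots> = s * hnorm X (Psi N \<psi> (A *\<^sub>v u))"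
      using s by (simp add: X_norm_smul Psi_mem \<psi>)
    finally have "s * hnorm X (Psi N \<psi> (A *\<^sub>v u)) \<le> Psi_opnorm \<omega> N \<psi> A" .
    then have "vnorm u * (s * hnorm X (Psi N \<psi> (A *\<^sub>v u))) \<le> vnorm u * Psi_opnorm \<omega> N \<psi> A"
      using pos by (intro mult_left_mono) simp_all
    also have "vnorm u * (s * hnorm X (Psi N \<psi> (A *\<^sub>v u))) = (s * vnorm u) * hnorm X (Psi N \<psi> (A *\<^sub>v u))"
      by (simp only: mult_ac)
    finally show ?thesis using s(2) by (simp add: mult.commute)
  qed
qed

lemma mpedmd_functional_calculus_error:
  fixes \<phi> :: "complex \<Rightarrow> real"
  assumes dict: "\<forall>j<N. \<psi> j \<in> vecs X"
    and fac: "mpedmd_factorization N G A R U1 \<sigma> U2 Vh lam"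
    and lip: "1-lipschitz_on circle \<phi>" and bound: "\<forall>z\<in>circle. \<bar>\<phi> z\<bar> \<le> B"
    and g: "g \<in> vecs X" and c: "c \<in> carrier_vec N"
  defines "KK \<equiv> mpedmd_matrix R U1 U2" and "K \<equiv> koopman F" and "Ks \<equiv> hadjoint X (koopman F)"
    and "f \<equiv> (\<lambda>z. complex_of_real (\<phi> z))"
  shows "hnorm X (\<lambda>x. spectral_integral X EK f g x
        - Psi N \<psi> (atomic_integral N (lam ` {..<N}) (mpedmd_measure N G R Vh lam) f *\<^sub>v c) x)
    \<le> pi / (real L + 2) * (hnorm X g + Psi_opnorm \<omega> N \<psi> (mat_inv R) * vnorm (R *\<^sub>v c))
      + B * hnorm X (\<lambda>x. g x - Psi N \<psi> c x)
      + (\<Sum>l=1..L. pi / (2 * real l) * (hnorm X (\<lambda>x. (K ^^ l) g x - Psi N \<psi> ((KK ^\<^sub>m l) *\<^sub>v c) x)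
          + hnorm X (\<lambda>x. (Ks ^^ l) g x - Psi N \<psi> ((mat_inv KK ^\<^sub>m l) *\<^sub>v c) x)))"
proof -
  have \<psi>: "\<psi> j \<in> vecs X" if "j < N" for j using dict that by blast
  obtain a where a0: "cmod (a 0) \<le> B" and al: "\<And>l. l \<in> {1..L} \<Longrightarrow> cmod (a l) \<le> pi / (2 * real l)"
    and approx: "\<And>z. cmod z = 1 \<Longrightarrow>
      cmod (\<phi> z - (a 0 + (\<Sum>l=1..L. a l * z ^ l + cnj (a l) * cnj z ^ l))) \<le> pi / (real L + 2)"
    using lipschitz_circle_trig_approximation[OF lip, of B L] bound by auto
  define \<epsilon> where "\<epsilon> = pi / (real L + 2)"
  have \<epsilon>: "0 \<le> \<epsilon>" by (simp add: \<epsilon>_def)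
  \<comment> \<open>As \<phi> is real, opposite frequencies have conjugate coefficients; positive
    and negative powers then share one bound.\<close>
  define b where "b l = cnj (a l)" for l
  define p where "p z = a 0 + (\<Sum>l=1..L. a l * z ^ l + b l * cnj z ^ l)" for z
  have fp: "cmod (f z - p z) \<le> \<epsilon>" if "z \<in> circle" for z
    using approx[of z] that by (simp add: f_def p_def b_def \<epsilon>_def)
  have f: "1-lipschitz_on circle f"
    using lip by (simp add: lipschitz_on_def f_def dist_norm flip: of_real_diff)
  define q where "q = (\<lambda>x. a 0 * g x + (\<Sum>l=1..L. a l * (K ^^ l) g x + b l * (Ks ^^ l) g x))"
  define y where "y = spectral_integral X EK f g"
  have q: "q \<in> vecs X" and y: "y \<in> vecs X" and yq: "hnorm X (\<lambda>x. y x - q x) \<le> \<epsilon> * hnorm X g"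
    unfolding q_def y_def K_def Ks_def
    by (rule koopman_trig_approximation[OF f g fp[unfolded p_def]], assumption)+
  define V where "V = mat_inv R * Vh"
  define Z where "Z = mat_adjoint Vh * R"
  note diag = mpedmd_diagonalization[OF fac, folded V_def Z_def KK_def]
  have V: "V \<in> carrier_mat N N" and Z: "Z \<in> carrier_mat N N" by (rule diag)+
  define z where "z = Z *\<^sub>v c"
  have z: "z \<in> carrier_vec N" using Z c by (simp add: z_def)
  \<comment> \<open>Every mpEDMD quantity below is \<open>Q\<close> of a diagonal: 1 for
    \<open>Psi N \<psi> c\<close>, powers of the eigenvalues or their conjugates for the iterates,
    \<open>f (lam j)\<close> for the integral.\<close>
  define Q where "Q h = Psi N \<psi> (V *\<^sub>v (mat_diag N h *\<^sub>v z))" for h :: "nat \<Rightarrow> complex"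
  have Qm: "Q h \<in> vecs X" for h unfolding Q_def by (rule Psi_mem[OF \<psi>])
  have app: "(V * mat_diag N h * Z) *\<^sub>v c = V *\<^sub>v (mat_diag N h *\<^sub>v z)" for h :: "nat \<Rightarrow> complex"
    using V Z c by (simp add: z_def assoc_mult_mat_vec[of _ N N _ N] mult_carrier_mat[of _ N N _ N])
  define u where "u l = Psi N \<psi> ((KK ^\<^sub>m l) *\<^sub>v c)" for l
  define v where "v l = Psi N \<psi> ((mat_inv KK ^\<^sub>m l) *\<^sub>v c)" for l
  have uQ: "u l = Q (\<lambda>j. lam j ^ l)" and vQ: "v l = Q (\<lambda>j. cnj (lam j) ^ l)" for l
    by (simp_all only: u_def v_def Q_def diag app)
  have cQ: "Psi N \<psi> c = Q (\<lambda>j. 1)"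
  proof -
    have "V *\<^sub>v z = (V * Z) *\<^sub>v c" using V Z c by (simp add: z_def)
    then show ?thesis using diag(3) z c by (simp add: Q_def)
  qed
  have fQ: "Psi N \<psi> (atomic_integral N (lam ` {..<N}) (mpedmd_measure N G R Vh lam) f *\<^sub>v c) = Q (\<lambda>j. f (lam j))"
    by (simp only: diag app Q_def)
  define w where "w j t = (\<Sum>i<N. V $$ (i, j) * z $ j * \<psi> i t)" for j t
  have Q: "Q h t = (\<Sum>j<N. h j * w j t)" for h t
    unfolding Q_def w_def by (rule Psi_mat_diag[OF V z])
  let ?s = "\<lambda>x. \<Sum>l=1..L. a l * ((K ^^ l) g x - u l x) + b l * ((Ks ^^ l) g x - v l x)"
  \<comment> \<open>Regrouping by powers pairs the constant terms into the projection error of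
    \<open>g\<close> and each other term with the iterate of the same exponent, so no error
    accumulates between different powers.\<close>
  have qp: "q x - Q (\<lambda>j. p (lam j)) x = a 0 * (g x - Psi N \<psi> c x) + ?s x" for x
  proof -
    have "Q (\<lambda>j. p (lam j)) x = a 0 * Psi N \<psi> c x + (\<Sum>j<N. \<Sum>l=1..L. a l * (lam j ^ l * w j x) + b l * (cnj (lam j) ^ l * w j x))"
      by (simp add: p_def Q cQ distrib_right sum.distrib sum_distrib_left sum_distrib_right mult.assoc)
    also have "(\<Sum>j<N. \<Sum>l=1..L. a l * (lam j ^ l * w j x) + b l * (cnj (lam j) ^ l * w j x))
       = (\<Sum>l=1..L. \<Sum>j<N. a l * (lam j ^ l * w j x) + b l * (cnj (lam j) ^ l * w j x))" by (rule sum.swap)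
    also have "\<dots> = (\<Sum>l=1..L. a l * u l x + b l * v l x)"
      by (simp add: uQ vQ Q sum.distrib sum_distrib_left)
    finally show ?thesis
      by (simp add: q_def right_diff_distrib sum.distrib sum_subtractf)
  qed
  have Km: "(K ^^ l) g \<in> vecs X" and Ksm: "(Ks ^^ l) g \<in> vecs X" for l
    unfolding K_def Ks_def by (intro koopman_power_mem adjoint_power_mem g)+
  have um: "u l \<in> vecs X" and vm: "v l \<in> vecs X" for l unfolding u_def v_def by (intro Psi_mem \<psi>, assumption)+
  have gm: "(\<lambda>x. g x - Psi N \<psi> c x) \<in> vecs X" by (intro L2_diff g Psi_mem \<psi>)
  have sm: "(\<lambda>x. a l * ((K ^^ l) g x - u l x) + b l * ((Ks ^^ l) g x - v l x)) \<in> vecs X" for l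
    by (intro L2_add L2_smul L2_diff Km Ksm um vm)
  have n2: "hnorm X (\<lambda>x. q x - Q (\<lambda>j. p (lam j)) x) \<le> B * hnorm X (\<lambda>x. g x - Psi N \<psi> c x)
      + (\<Sum>l=1..L. pi / (2 * real l) * (hnorm X (\<lambda>x. (K ^^ l) g x - u l x) + hnorm X (\<lambda>x. (Ks ^^ l) g x - v l x)))"
  proof -
    have "hnorm X (\<lambda>x. q x - Q (\<lambda>j. p (lam j)) x) \<le> hnorm X (\<lambda>x. a 0 * (g x - Psi N \<psi> c x)) + hnorm X ?s"
      unfolding qp by (intro X_norm_triangle L2_smul gm L2_sum sm)
    also have "hnorm X (\<lambda>x. a 0 * (g x - Psi N \<psi> c x)) \<le> B * hnorm X (\<lambda>x. g x - Psi N \<psi> c x)"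
      unfolding X_norm_smul[OF gm] by (intro mult_right_mono a0 X_norm_nonneg gm)
    also have "hnorm X ?s \<le> (\<Sum>l=1..L. hnorm X (\<lambda>x. a l * ((K ^^ l) g x - u l x) + b l * ((Ks ^^ l) g x - v l x)))"
      by (rule X_norm_sum_le[OF sm])
    also have "\<dots> \<le> (\<Sum>l=1..L. pi / (2 * real l) * (hnorm X (\<lambda>x. (K ^^ l) g x - u l x) + hnorm X (\<lambda>x. (Ks ^^ l) g x - v l x)))"
    proof (rule sum_mono)
      fix l assume l: "l \<in> {1..L}"
      have m: "(\<lambda>x. (K ^^ l) g x - u l x) \<in> vecs X" "(\<lambda>x. (Ks ^^ l) g x - v l x) \<in> vecs X"
        by (intro L2_diff Km Ksm um vm)+
      have "hnorm X (\<lambda>x. a l * ((K ^^ l) g x - u l x) + b l * ((Ks ^^ l) g x - v l x))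
         \<le> hnorm X (\<lambda>x. a l * ((K ^^ l) g x - u l x)) + hnorm X (\<lambda>x. b l * ((Ks ^^ l) g x - v l x))"
        by (intro X_norm_triangle L2_smul m)
      also have "\<dots> = cmod (a l) * (hnorm X (\<lambda>x. (K ^^ l) g x - u l x) + hnorm X (\<lambda>x. (Ks ^^ l) g x - v l x))"
        by (simp add: X_norm_smul[OF m(1)] X_norm_smul[OF m(2)] b_def distrib_left)
      also have "\<dots> \<le> pi / (2 * real l) * (hnorm X (\<lambda>x. (K ^^ l) g x - u l x) + hnorm X (\<lambda>x. (Ks ^^ l) g x - v l x))"
        by (intro mult_right_mono al[OF l] add_nonneg_nonneg X_norm_nonneg m)
      finally show "hnorm X (\<lambda>x. a l * ((K ^^ l) g x - u l x) + b l * ((Ks ^^ l) g x - v l x))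
         \<le> pi / (2 * real l) * (hnorm X (\<lambda>x. (K ^^ l) g x - u l x) + hnorm X (\<lambda>x. (Ks ^^ l) g x - v l x))" .
    qed
    finally show ?thesis by simp
  qed
  have n3: "hnorm X (\<lambda>x. Q (\<lambda>j. p (lam j)) x - Q (\<lambda>j. f (lam j)) x) \<le> \<epsilon> * (Psi_opnorm \<omega> N \<psi> (mat_inv R) * vnorm (R *\<^sub>v c))"
  proof -
    let ?h = "\<lambda>j. p (lam j) - f (lam j)"
    have pd: "positive_definite N R" and Vh: "Vh \<in> carrier_mat N N" "Vh * mat_adjoint Vh = 1\<^sub>m N" "mat_adjoint Vh * Vh = 1\<^sub>m N"
      using fac by (simp_all add: mpedmd_factorization_def is_matrix_sqrt_def unitary_matrix_def)
    have R: "R \<in> carrier_mat N N" using pd by (simp add: positive_definite_def)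
    note Ri = positive_definite_mat_inv[OF pd]
    have W: "mat_adjoint Vh \<in> carrier_mat N N" by (rule mat_adjoint_carrier[OF Vh(1)])
    \<comment> \<open>The eigencoordinates \<open>z\<close> differ from \<open>R *\<^sub>v c\<close>
      by a unitary matrix. Together with \<open>V = mat_inv R * Vh\<close> this yields the operator
      norm of the dictionary map at \<open>mat_inv R\<close>, with no condition number of
      \<open>V\<close>.\<close>
    have vz: "vnorm z = vnorm (R *\<^sub>v c)"
    proof -
      have zW: "z = mat_adjoint Vh *\<^sub>v (R *\<^sub>v c)" unfolding z_def Z_def using W R c by simp
      have "Vh *\<^sub>v z = (Vh * mat_adjoint Vh) *\<^sub>v (R *\<^sub>v c)" unfolding zW using Vh(1) W R c by simp
      then have "Vh *\<^sub>v z = R *\<^sub>v c" using R c by (simp add: Vh(2))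
      then show ?thesis using vnorm_isometry[OF Vh(1,3) z] by simp
    qed
    have dz: "mat_diag N ?h *\<^sub>v z \<in> carrier_vec N" by (rule mult_mat_vec_carrier[OF mat_diag_dim z])
    have "(\<lambda>x. Q (\<lambda>j. p (lam j)) x - Q (\<lambda>j. f (lam j)) x) = Q ?h"
      by (rule ext) (simp add: Q left_diff_distrib sum_subtractf)
    also have "\<dots> = Psi N \<psi> (mat_inv R *\<^sub>v (Vh *\<^sub>v (mat_diag N ?h *\<^sub>v z)))"
      unfolding Q_def V_def using Ri(1) Vh(1) dz by (simp add: assoc_mult_mat_vec[of _ N N _ N])
    finally have "hnorm X (\<lambda>x. Q (\<lambda>j. p (lam j)) x - Q (\<lambda>j. f (lam j)) x)
        = hnorm X (Psi N \<psi> (mat_inv R *\<^sub>v (Vh *\<^sub>v (mat_diag N ?h *\<^sub>v z))))" by (rule arg_cong)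
    also have "\<dots> \<le> Psi_opnorm \<omega> N \<psi> (mat_inv R) * vnorm (Vh *\<^sub>v (mat_diag N ?h *\<^sub>v z))"
      using Vh(1) dz by (intro Psi_norm_le_opnorm \<psi> Ri(1)) auto
    also have "\<dots> = Psi_opnorm \<omega> N \<psi> (mat_inv R) * vnorm (mat_diag N ?h *\<^sub>v z)"
      by (simp only: vnorm_isometry[OF Vh(1,3) dz])
    also have "\<dots> \<le> Psi_opnorm \<omega> N \<psi> (mat_inv R) * (\<epsilon> * vnorm z)"
    proof (rule mult_left_mono)
      show "vnorm (mat_diag N ?h *\<^sub>v z) \<le> \<epsilon> * vnorm z"
      proof (rule vnorm_mat_diag_le[OF z _ \<epsilon>])
        fix j assume "j < N"
        then have "lam j \<in> circle" using diag(4) by simp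
        from fp[OF this] show "cmod (?h j) \<le> \<epsilon>" by (simp add: norm_minus_commute)
      qed
      show "0 \<le> Psi_opnorm \<omega> N \<psi> (mat_inv R)" by (intro Psi_opnorm_nonneg \<psi> Ri(1))
    qed
    finally show ?thesis by (simp add: vz mult_ac)
  qed
  have "hnorm X (\<lambda>x. y x - Q (\<lambda>j. f (lam j)) x)
      \<le> hnorm X (\<lambda>x. y x - q x) + hnorm X (\<lambda>x. (q x - Q (\<lambda>j. p (lam j)) x) + (Q (\<lambda>j. p (lam j)) x - Q (\<lambda>j. f (lam j)) x))"
    using X_norm_triangle[of "\<lambda>x. y x - q x" "\<lambda>x. (q x - Q (\<lambda>j. p (lam j)) x) + (Q (\<lambda>j. p (lam j)) x - Q (\<lambda>j. f (lam j)) x)"]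
    by (simp add: L2_diff y q Qm)
  also have "hnorm X (\<lambda>x. (q x - Q (\<lambda>j. p (lam j)) x) + (Q (\<lambda>j. p (lam j)) x - Q (\<lambda>j. f (lam j)) x))
      \<le> hnorm X (\<lambda>x. q x - Q (\<lambda>j. p (lam j)) x) + hnorm X (\<lambda>x. Q (\<lambda>j. p (lam j)) x - Q (\<lambda>j. f (lam j)) x)"
    by (intro X_norm_triangle L2_diff q Qm)
  finally show ?thesis
    using yq n2 n3 unfolding fQ y_def[symmetric] u_def[symmetric] v_def[symmetric] \<epsilon>_def[symmetric]
    by (simp add: distrib_left)
qed

end

section \<open>Choice of the universal constant\<close>

theorem theorem5p1:
  "\<exists>C>0. \<forall>(d::nat) (\<omega>::point measure) (F::point \<Rightarrow> point) E
      (N::nat) (M::nat) (\<psi>::nat \<Rightarrow> point \<Rightarrow> complex) (x::nat \<Rightarrow> point) (y::nat \<Rightarrow> point) (w::nat \<Rightarrow> real)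
      R U1 \<sigma> U2 Vh lam (\<phi>::complex \<Rightarrow> real) (L::nat) (g::point \<Rightarrow> complex) (c::complex vec).
    measure_preserving_system d \<omega> F \<longrightarrow>
    koopman_spectral_measure \<omega> F E \<longrightarrow>
    (\<forall>j<N. \<psi> j \<in> vecs (L2 \<omega>)) \<longrightarrow>
    (\<forall>m<M. x m \<in> space \<omega> \<and> y m = F (x m) \<and> 0 \<le> w m) \<longrightarrow>
    invertible_mat (gram_G N M \<psi> x w) \<longrightarrow>
    mpedmd_factorization N (gram_G N M \<psi> x w) (cross_A N M \<psi> x y w) R U1 \<sigma> U2 Vh lam \<longrightarrow>
    1-lipschitz_on circle \<phi> \<longrightarrow>
    2 \<le> L \<longrightarrow>
    g \<in> vecs (L2 \<omega>) \<longrightarrow>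
    c \<in> carrier_vec N \<longrightarrow>
    (let G = gram_G N M \<psi> x w;
         KK = mpedmd_matrix R U1 U2;
         K = koopman F;
         Ks = hadjoint (L2 \<omega>) K;
         f = (\<lambda>z. complex_of_real (\<phi> z));
         int_E = spectral_integral (L2 \<omega>) E f g;
         int_EN = atomic_integral N (lam ` {..<N}) (mpedmd_measure N G R Vh lam) f
     in hnorm (L2 \<omega>) (int_E - Psi N \<psi> (int_EN *\<^sub>v c))
        \<le> C * (ln (real L) / real L
                 * (hnorm (L2 \<omega>) g + Psi_opnorm \<omega> N \<psi> (mat_inv R) * vnorm (R *\<^sub>v c))
               + hnorm (L2 \<omega>) (g - Psi N \<psi> c) * (SUP z\<in>circle. \<bar>\<phi> z\<bar>)
               + (\<Sum>l=1..L.
                   (hnorm (L2 \<omega>) ((K ^^ l) g - Psi N \<psi> ((KK ^\<^sub>m l) *\<^sub>v c))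
                    + hnorm (L2 \<omega>) ((Ks ^^ l) g - Psi N \<psi> ((mat_inv KK ^\<^sub>m l) *\<^sub>v c)))
                   / real l)))"
\<comment> \<open>Dividing by \<open>ln 2\<close> converts the rate \<open>pi / L\<close> into a
  multiple of \<open>ln L / L\<close>, since \<open>ln L\<close> is at least \<open>ln 2\<close>. As
  \<open>ln 2\<close> is at most 1, the constant is at least \<open>pi\<close> and so also dominates
  the coefficients 1 and \<open>pi / 2\<close> of the other two terms.\<close>
proof (intro exI[of _ "pi / ln 2"] conjI allI impI)
  show "0 < pi / ln (2 :: real)" by simp
next
  fix d :: nat and \<omega> F E and N M :: nat and \<psi> x y w R U1 \<sigma> U2 Vh lam
    and \<phi> :: "complex \<Rightarrow> real" and L :: nat and g and c :: "complex vec"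
  assume mps: "measure_preserving_system d \<omega> F" and ksm: "koopman_spectral_measure \<omega> F E"
    and \<psi>: "\<forall>j<N. \<psi> j \<in> vecs (L2 \<omega>)"
    and fac: "mpedmd_factorization N (gram_G N M \<psi> x w) (cross_A N M \<psi> x y w) R U1 \<sigma> U2 Vh lam"
    and lip: "1-lipschitz_on circle \<phi>" and L: "2 \<le> L" and g: "g \<in> vecs (L2 \<omega>)" and c: "c \<in> carrier_vec N"
  from ksm obtain H' :: "(nat \<Rightarrow> point \<Rightarrow> complex) cips" and K' E' J P where
    hs: "hilbert_space H'" and un: "unitary_operator H' K'" and iso: "linear_isometry (L2 \<omega>) H' J"
    and JK: "\<forall>g\<in>vecs (L2 \<omega>). K' (J g) = J (koopman F g)"
    and sp: "spectral_measure_of_unitary H' K' E'"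
    and P: "\<forall>h\<in>vecs H'. P h \<in> vecs (L2 \<omega>) \<and> (\<forall>g\<in>vecs (L2 \<omega>). ip H' (h - J (P h)) (J g) = 0)"
    and EK: "\<forall>U\<in>sets circle_borel. \<forall>g\<in>vecs (L2 \<omega>). E U g = P (E' U (J g))"
    unfolding koopman_spectral_measure_def by blast
  interpret koopman_extension H' E' K' d \<omega> F J P E
  proof unfold_locales
    show "hilbert_space H'" by (rule hs)
    show "projection_valued_measure H' E'" using sp by (simp add: spectral_measure_of_unitary_def)
    show "unitary_operator H' K'" by (rule un)
    show "has_spectral_integral H' E' (\<lambda>z. z) x (K' x)" if "x \<in> vecs H'" for x
      using sp that by (simp add: spectral_measure_of_unitary_def)
    show "measure_preserving_system d \<omega> F" by (rule mps)
    show "linear_isometry (L2 \<omega>) H' J" by (rule iso)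
  qed (use JK P EK in blast)+
  define B where "B = (SUP z\<in>circle. \<bar>\<phi> z\<bar>)"
  \<comment> \<open>A Lipschitz function is bounded on the circle, whose points are at distance at
    most 2 from \<open>1\<close>; hence the supremum is over a set bounded above and dominates each
    value.\<close>
  have bound: "\<forall>z\<in>circle. \<bar>\<phi> z\<bar> \<le> B"
    unfolding B_def
  proof (intro ballI cSUP_upper bdd_aboveI2)
    fix u :: complex assume u: "u \<in> circle"
    have "dist (\<phi> u) (\<phi> 1) \<le> 1 * dist u 1" using lipschitz_onD[OF lip u, of 1] by simp
    also have "\<dots> \<le> 2" using norm_triangle_ineq4[of u 1] u by (simp add: dist_norm)
    finally show "\<bar>\<phi> u\<bar> \<le> \<bar>\<phi> 1\<bar> + 2" by (simp add: dist_real_def)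
  qed
  define p where "p = hnorm (L2 \<omega>) g + Psi_opnorm \<omega> N \<psi> (mat_inv R) * vnorm (R *\<^sub>v c)"
  define q where "q = hnorm (L2 \<omega>) (\<lambda>t. g t - Psi N \<psi> c t)"
  define K where "K = koopman F"
  define Ks where "Ks = hadjoint (L2 \<omega>) K"
  define KK where "KK = mpedmd_matrix R U1 U2"
  define r where "r l = hnorm X (\<lambda>t. (K ^^ l) g t - Psi N \<psi> ((KK ^\<^sub>m l) *\<^sub>v c) t)
          + hnorm X (\<lambda>t. (Ks ^^ l) g t - Psi N \<psi> ((mat_inv KK ^\<^sub>m l) *\<^sub>v c) t)" for l
  have q0: "0 \<le> q" unfolding q_def using \<psi> by (intro X_norm_nonneg L2_diff g Psi_mem) simp
  have r0: "0 \<le> r l" for l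
    unfolding r_def Ks_def K_def using \<psi>
    by (intro add_nonneg_nonneg X_norm_nonneg L2_diff Psi_mem koopman_power_mem adjoint_power_mem g) simp_all
  have "positive_definite N R" using fac by (simp add: mpedmd_factorization_def is_matrix_sqrt_def)
  then have p0: "0 \<le> p" unfolding p_def using \<psi>
    by (intro add_nonneg_nonneg mult_nonneg_nonneg X_norm_nonneg Psi_opnorm_nonneg vnorm_nonneg g positive_definite_mat_inv)
      simp_all
  have B0: "0 \<le> B" using bspec[OF bound, of 1] by simp
  have ln2: "0 < ln (2 :: real)" "ln (2 :: real) \<le> 1" using ln_2_less_1 by simp_all
  have C: "pi \<le> pi / ln 2" using ln2 by (simp add: field_simps mult_left_le)
  have coeff: "pi / (real L + 2) \<le> pi / ln 2 * (ln (real L) / real L)"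
  proof -
    have "pi / (real L + 2) \<le> pi / real L" using L by (intro divide_left_mono) auto
    also have "\<dots> = pi / ln 2 * (ln 2 / real L)" using ln2 by simp
    also have "\<dots> \<le> pi / ln 2 * (ln (real L) / real L)"
      using L ln2 by (intro mult_left_mono divide_right_mono) simp_all
    finally show ?thesis .
  qed
  have tail: "(\<Sum>l=1..L. pi / (2 * real l) * r l) \<le> (\<Sum>l=1..L. pi / ln 2 * (r l / real l))"
  proof (rule sum_mono)
    fix l assume "l \<in> {1..L}"
    then have "pi / (2 * real l) * r l = pi / 2 * (r l / real l)" by simp
    also have "\<dots> \<le> pi / ln 2 * (r l / real l)"
      using C r0[of l] pi_gt_zero by (intro mult_right_mono divide_nonneg_nonneg) linarith+
    finally show "pi / (2 * real l) * r l \<le> pi / ln 2 * (r l / real l)" .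
  qed
  have head: "B * q \<le> pi / ln 2 * (q * B)"
  proof -
    have "1 \<le> pi / ln 2" using C pi_gt3 by linarith
    from mult_right_mono[OF this mult_nonneg_nonneg[OF q0 B0]] show ?thesis by (simp add: mult.commute)
  qed
  have main: "pi / (real L + 2) * p \<le> pi / ln 2 * (ln (real L) / real L) * p"
    by (rule mult_right_mono[OF coeff p0])
  note error = mpedmd_functional_calculus_error[of N \<psi>, OF \<psi> fac lip bound g c, where L = L, folded K_def KK_def,
      folded Ks_def p_def q_def, folded r_def]
  show "let G = gram_G N M \<psi> x w;
         KK = mpedmd_matrix R U1 U2;
         K = koopman F;
         Ks = hadjoint (L2 \<omega>) K;
         f = (\<lambda>z. complex_of_real (\<phi> z));
         int_E = spectral_integral (L2 \<omega>) E f g;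
         int_EN = atomic_integral N (lam ` {..<N}) (mpedmd_measure N G R Vh lam) f
     in hnorm (L2 \<omega>) (int_E - Psi N \<psi> (int_EN *\<^sub>v c))
        \<le> pi / ln 2 * (ln (real L) / real L
                 * (hnorm (L2 \<omega>) g + Psi_opnorm \<omega> N \<psi> (mat_inv R) * vnorm (R *\<^sub>v c))
               + hnorm (L2 \<omega>) (g - Psi N \<psi> c) * (SUP z\<in>circle. \<bar>\<phi> z\<bar>)
               + (\<Sum>l=1..L.
                   (hnorm (L2 \<omega>) ((K ^^ l) g - Psi N \<psi> ((KK ^\<^sub>m l) *\<^sub>v c))
                    + hnorm (L2 \<omega>) ((Ks ^^ l) g - Psi N \<psi> ((mat_inv KK ^\<^sub>m l) *\<^sub>v c)))
                   / real l))"
    unfolding Let_def fun_diff_def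
    unfolding p_def[symmetric] q_def[symmetric] B_def[symmetric] K_def[symmetric] KK_def[symmetric]
    unfolding Ks_def[symmetric]
    unfolding r_def[symmetric] distrib_left sum_distrib_left mult.assoc[symmetric]
    using error main head tail by (simp only: mult.assoc)
qed

end
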